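(* Let $\alpha\in(0,2)$, $d>\alpha$ and $\beta\ge0$. Then the operator $L_0=-(1+|x|)^\beta(-\Delta)^{\alpha/2}$ generates a compact semigroup on $L^2(\mathbb{R}^d;(1+|x|)^{-\beta}\,dx)$ if and only if $\beta>\alpha$.
   Context: Let $D(f,g)=\frac12\int_{\mathbb{R}^d\times\mathbb{R}^d}(f(x)-f(y))(g(x)-g(y))\frac{c_{d,\alpha}}{|x-y|^{d+\alpha}}\,dx\,dy$ with domain $\mathscr{D}(D)=\{f\in L^2(\mathbb{R}^d;dx):D(f,f)<\infty\}$ be the Dirichlet form on $L^2(\mathbb{R}^d;dx)$ of the rotationally symmetric $\alpha$-stable process, whose generator is $-(-\Delta)^{\alpha/2}$ ($c_{d,\alpha}>0$ is the corresponding normalizing constant). Let $\mathscr{D}_e(D)$ be its extended Dirichlet space (the a.e. finite measurable functions that are a.e. limits of $D$-Cauchy sequences in $\mathscr{D}(D)$, with $D$ extended accordingly). Put $\mu(dx)=(1+|x|)^{-\beta}dx$. The operator $L_0$ is the self-adjoint operator on $L^2(\mathbb{R}^d;\mu)$ that is the generator of the regular Dirichlet form $(D,\mathscr{D}(D^\mu))$ on $L^2(\mathbb{R}^d;\mu)$, where $\mathscr{D}(D^\mu)=\mathscr{D}_e(D)\cap L^2(\mathbb{R}^d;\mu)$; $C_c^\infty(\mathbb{R}^d)$ is a core. The semigroup generated by $L_0$ is $P_t=e^{tL_0}$; it is called compact if $P_t$ is a compact operator on $L^2(\mathbb{R}^d;\mu)$ for every $t>0$. *)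

theory Defs
  imports "HOL-Analysis.Analysis"
begin

text \<open>
  Elements of \<open>L\<^sup>2(M)\<close> are represented by functions, not by equivalence classes: every
  identity between elements is an identity almost everywhere, and operators given by their
  graph contain with a pair also all pairs that agree with it almost everywhere.
\<close>

definition L2 :: "'b measure \<Rightarrow> ('b \<Rightarrow> real) set" where
  "L2 M = {f \<in> borel_measurable M. integrable M (\<lambda>x. (f x)\<^sup>2)}"

definition L2_inner :: "'b measure \<Rightarrow> ('b \<Rightarrow> real) \<Rightarrow> ('b \<Rightarrow> real) \<Rightarrow> real" where
  "L2_inner M f g = (LINT x|M. f x * g x)"

definition L2_norm :: "'b measure \<Rightarrow> ('b \<Rightarrow> real) \<Rightarrow> real" where
  "L2_norm M f = sqrt (L2_inner M f f)"

definition L2_bounded_operator :: "'b measure \<Rightarrow> (('b \<Rightarrow> real) \<Rightarrow> 'b \<Rightarrow> real) \<Rightarrow> bool" where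
  "L2_bounded_operator M T \<longleftrightarrow>
     (\<forall>f\<in>L2 M. T f \<in> L2 M) \<and>
     (\<forall>f\<in>L2 M. \<forall>g\<in>L2 M. AE x in M. T (\<lambda>y. f y + g y) x = T f x + T g x) \<and>
     (\<forall>c. \<forall>f\<in>L2 M. AE x in M. T (\<lambda>y. c * f y) x = c * T f x) \<and>
     (\<exists>K. \<forall>f\<in>L2 M. L2_norm M (T f) \<le> K * L2_norm M f)"

definition L2_compact_operator :: "'b measure \<Rightarrow> (('b \<Rightarrow> real) \<Rightarrow> 'b \<Rightarrow> real) \<Rightarrow> bool" where
  "L2_compact_operator M T \<longleftrightarrow>
     L2_bounded_operator M T \<and>
     (\<forall>f :: nat \<Rightarrow> 'b \<Rightarrow> real. (\<forall>n. f n \<in> L2 M) \<longrightarrow> bounded (range (\<lambda>n. L2_norm M (f n))) \<longrightarrow>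
        (\<exists>r g. strict_mono r \<and> g \<in> L2 M \<and>
           (\<lambda>n. L2_norm M (\<lambda>x. T (f (r n)) x - g x)) \<longlonglongrightarrow> 0))"

text \<open>Strongly continuous semigroups; only the parameters \<open>t \<ge> 0\<close> are relevant.\<close>

definition L2_C0_semigroup :: "'b measure \<Rightarrow> (real \<Rightarrow> ('b \<Rightarrow> real) \<Rightarrow> 'b \<Rightarrow> real) \<Rightarrow> bool" where
  "L2_C0_semigroup M P \<longleftrightarrow>
     (\<forall>t\<ge>0. L2_bounded_operator M (P t)) \<and>
     (\<forall>f\<in>L2 M. AE x in M. P 0 f x = f x) \<and>
     (\<forall>s\<ge>0. \<forall>t\<ge>0. \<forall>f\<in>L2 M. AE x in M. P (s + t) f x = P s (P t f) x) \<and>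
     (\<forall>f\<in>L2 M. ((\<lambda>t. L2_norm M (\<lambda>x. P t f x - f x)) \<longlongrightarrow> 0) (at_right 0))"

definition semigroup_generator ::
  "'b measure \<Rightarrow> (real \<Rightarrow> ('b \<Rightarrow> real) \<Rightarrow> 'b \<Rightarrow> real) \<Rightarrow> (('b \<Rightarrow> real) \<times> ('b \<Rightarrow> real)) set" where
  "semigroup_generator M P =
     {(f, g). f \<in> L2 M \<and> g \<in> L2 M \<and>
        ((\<lambda>t. L2_norm M (\<lambda>x. (P t f x - f x) / t - g x)) \<longlongrightarrow> 0) (at_right 0)}"

text \<open>A strongly continuous semigroup is determined by its generator, so there is at most one
  candidate for \<open>P\<close> (up to equality almost everywhere).\<close>

definition generates_compact_semigroup ::
  "'b measure \<Rightarrow> (('b \<Rightarrow> real) \<times> ('b \<Rightarrow> real)) set \<Rightarrow> bool" where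
  "generates_compact_semigroup M A \<longleftrightarrow>
     (\<exists>P. L2_C0_semigroup M P \<and> semigroup_generator M P = A \<and>
          (\<forall>t>0. L2_compact_operator M (P t)))"

text \<open>The nonpositive self-adjoint operator \<open>A\<close> (as a graph) of a closed form \<open>E\<close> with domain
  \<open>F\<close>, i.e. \<open>E(u, v) = (- A u, v)\<close> for all \<open>v\<close> in \<open>F\<close>.\<close>

definition form_generator ::
  "'b measure \<Rightarrow> (('b \<Rightarrow> real) \<Rightarrow> ('b \<Rightarrow> real) \<Rightarrow> real) \<Rightarrow> ('b \<Rightarrow> real) set \<Rightarrow>
    (('b \<Rightarrow> real) \<times> ('b \<Rightarrow> real)) set" where
  "form_generator M E F =
     {(u, w). u \<in> F \<and> w \<in> L2 M \<and> (\<forall>v\<in>F. E u v = L2_inner M (\<lambda>x. - w x) v)}"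

text \<open>The constant for which the form below is that of \<open>(-\<Delta>)\<^bsup>\<alpha>/2\<^esup>\<close>, the Fourier multiplier
  \<open>\<bar>\<xi>\<bar>\<^bsup>\<alpha>\<^esup>\<close>.\<close>

definition stable_const :: "nat \<Rightarrow> real \<Rightarrow> real" where
  "stable_const d \<alpha> =
     \<alpha> * 2 powr (\<alpha> - 1) * Gamma ((real d + \<alpha>) / 2) / (pi powr (real d / 2) * Gamma (1 - \<alpha> / 2))"

lemma stable_const_pos:
  assumes "0 < \<alpha>" "\<alpha> < 2"
  shows "stable_const d \<alpha> > 0"
  unfolding stable_const_def using assms
  by (intro divide_pos_pos mult_pos_pos Gamma_real_pos) auto

definition stable_integrand ::
  "real \<Rightarrow> ('a::euclidean_space \<Rightarrow> real) \<Rightarrow> ('a \<Rightarrow> real) \<Rightarrow> 'a \<times> 'a \<Rightarrow> real" where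
  "stable_integrand \<alpha> f g = (\<lambda>(x, y).
     (f x - f y) * (g x - g y) *
       (stable_const DIM('a) \<alpha> / norm (x - y) powr (real DIM('a) + \<alpha>)))"

definition stable_form ::
  "real \<Rightarrow> ('a::euclidean_space \<Rightarrow> real) \<Rightarrow> ('a \<Rightarrow> real) \<Rightarrow> real" where
  "stable_form \<alpha> f g = 1 / 2 * (LINT z|(lborel \<Otimes>\<^sub>M lborel). stable_integrand \<alpha> f g z)"

text \<open>As the integrand of \<open>D(f, f)\<close> is nonnegative, \<open>D(f, f) < \<infinity>\<close> means that it is
  integrable.\<close>

definition stable_dom :: "real \<Rightarrow> ('a::euclidean_space \<Rightarrow> real) set" where
  "stable_dom \<alpha> = {f \<in> L2 lborel. integrable (lborel \<Otimes>\<^sub>M lborel) (stable_integrand \<alpha> f f)}"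

definition approximating_sequence ::
  "real \<Rightarrow> (nat \<Rightarrow> 'a::euclidean_space \<Rightarrow> real) \<Rightarrow> ('a \<Rightarrow> real) \<Rightarrow> bool" where
  "approximating_sequence \<alpha> u f \<longleftrightarrow>
     (\<forall>n. u n \<in> stable_dom \<alpha>) \<and>
     (\<forall>e>0. \<exists>N. \<forall>m\<ge>N. \<forall>n\<ge>N.
        stable_form \<alpha> (\<lambda>x. u m x - u n x) (\<lambda>x. u m x - u n x) < e) \<and>
     (AE x in lborel. (\<lambda>n. u n x) \<longlonglongrightarrow> f x)"

definition extended_dom :: "real \<Rightarrow> ('a::euclidean_space \<Rightarrow> real) set" where
  "extended_dom \<alpha> = {f \<in> borel_measurable lborel. \<exists>u. approximating_sequence \<alpha> u f}"

text \<open>The limit exists and does not depend on the approximating sequences; the value is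
  meaningful only for \<open>f\<close> and \<open>g\<close> in the extended Dirichlet space.\<close>

definition extended_form ::
  "real \<Rightarrow> ('a::euclidean_space \<Rightarrow> real) \<Rightarrow> ('a \<Rightarrow> real) \<Rightarrow> real" where
  "extended_form \<alpha> f g =
     (THE c. \<forall>u v. approximating_sequence \<alpha> u f \<longrightarrow> approximating_sequence \<alpha> v g \<longrightarrow>
        (\<lambda>n. stable_form \<alpha> (u n) (v n)) \<longlonglongrightarrow> c)"

definition weighted_measure :: "real \<Rightarrow> 'a::euclidean_space measure" where
  "weighted_measure \<beta> = density lborel (\<lambda>x. ennreal ((1 + norm x) powr (- \<beta>)))"

definition time_changed_dom :: "real \<Rightarrow> real \<Rightarrow> ('a::euclidean_space \<Rightarrow> real) set" where
  "time_changed_dom \<alpha> \<beta> = extended_dom \<alpha> \<inter> L2 (weighted_measure \<beta>)"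

text \<open>The operator \<open>L\<^sub>0 = - (1 + \<bar>x\<bar>)\<^bsup>\<beta>\<^esup> (-\<Delta>)\<^bsup>\<alpha>/2\<^esup>\<close> on \<open>L\<^sup>2(\<real>\<^bsup>d\<^esup>; \<mu>)\<close>, defined through its form.\<close>

definition L0_operator ::
  "real \<Rightarrow> real \<Rightarrow> (('a::euclidean_space \<Rightarrow> real) \<times> ('a \<Rightarrow> real)) set" where
  "L0_operator \<alpha> \<beta> =
     form_generator (weighted_measure \<beta>) (extended_form \<alpha>) (time_changed_dom \<alpha> \<beta>)"

end

theory Submission
  imports Defs "HOL-Library.Function_Algebras" "HOL-Library.Diagonal_Subsequence"
begin

text \<open>
  The form \<open>D\<close> is half the \<open>L\<^sup>2\<close> inner product of the increments
  \<open>(f x - f y) \<bar>x - y\<bar>\<^bsup>-(d+\<alpha>)/2\<^esup>\<close>. Comparing mean squares over consecutive dyadic shells gives the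
  Hardy inequality \<open>\<integral> f\<^sup>2 (1 + \<bar>x\<bar>)\<^bsup>-\<alpha>\<^esup> dx \<le> C D(f, f)\<close>, which describes the extended Dirichlet space and
  makes the form closed.

  If \<open>\<beta> > \<alpha>\<close>, the Hardy inequality makes the tails in \<open>L\<^sup>2(\<mu>)\<close> small uniformly on sets of bounded
  energy, and averaging over small cubes (a Poincare inequality) gives compactness on balls. So the form domain
  embeds compactly, the variational eigenfunctions form an orthogonal basis, and the semigroup
  \<open>\<Sum>n. exp (- l\<^sub>n t) \<langle>f, e\<^sub>n\<rangle> e\<^sub>n\<close> is compact because it maps bounded sets to sets of bounded energy.

  If \<open>\<beta> \<le> \<alpha>\<close>, a bump on the shell \<open>1 < \<bar>x\<bar> < 2\<close> dilated by \<open>R = 2\<^bsup>k\<^esup>\<close> and normalised in \<open>L\<^sup>2(\<mu>)\<close> has energy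
  of order \<open>R\<^bsup>\<beta>-\<alpha>\<^esup>\<close>, hence bounded, although these functions are orthonormal. Such a sequence cannot
  exist if the semigroup is compact.
\<close>

section \<open>Semi-inner product spaces\<close>

text \<open>The threshold is dictated by scaling: dilation by \<open>R\<close> multiplies the energy
  by \<open>R powr (d - \<alpha>)\<close> and the mass far from the origin by about
  \<open>R powr (d - \<beta>)\<close>. The condition \<open>\<alpha> < d\<close> enters through
  volumes: the shells grow by \<open>2 ^ d\<close>, which beats the factor
  \<open>2 powr \<alpha>\<close> and makes the comparison of neighbouring shells a contraction. With
  weight exponent \<alpha> the Hardy inequality is scale invariant. It identifies limits for every
  \<beta>, and for \<open>\<beta> > \<alpha>\<close> it leaves a power of the radius to spare.

  Two obstacles shape the abstract part. Elements are functions rather than classes, so inner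
  products are semidefinite, limits are not unique, and an identity between operators says that a
  seminorm vanishes. In the direction from compactness to \<open>\<beta> > \<alpha>\<close> the
  semigroup is an arbitrary strongly continuous one with compact operators and the given generator;
  neither contractivity nor self-adjointness is part of the definition. Hence a uniform bound for
  small times is extracted from the uniform boundedness principle; with it, a bound on the generator
  makes \<open>P t u\<close> close to \<open>u\<close>.\<close>

lemma quadratic_nonneg_linear_coeff:
  fixes a b :: real
  assumes "\<And>t. 0 \<le> t\<^sup>2 * a + 2 * t * b"
  shows "b = 0"
proof (rule ccontr)
  assume b: "b \<noteq> 0"
  have a: "0 \<le> a" using assms[of 1] assms[of "-1"] by simp
  \<comment> \<open>The minimiser would be \<open>- b / a\<close>; dividing by \<open>a + 1\<close>
    also covers \<open>a = 0\<close> and still produces a negative value.\<close>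
  define t where "t = - b / (a + 1)"
  have "b = - t * (a + 1)" using a by (simp add: t_def)
  have "t\<^sup>2 * a + 2 * t * (- t * (a + 1)) = - (t\<^sup>2 * (a + 2))"
    by (simp add: algebra_simps power2_eq_square)
  then have "t\<^sup>2 * a + 2 * t * b = - (t\<^sup>2 * (a + 2))"
    using \<open>b = - t * (a + 1)\<close> by simp
  also have "\<dots> < 0" using a b by (simp add: t_def)
  finally show False using assms[of t] by simp
qed

text \<open>The form is only assumed to be positive semidefinite, as functions that vanish almost
  everywhere have norm zero.\<close>

locale semi_inner =
  fixes S :: "'v::real_vector set" and ip :: "'v \<Rightarrow> 'v \<Rightarrow> real"
  assumes subspace_S: "subspace S"
    and ip_commute: "x \<in> S \<Longrightarrow> y \<in> S \<Longrightarrow> ip x y = ip y x"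
    and ip_add_left: "x \<in> S \<Longrightarrow> y \<in> S \<Longrightarrow> z \<in> S \<Longrightarrow> ip (x + y) z = ip x z + ip y z"
    and ip_scale_left: "x \<in> S \<Longrightarrow> z \<in> S \<Longrightarrow> ip (c *\<^sub>R x) z = c * ip x z"
    and ip_nonneg: "x \<in> S \<Longrightarrow> 0 \<le> ip x x"
begin

lemma mem_zero [simp, intro]: "0 \<in> S"
  and mem_add [simp, intro]: "x \<in> S \<Longrightarrow> y \<in> S \<Longrightarrow> x + y \<in> S"
  and mem_diff [simp, intro]: "x \<in> S \<Longrightarrow> y \<in> S \<Longrightarrow> x - y \<in> S"
  and mem_scale [simp, intro]: "x \<in> S \<Longrightarrow> c *\<^sub>R x \<in> S"
  and mem_minus [simp, intro]: "x \<in> S \<Longrightarrow> - x \<in> S"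
  and mem_sum [simp, intro]: "(\<And>i. i \<in> I \<Longrightarrow> f i \<in> S) \<Longrightarrow> sum f I \<in> S"
  using subspace_S
  by (auto intro: subspace_0 subspace_add subspace_diff subspace_scale subspace_neg subspace_sum)

lemma ip_add_right: "x \<in> S \<Longrightarrow> y \<in> S \<Longrightarrow> z \<in> S \<Longrightarrow> ip z (x + y) = ip z x + ip z y"
  by (simp add: ip_commute[of z] ip_add_left)

lemma ip_scale_right: "x \<in> S \<Longrightarrow> z \<in> S \<Longrightarrow> ip z (c *\<^sub>R x) = c * ip z x"
  by (simp add: ip_commute[of z] ip_scale_left)

lemma ip_minus_left: "x \<in> S \<Longrightarrow> z \<in> S \<Longrightarrow> ip (- x) z = - ip x z"
  using ip_scale_left[of x z "-1"] by simp

lemma ip_minus_right: "x \<in> S \<Longrightarrow> z \<in> S \<Longrightarrow> ip z (- x) = - ip z x"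
  using ip_scale_right[of x z "-1"] by simp

lemma ip_diff_left: "x \<in> S \<Longrightarrow> y \<in> S \<Longrightarrow> z \<in> S \<Longrightarrow> ip (x - y) z = ip x z - ip y z"
  using ip_add_left[of x "-y" z] by (simp add: ip_minus_left)

lemma ip_diff_right: "x \<in> S \<Longrightarrow> y \<in> S \<Longrightarrow> z \<in> S \<Longrightarrow> ip z (x - y) = ip z x - ip z y"
  by (simp add: ip_commute[of z] ip_diff_left)

lemma ip_zero_left [simp]: "z \<in> S \<Longrightarrow> ip 0 z = 0"
  using ip_scale_left[of 0 z 0] by simp

lemma ip_zero_right [simp]: "z \<in> S \<Longrightarrow> ip z 0 = 0"
  using ip_scale_right[of 0 z 0] by simp

lemma ip_sum_left:
  "(\<And>i. i \<in> I \<Longrightarrow> y i \<in> S) \<Longrightarrow> z \<in> S \<Longrightarrow> ip (\<Sum>i\<in>I. y i) z = (\<Sum>i\<in>I. ip (y i) z)"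
  by (induction I rule: infinite_finite_induct) (auto simp: ip_add_left)

lemma ip_sum_right:
  "(\<And>i. i \<in> I \<Longrightarrow> y i \<in> S) \<Longrightarrow> z \<in> S \<Longrightarrow> ip z (\<Sum>i\<in>I. y i) = (\<Sum>i\<in>I. ip z (y i))"
  by (induction I rule: infinite_finite_induct) (auto simp: ip_add_right)

lemmas ip_simps = ip_add_left ip_add_right ip_diff_left ip_diff_right ip_scale_left ip_scale_right
  ip_minus_left ip_minus_right ip_zero_left ip_zero_right

definition nrm :: "'v \<Rightarrow> real" where "nrm x = sqrt (ip x x)"

lemma nrm_nonneg: "x \<in> S \<Longrightarrow> 0 \<le> nrm x"
  by (simp add: nrm_def ip_nonneg)

lemma nrm_sq: "x \<in> S \<Longrightarrow> (nrm x)\<^sup>2 = ip x x"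
  by (simp add: nrm_def ip_nonneg)

lemma nrm_zero [simp]: "nrm 0 = 0"
  by (simp add: nrm_def)

lemma ip_expand:
  assumes "x \<in> S" "y \<in> S"
  shows "ip (x + t *\<^sub>R y) (x + t *\<^sub>R y) = ip x x + 2 * t * ip x y + t\<^sup>2 * ip y y"
  using assms by (simp add: ip_simps ip_commute[of y x] power2_eq_square algebra_simps)

lemma Cauchy_Schwarz:
  assumes x: "x \<in> S" and y: "y \<in> S"
  shows "\<bar>ip x y\<bar> \<le> nrm x * nrm y"
proof -
  let ?a = "ip x x" and ?b = "ip x y" and ?c = "ip y y"
  have q: "0 \<le> ?a + 2 * t * ?b + t\<^sup>2 * ?c" for t
    using ip_nonneg[of "x + t *\<^sub>R y"] x y by (simp add: ip_expand)
  have "?b\<^sup>2 \<le> ?a * ?c"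
  proof (cases "?c = 0")
    case True
    \<comment> \<open>A null vector \<open>y\<close> need not be zero. The quadratic polynomial is
      then affine in \<open>t\<close>, and a nonzero slope would give it the value \<open>-1\<close>
      at the chosen \<open>t\<close>.\<close>
    have "?b = 0"
    proof (rule ccontr)
      assume "?b \<noteq> 0"
      then show False using q[of "- (?a + 1) / (2 * ?b)"] True by (simp add: field_simps)
    qed
    then show ?thesis using True by simp
  next
    case False
    then have c: "?c > 0" using ip_nonneg[OF y] by simp
    have "0 \<le> ?c * (?a + 2 * (- ?b / ?c) * ?b + (- ?b / ?c)\<^sup>2 * ?c)"
      using q[of "- ?b / ?c"] c by (intro mult_nonneg_nonneg) auto
    also have "\<dots> = ?a * ?c - ?b\<^sup>2" using c by (simp add: field_simps power2_eq_square)
    finally show ?thesis by simp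
  qed
  then have "sqrt (?b\<^sup>2) \<le> sqrt (?a * ?c)" by (rule real_sqrt_le_mono)
  then show ?thesis by (simp add: nrm_def real_sqrt_mult)
qed

lemma nrm_scale: "x \<in> S \<Longrightarrow> nrm (c *\<^sub>R x) = \<bar>c\<bar> * nrm x"
  by (simp add: nrm_def ip_simps real_sqrt_mult flip: mult.assoc)

lemma nrm_minus: "x \<in> S \<Longrightarrow> nrm (- x) = nrm x"
  by (simp add: nrm_def ip_simps)

lemma nrm_diff_commute: "x \<in> S \<Longrightarrow> y \<in> S \<Longrightarrow> nrm (x - y) = nrm (y - x)"
  using nrm_minus[of "x - y"] by simp

lemma nrm_triangle:
  assumes "x \<in> S" "y \<in> S"
  shows "nrm (x + y) \<le> nrm x + nrm y"
proof (rule power2_le_imp_le)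
  have "(nrm (x + y))\<^sup>2 = (nrm x)\<^sup>2 + 2 * ip x y + (nrm y)\<^sup>2"
    using assms ip_expand[of x y 1] by (simp add: nrm_sq)
  also have "\<dots> \<le> (nrm x)\<^sup>2 + 2 * (nrm x * nrm y) + (nrm y)\<^sup>2"
    using Cauchy_Schwarz[OF assms] by simp
  finally show "(nrm (x + y))\<^sup>2 \<le> (nrm x + nrm y)\<^sup>2" by (simp add: power2_sum)
qed (use assms in \<open>simp add: nrm_nonneg\<close>)

lemma nrm_triangle_diff: "x \<in> S \<Longrightarrow> y \<in> S \<Longrightarrow> nrm (x - y) \<le> nrm x + nrm y"
  using nrm_triangle[of x "- y"] by (simp add: nrm_minus)

lemma nrm_triangle2:
  "x \<in> S \<Longrightarrow> y \<in> S \<Longrightarrow> z \<in> S \<Longrightarrow> nrm (x - z) \<le> nrm (x - y) + nrm (y - z)"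
  using nrm_triangle[of "x - y" "y - z"] by simp

lemma nrm_triangle_ineq2: "x \<in> S \<Longrightarrow> y \<in> S \<Longrightarrow> nrm x - nrm y \<le> nrm (x - y)"
  using nrm_triangle2[of x y 0] by simp

lemma ip_diff_le:
  assumes "x \<in> S" "y \<in> S"
  shows "ip (x - y) (x - y) \<le> 2 * ip x x + 2 * ip y y"
proof -
  have "ip (x - y) (x - y) + ip (x + y) (x + y) = 2 * ip x x + 2 * ip y y"
    using assms by (simp add: ip_simps)
  then show ?thesis using ip_nonneg[OF mem_add[OF assms]] by linarith
qed

lemma nrm_eq_cong:
  assumes "x \<in> S" "y \<in> S" "nrm (x - y) = 0"
  shows "nrm x = nrm y"
  using nrm_triangle_ineq2[of x y] nrm_triangle_ineq2[of y x] nrm_diff_commute[of x y] assms by simp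

section \<open>Convergence and Cauchy sequences in a seminorm\<close>

definition conv :: "(nat \<Rightarrow> 'v) \<Rightarrow> 'v \<Rightarrow> bool" where
  "conv u x \<longleftrightarrow> (\<lambda>n. nrm (u n - x)) \<longlonglongrightarrow> 0"

definition Cau :: "(nat \<Rightarrow> 'v) \<Rightarrow> bool" where
  "Cau u \<longleftrightarrow> (\<forall>e>0. \<exists>N. \<forall>m\<ge>N. \<forall>n\<ge>N. nrm (u m - u n) < e)"

lemma conv_ip:
  assumes u: "\<And>n. u n \<in> S" and x: "x \<in> S" and v: "\<And>n. v n \<in> S" and y: "y \<in> S"
    and cu: "conv u x" and cv: "conv v y"
  shows "(\<lambda>n. ip (u n) (v n)) \<longlonglongrightarrow> ip x y"
proof (rule LIM_zero_cancel, rule Lim_null_comparison)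
  show "\<forall>\<^sub>F n in sequentially. norm (ip (u n) (v n) - ip x y)
      \<le> nrm (u n - x) * (nrm (v n - y) + nrm y) + nrm x * nrm (v n - y)"
  proof (rule always_eventually, rule allI)
    fix n
    have "ip (u n) (v n) - ip x y = ip (u n - x) (v n) + ip x (v n - y)"
      using u v x y by (simp add: ip_simps)
    also have "\<bar>\<dots>\<bar> \<le> nrm (u n - x) * nrm (v n) + nrm x * nrm (v n - y)"
      using Cauchy_Schwarz[of "u n - x" "v n"] Cauchy_Schwarz[of x "v n - y"] u v x y by force
    also have "\<dots> \<le> nrm (u n - x) * (nrm (v n - y) + nrm y) + nrm x * nrm (v n - y)"
      using nrm_triangle[of "v n - y" y] u v x y
      by (intro add_right_mono mult_left_mono) (auto simp: nrm_nonneg)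
    finally show "norm (ip (u n) (v n) - ip x y)
      \<le> nrm (u n - x) * (nrm (v n - y) + nrm y) + nrm x * nrm (v n - y)" by simp
  qed
  show "(\<lambda>n. nrm (u n - x) * (nrm (v n - y) + nrm y) + nrm x * nrm (v n - y)) \<longlonglongrightarrow> 0"
    using cu cv unfolding conv_def by (auto intro!: tendsto_eq_intros)
qed

lemma conv_const: "conv (\<lambda>n. x) x"
  by (simp add: conv_def)

lemma conv_ip_left:
  "(\<And>n. u n \<in> S) \<Longrightarrow> x \<in> S \<Longrightarrow> y \<in> S \<Longrightarrow> conv u x \<Longrightarrow> (\<lambda>n. ip (u n) y) \<longlonglongrightarrow> ip x y"
  by (rule conv_ip[OF _ _ _ _ _ conv_const]) auto

lemma conv_subseq: "conv u x \<Longrightarrow> strict_mono r \<Longrightarrow> conv (\<lambda>n. u (r n)) x"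
  unfolding conv_def using LIMSEQ_subseq_LIMSEQ[of "\<lambda>n. nrm (u n - x)" 0 r] by (simp add: o_def)

lemma conv_imp_Cau:
  assumes "\<And>n. u n \<in> S" "x \<in> S" "conv u x"
  shows "Cau u"
  unfolding Cau_def
proof (intro allI impI)
  fix e :: real assume "e > 0"
  then have "\<forall>\<^sub>F n in sequentially. nrm (u n - x) < e / 2"
    using assms(3) unfolding conv_def by (intro order_tendstoD) auto
  then obtain N where N: "\<And>n. n \<ge> N \<Longrightarrow> nrm (u n - x) < e / 2"
    by (auto simp: eventually_sequentially)
  have "nrm (u m - u n) < e" if "m \<ge> N" "n \<ge> N" for m n
    using nrm_triangle2[of "u m" x "u n"] nrm_diff_commute[of x "u n"] N[of m] N[of n] that assms
    by simp
  then show "\<exists>N. \<forall>m\<ge>N. \<forall>n\<ge>N. nrm (u m - u n) < e" by blast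
qed

text \<open>A bound by a sum \<open>b m + b n\<close> is what the parallelogram identity yields for
  minimising sequences and what tails of convergent series yield for partial sums. By symmetry of
  the distance it suffices to treat \<open>m \<le> n\<close>.\<close>

lemma CauI:
  assumes u: "\<And>n. u n \<in> S" and b: "b \<longlonglongrightarrow> (0::real)"
    and le: "\<And>m n. m \<le> n \<Longrightarrow> ip (u m - u n) (u m - u n) \<le> b m + b n"
  shows "Cau u"
  unfolding Cau_def
proof (intro allI impI)
  fix e :: real assume e: "e > 0"
  then have "\<forall>\<^sub>F n in sequentially. b n < e\<^sup>2 / 2"
    using b by (intro order_tendstoD) auto
  then obtain N where N: "\<And>n. n \<ge> N \<Longrightarrow> b n < e\<^sup>2 / 2"
    by (auto simp: eventually_sequentially)
  have *: "nrm (u m - u n) < e" if "m \<ge> N" "n \<ge> N" "m \<le> n" for m n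
  proof (rule power2_less_imp_less)
    show "(nrm (u m - u n))\<^sup>2 < e\<^sup>2"
      using le[of m n] N[of m] N[of n] that u by (simp add: nrm_sq)
  qed (use e in simp)
  have "nrm (u m - u n) < e" if "m \<ge> N" "n \<ge> N" for m n
    using *[of m n] *[of n m] that nrm_diff_commute[of "u m" "u n"] u by (cases "m \<le> n") auto
  then show "\<exists>N. \<forall>m\<ge>N. \<forall>n\<ge>N. nrm (u m - u n) < e" by blast
qed

text \<open>Transfers the Cauchy property between seminorms: \<open>g\<close> is the distance in the
  other one, as when the Hardy inequality turns energy-Cauchy sequences into weighted
  \<open>L2\<close>-Cauchy sequences.\<close>

lemma CauI_dominated:
  fixes g :: "nat \<Rightarrow> nat \<Rightarrow> real"
  assumes K: "0 \<le> K" and le: "\<And>m n. nrm (u m - u n) \<le> K * g m n"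
    and g: "\<forall>e>0. \<exists>N. \<forall>m\<ge>N. \<forall>n\<ge>N. g m n < e"
  shows "Cau u"
  unfolding Cau_def
proof (intro allI impI)
  fix e :: real assume e: "e > 0"
  have K1: "0 < K + 1" using K by simp
  then have "0 < e / (K + 1)" using e by simp
  then obtain N where N: "\<And>m n. m \<ge> N \<Longrightarrow> n \<ge> N \<Longrightarrow> g m n < e / (K + 1)" using g by metis
  have "nrm (u m - u n) < e" if "m \<ge> N" "n \<ge> N" for m n
  proof -
    have "K * g m n \<le> K * (e / (K + 1))" using N[OF that] K by (intro mult_left_mono) auto
    also have "\<dots> < e" using e K1 by (simp add: field_simps)
    finally show ?thesis using le[of m n] by linarith
  qed
  then show "\<exists>N. \<forall>m\<ge>N. \<forall>n\<ge>N. nrm (u m - u n) < e" by blast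
qed

lemma Cau_add:
  assumes u: "\<And>n. u n \<in> S" and v: "\<And>n. v n \<in> S"
    and "Cau u" "Cau v"
  shows "Cau (\<lambda>n. u n + v n)"
  unfolding Cau_def
proof (intro allI impI)
  fix e :: real assume "e > 0"
  then have "e / 2 > 0" by simp
  then obtain N1 N2 where N1: "\<And>m n. m \<ge> N1 \<Longrightarrow> n \<ge> N1 \<Longrightarrow> nrm (u m - u n) < e / 2"
    and N2: "\<And>m n. m \<ge> N2 \<Longrightarrow> n \<ge> N2 \<Longrightarrow> nrm (v m - v n) < e / 2"
    using assms(3,4) unfolding Cau_def by metis
  have "nrm (u m + v m - (u n + v n)) < e" if "m \<ge> max N1 N2" "n \<ge> max N1 N2" for m n
  proof -
    have eq: "u m + v m - (u n + v n) = (u m - u n) + (v m - v n)" by (simp add: algebra_simps)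
    show ?thesis
      unfolding eq using nrm_triangle[OF mem_diff[OF u u] mem_diff[OF v v], of m n m n] N1[of m n] N2[of m n] that
      by simp
  qed
  then show "\<exists>N. \<forall>m\<ge>N. \<forall>n\<ge>N. nrm (u m + v m - (u n + v n)) < e" by blast
qed

lemma Cau_scale:
  assumes u: "\<And>n. u n \<in> S" and C: "Cau u"
  shows "Cau (\<lambda>n. c *\<^sub>R u n)"
  unfolding Cau_def
proof (intro allI impI)
  fix e :: real assume e: "e > 0"
  then have "e / (\<bar>c\<bar> + 1) > 0" by (intro divide_pos_pos) auto
  then obtain N where N: "\<And>m n. m \<ge> N \<Longrightarrow> n \<ge> N \<Longrightarrow> nrm (u m - u n) < e / (\<bar>c\<bar> + 1)"
    using C unfolding Cau_def by metis
  have "nrm (c *\<^sub>R u m - c *\<^sub>R u n) < e" if "m \<ge> N" "n \<ge> N" for m n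
  proof -
    have "nrm (c *\<^sub>R u m - c *\<^sub>R u n) = \<bar>c\<bar> * nrm (u m - u n)"
      using nrm_scale[OF mem_diff[OF u u], of c m n] by (simp only: scaleR_diff_right)
    also have "\<dots> \<le> (\<bar>c\<bar> + 1) * nrm (u m - u n)"
      using nrm_nonneg[OF mem_diff[OF u u], of m n] by (intro mult_right_mono) auto
    also have "\<dots> < e" using N[OF that] by (simp add: field_simps)
    finally show ?thesis .
  qed
  then show "\<exists>N. \<forall>m\<ge>N. \<forall>n\<ge>N. nrm (c *\<^sub>R u m - c *\<^sub>R u n) < e" by blast
qed

lemma Cau_conv_subseq:
  assumes u: "\<And>n. u n \<in> S" and x: "x \<in> S" and C: "Cau u"
    and r: "strict_mono r" and c: "conv (\<lambda>n. u (r n)) x"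
  shows "conv u x"
  unfolding conv_def
proof (rule LIMSEQ_I)
  fix e :: real assume "e > 0"
  then have e: "e / 2 > 0" by simp
  then obtain N where N: "\<And>m n. m \<ge> N \<Longrightarrow> n \<ge> N \<Longrightarrow> nrm (u m - u n) < e / 2"
    using C unfolding Cau_def by metis
  have "\<forall>\<^sub>F n in sequentially. nrm (u (r n) - x) < e / 2 \<and> n \<ge> N"
    using c e unfolding conv_def by (intro eventually_conj order_tendstoD eventually_ge_at_top) auto
  then obtain k where k: "nrm (u (r k) - x) < e / 2" "k \<ge> N" by (auto simp: eventually_sequentially)
  have rk: "r k \<ge> N" using k(2) seq_suble[OF r, of k] by simp
  have "norm (nrm (u n - x) - 0) < e" if "n \<ge> N" for n
    using nrm_triangle2[OF u u x, of n "r k"] N[OF that rk] k(1) nrm_nonneg[OF mem_diff[OF u x], of n] by simp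
  then show "\<exists>no. \<forall>n\<ge>no. norm (nrm (u n - x) - 0) < e" by blast
qed

end

section \<open>Complete spaces: Riesz representation and uniform boundedness\<close>

locale semi_hilbert = semi_inner S ip for S :: "'v::real_vector set" and ip +
  assumes complete: "(\<And>n. u n \<in> S) \<Longrightarrow> Cau u \<Longrightarrow> \<exists>x\<in>S. conv u x"
begin

text \<open>Variational proof: minimise \<open>G u = ip u u - 2 * \<phi> u\<close>. The
  parallelogram identity makes minimising sequences Cauchy, and the vanishing first variation at the
  limit is the representation.\<close>

lemma Riesz:
  assumes add: "\<And>x y. x \<in> S \<Longrightarrow> y \<in> S \<Longrightarrow> \<phi> (x + y) = \<phi> x + \<phi> y"
    and scale: "\<And>x c. x \<in> S \<Longrightarrow> \<phi> (c *\<^sub>R x) = c * \<phi> x"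
    and bdd: "\<And>x. x \<in> S \<Longrightarrow> \<bar>\<phi> x\<bar> \<le> K * nrm x"
  shows "\<exists>u\<in>S. \<forall>v\<in>S. ip u v = \<phi> v"
proof -
  define G where "G u = ip u u - 2 * \<phi> u" for u
  have low: "- K\<^sup>2 \<le> G u" if "u \<in> S" for u
  proof -
    have "0 \<le> (nrm u - K)\<^sup>2" by simp
    then show ?thesis using bdd[OF that] nrm_sq[OF that] unfolding G_def by (simp add: power2_diff mult.commute)
  qed
  have bb: "bdd_below (G ` S)" using low by (auto intro!: bdd_belowI2[where m = "- K\<^sup>2"])
  define m where "m = (INF u\<in>S. G u)"
  have mle: "m \<le> G u" if "u \<in> S" for u unfolding m_def using bb that by (rule cINF_lower)
  have "\<exists>u\<in>S. G u < m + 1 / real (Suc n)" for n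
  proof (rule ccontr)
    assume "\<not> ?thesis"
    then have "\<forall>u\<in>S. m + 1 / real (Suc n) \<le> G u" by force
    then have "m + 1 / real (Suc n) \<le> m" unfolding m_def by (intro cINF_greatest) auto
    then show False by (simp add: field_simps)
  qed
  then obtain u where u: "\<And>n. u n \<in> S" and Gu: "\<And>n. G (u n) < m + 1 / real (Suc n)" by metis
  have "Cau u"
  proof (rule CauI[where b = "\<lambda>n. 2 * inverse (real (Suc n))"])
    show "(\<lambda>n. 2 * inverse (real (Suc n))) \<longlonglongrightarrow> 0"
      using tendsto_mult[OF tendsto_const[of 2] LIMSEQ_inverse_real_of_nat] by simp
    fix k n
    \<comment> \<open>Parallelogram identity in which the linear parts of \<open>G\<close> cancel;
      the midpoint has \<open>G\<close> at least \<open>m\<close>.\<close>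
    have "ip (u k - u n) (u k - u n) = 2 * G (u k) + 2 * G (u n) - 4 * G ((1/2) *\<^sub>R (u k + u n))"
      unfolding G_def using u by (simp add: ip_simps add scale ip_commute[of "u n" "u k"] algebra_simps)
    also have "\<dots> \<le> 2 * (m + 1 / real (Suc k)) + 2 * (m + 1 / real (Suc n)) - 4 * m"
      using Gu[of k] Gu[of n] mle[of "(1/2) *\<^sub>R (u k + u n)"] u by (smt (verit) mem_add mem_scale)
    finally show "ip (u k - u n) (u k - u n) \<le> 2 * inverse (real (Suc k)) + 2 * inverse (real (Suc n))"
      by (simp add: divide_inverse)
  qed (rule u)
  then obtain x where x: "x \<in> S" and cx: "conv u x" using complete u by blast
  have "(\<lambda>n. \<phi> (u n)) \<longlonglongrightarrow> \<phi> x"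
  proof (rule LIM_zero_cancel, rule Lim_null_comparison)
    show "\<forall>\<^sub>F n in sequentially. norm (\<phi> (u n) - \<phi> x) \<le> K * nrm (u n - x)"
    proof (rule always_eventually, rule allI)
      fix n
      have "\<phi> (u n) = \<phi> (u n - x) + \<phi> x" using add[of "u n - x" x] u x by simp
      then show "norm (\<phi> (u n) - \<phi> x) \<le> K * nrm (u n - x)"
        using bdd[of "u n - x"] u x by simp
    qed
    show "(\<lambda>n. K * nrm (u n - x)) \<longlonglongrightarrow> 0"
      using cx unfolding conv_def by (auto intro: tendsto_mult_right_zero)
  qed
  then have lim: "(\<lambda>n. G (u n)) \<longlonglongrightarrow> G x"
    unfolding G_def using conv_ip[OF u x u x cx cx] by (intro tendsto_intros)
  have "(\<lambda>n. m + 1 / real (Suc n)) \<longlonglongrightarrow> m + 0"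
    using LIMSEQ_inverse_real_of_nat by (intro tendsto_intros) (simp add: divide_inverse)
  then have Gx: "G x \<le> m"
    using lim Gu by (intro LIMSEQ_le[OF lim]) (auto intro: less_imp_le)
  have "ip x v = \<phi> v" if v: "v \<in> S" for v
  proof -
    have "0 \<le> t\<^sup>2 * ip v v + 2 * t * (ip x v - \<phi> v)" for t
    proof -
      have "G (x + t *\<^sub>R v) = G x + t\<^sup>2 * ip v v + 2 * t * (ip x v - \<phi> v)"
        unfolding G_def using x v by (simp add: ip_expand add scale algebra_simps)
      then show ?thesis using mle[of "x + t *\<^sub>R v"] Gx x v by simp
    qed
    then have "ip x v - \<phi> v = 0" by (rule quadratic_nonneg_linear_coeff)
    then show ?thesis by simp
  qed
  then show ?thesis using x by blast
qed

text \<open>Sokal's elementary proof: if the optimal constants \<open>K (N k)\<close> exceed \<open>4 ^ k\<close>, moving from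
  \<open>y k\<close> by \<open>\<plusminus> 3\<^bsup>-k\<^esup> \<xi> k\<close> with a suitable sign makes \<open>q (N k)\<close> at least \<open>2/3 * 3\<^bsup>-k\<^esup> K (N k)\<close>, of
  which all the later steps together undo at most three quarters.\<close>

lemma uniform_boundedness:
  fixes q :: "nat \<Rightarrow> 'v \<Rightarrow> real"
  assumes sub: "\<And>n x y. x \<in> S \<Longrightarrow> y \<in> S \<Longrightarrow> q n (x + y) \<le> q n x + q n y"
    and hom: "\<And>n x c. x \<in> S \<Longrightarrow> q n (c *\<^sub>R x) = \<bar>c\<bar> * q n x"
    and bdd: "\<And>n. \<exists>K. \<forall>x\<in>S. q n x \<le> K * nrm x"
    and pw: "\<And>x. x \<in> S \<Longrightarrow> \<exists>B. \<forall>n. q n x \<le> B"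
  shows "\<exists>K. \<forall>n. \<forall>x\<in>S. q n x \<le> K * nrm x"
proof -
  define B where "B = {x \<in> S. nrm x \<le> 1}"
  define K where "K n = (SUP x\<in>B. q n x)" for n
  have qm: "q n (- x) = q n x" if "x \<in> S" for n x using hom[OF that, of n "-1"] by simp
  have q0: "q n 0 = 0" for n using hom[of 0 n 0] by simp
  have bb: "bdd_above (q n ` B)" for n
  proof -
    obtain C where C: "\<forall>x\<in>S. q n x \<le> C * nrm x" using bdd by blast
    have "q n x \<le> \<bar>C\<bar>" if "x \<in> B" for x
    proof -
      have "q n x \<le> C * nrm x" using C that by (simp add: B_def)
      also have "\<dots> \<le> \<bar>C\<bar> * 1" using that by (intro mult_mono) (auto simp: B_def nrm_nonneg)
      finally show ?thesis by simp
    qed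
    then show ?thesis by (auto intro!: bdd_aboveI2)
  qed
  have qK: "q n x \<le> K n * nrm x" if x: "x \<in> S" for n x
  proof (cases "nrm x = 0")
    case True
    \<comment> \<open>A null vector cannot be normalised into \<open>B\<close>, but boundedness of
      the single \<open>q n\<close> already gives \<open>q n x \<le> 0\<close> there.\<close>
    obtain C where "\<forall>x\<in>S. q n x \<le> C * nrm x" using bdd by blast
    then have "q n x \<le> C * nrm x" using x by blast
    then show ?thesis using True by simp
  next
    case False
    then have p: "nrm x > 0" using nrm_nonneg[OF x] by simp
    have "q n ((1 / nrm x) *\<^sub>R x) \<le> K n"
      unfolding K_def using p x by (intro cSUP_upper bb) (auto simp: B_def nrm_scale)
    then show ?thesis using p x by (simp add: hom field_simps)
  qed
  have "\<exists>C. \<forall>n. K n \<le> C"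
  proof (rule ccontr)
    assume "\<not> ?thesis"
    then have "\<forall>k. \<exists>n. 4 ^ k < K n" by (meson not_le)
    then obtain N where N: "\<And>k. 4 ^ k < K (N k)" by metis
    have Kp: "0 < K (N k)" for k by (rule less_trans[OF _ N]) simp
    have "\<exists>x\<in>B. 2 / 3 * K (N k) < q (N k) x" for k
    proof (rule ccontr)
      assume "\<not> ?thesis"
      then have "\<forall>x\<in>B. q (N k) x \<le> 2 / 3 * K (N k)" by force
      then have "K (N k) \<le> 2 / 3 * K (N k)"
        unfolding K_def using mem_zero by (intro cSUP_least) (auto simp: B_def simp del: mem_zero)
      then show False using Kp[of k] by simp
    qed
    then obtain \<xi> where \<xi>: "\<And>k. \<xi> k \<in> B" and q\<xi>: "\<And>k. 2 / 3 * K (N k) < q (N k) (\<xi> k)" by metis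
    have \<xi>S: "\<xi> k \<in> S" and \<xi>1: "nrm (\<xi> k) \<le> 1" for k using \<xi>[of k] by (auto simp: B_def)
    have step: "\<exists>z. z \<in> S \<and> nrm (z - y) \<le> (1/3) ^ k \<and> (1/3) ^ k * q (N k) (\<xi> k) \<le> q (N k) z"
      if y: "y \<in> S" for y k
    proof -
      define h where "h = (1/3::real) ^ k *\<^sub>R \<xi> k"
      have h: "h \<in> S" and nh: "nrm h \<le> (1/3) ^ k" and qh: "q (N k) h = (1/3) ^ k * q (N k) (\<xi> k)"
        using \<xi>S[of k] \<xi>1[of k] by (auto simp: h_def nrm_scale hom mult_left_le)
      \<comment> \<open>Since \<open>2 h\<close> is the difference of \<open>y + h\<close> and
        \<open>y - h\<close>, at least one of the two signs gives a value no smaller than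
        \<open>q (N k) h\<close>.\<close>
      have "2 * q (N k) h = q (N k) ((y + h) + - (y - h))"
        using hom[OF h, of "N k" 2] by (simp add: scaleR_2)
      also have "\<dots> \<le> q (N k) (y + h) + q (N k) (y - h)"
        using sub[of "y + h" "- (y - h)"] qm[of "y - h"] y h by (metis mem_add mem_diff mem_minus)
      finally have "q (N k) h \<le> q (N k) (y + h) \<or> q (N k) h \<le> q (N k) (y - h)" by linarith
      then show ?thesis
      proof
        assume "q (N k) h \<le> q (N k) (y + h)"
        then show ?thesis using y h nh qh by (intro exI[of _ "y + h"]) auto
      next
        assume "q (N k) h \<le> q (N k) (y - h)"
        then show ?thesis using y h nh qh
          by (intro exI[of _ "y - h"]) (auto simp: nrm_minus)
      qed
    qed
    define y where "y = rec_nat 0 (\<lambda>k y. SOME z. z \<in> S \<and> nrm (z - y) \<le> (1/3) ^ k \<and>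
        (1/3) ^ k * q (N k) (\<xi> k) \<le> q (N k) z)"
    have y0: "y 0 = 0" and ySuc: "y (Suc k) = (SOME z. z \<in> S \<and> nrm (z - y k) \<le> (1/3) ^ k \<and>
        (1/3) ^ k * q (N k) (\<xi> k) \<le> q (N k) z)" for k
      by (simp_all add: y_def)
    have yS: "y k \<in> S" for k
    proof (induction k)
      case (Suc k)
      then show ?case unfolding ySuc using someI_ex[OF step[OF Suc, of k]] by blast
    qed (simp add: y0)
    have ystep: "nrm (y (Suc k) - y k) \<le> (1/3) ^ k"
      and yq: "(1/3) ^ k * q (N k) (\<xi> k) \<le> q (N k) (y (Suc k))" for k
      unfolding ySuc using someI_ex[OF step[OF yS, of k k]] by blast+
    have ydist: "nrm (y (m + j) - y m) \<le> 3 / 2 * (1/3) ^ m * (1 - (1/3) ^ j)" for m j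
    proof (induction j)
      case (Suc j)
      have "nrm (y (m + Suc j) - y m) \<le> nrm (y (Suc (m + j)) - y (m + j)) + nrm (y (m + j) - y m)"
        using nrm_triangle2[OF yS yS yS, of "Suc (m + j)" "m" "m + j"] by simp
      also have "\<dots> \<le> (1/3) ^ (m + j) + 3 / 2 * (1/3) ^ m * (1 - (1/3) ^ j)"
        using ystep[of "m + j"] Suc by simp
      also have "\<dots> = 3 / 2 * (1/3) ^ m * (1 - (1/3) ^ Suc j)"
        by (simp add: power_add field_simps)
      finally show ?case .
    qed simp
    have ydist': "nrm (y n - y m) \<le> 3 / 2 * (1/3) ^ m" if "m \<le> n" for m n
    proof -
      have "nrm (y n - y m) \<le> 3 / 2 * (1/3) ^ m * (1 - (1/3) ^ (n - m))"
        using ydist[of m "n - m"] that by simp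
      also have "\<dots> \<le> 3 / 2 * (1/3) ^ m * 1" by (intro mult_left_mono) auto
      finally show ?thesis by simp
    qed
    have "Cau y"
    proof (rule CauI[where b = "\<lambda>n. 9 / 4 * (1/9) ^ n"])
      have "(\<lambda>n. (1/9::real) ^ n) \<longlonglongrightarrow> 0" by (intro LIMSEQ_power_zero) auto
      then show "(\<lambda>n. 9 / 4 * (1/9::real) ^ n) \<longlonglongrightarrow> 0" by (rule tendsto_mult_right_zero)
      fix m n :: nat assume mn: "m \<le> n"
      have "(nrm (y m - y n))\<^sup>2 \<le> (3 / 2 * (1/3) ^ m)\<^sup>2"
        using ydist'[OF mn] nrm_nonneg[of "y n - y m"] yS nrm_diff_commute[OF yS yS, of m n]
        by (intro power_mono) auto
      also have "\<dots> = 9 / 4 * (1/9) ^ m"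
        by (simp add: power_mult_distrib power2_eq_square flip: power_mult_distrib)
      finally show "ip (y m - y n) (y m - y n) \<le> 9 / 4 * (1/9) ^ m + 9 / 4 * (1/9) ^ n"
        using yS by (simp add: nrm_sq add_increasing2)
    qed (rule yS)
    then obtain x where x: "x \<in> S" and cx: "conv y x" using complete yS by blast
    have dx: "nrm (y m - x) \<le> 3 / 2 * (1/3) ^ m" for m
    proof (rule LIMSEQ_le_const)
      show "(\<lambda>n. 3 / 2 * (1/3) ^ m + nrm (y n - x)) \<longlonglongrightarrow> 3 / 2 * (1/3) ^ m"
        using cx unfolding conv_def by (auto intro!: tendsto_eq_intros)
      have "nrm (y m - x) \<le> 3 / 2 * (1/3) ^ m + nrm (y n - x)" if "n \<ge> m" for n
        using nrm_triangle2[OF yS yS x, of m n] ydist'[OF that] nrm_diff_commute[OF yS yS, of m n] by simp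
      then show "\<exists>N. \<forall>n\<ge>N. nrm (y m - x) \<le> 3 / 2 * (1/3) ^ m + nrm (y n - x)" by blast
    qed
    \<comment> \<open>The distance from \<open>y (Suc k)\<close> to the limit is at most
      \<open>3 / 2 * (1/3) ^ Suc k = 1 / 2 * (1/3) ^ k\<close>, so \<open>2/3 - 1/2 = 1/6\<close> of
      \<open>(1/3) ^ k * K (N k)\<close> survives at the single point \<open>x\<close>. As
      \<open>K (N k) > 4 ^ k\<close>, this is unbounded.\<close>
    have big: "1 / 6 * (4 / 3) ^ k \<le> q (N k) x" for k
    proof -
      have "q (N k) (y (Suc k)) \<le> q (N k) x + q (N k) (y (Suc k) - x)"
        using sub[of x "y (Suc k) - x" "N k"] x yS[of "Suc k"] by simp
      moreover have "q (N k) (y (Suc k) - x) \<le> 1 / 2 * ((1/3) ^ k * K (N k))"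
      proof -
        have "q (N k) (y (Suc k) - x) \<le> K (N k) * nrm (y (Suc k) - x)"
          using x yS by (intro qK) auto
        also have "\<dots> \<le> K (N k) * (3 / 2 * (1/3) ^ Suc k)"
          using dx[of "Suc k"] Kp[of k] by (intro mult_left_mono) auto
        finally show ?thesis by (simp add: mult.commute)
      qed
      moreover have "2 / 3 * ((1/3) ^ k * K (N k)) \<le> (1/3) ^ k * q (N k) (\<xi> k)"
        using mult_left_mono[OF less_imp_le[OF q\<xi>[of k]], of "(1/3) ^ k"] by simp
      ultimately have "1 / 6 * ((1/3) ^ k * K (N k)) \<le> q (N k) x"
        using yq[of k] by linarith
      moreover have "(1/3) ^ k * 4 ^ k \<le> (1/3) ^ k * K (N k)"
        using N[of k] by (intro mult_left_mono) auto
      moreover have "(1/3::real) ^ k * 4 ^ k = (4 / 3) ^ k" by (simp flip: power_mult_distrib)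
      ultimately show ?thesis by linarith
    qed
    obtain C where C: "\<And>n. q n x \<le> C" using pw[OF x] by blast
    obtain k where "6 * C < (4 / 3 :: real) ^ k" using real_arch_pow[of "4/3" "6 * C"] by auto
    then show False using big[of k] C[of "N k"] by simp
  qed
  then obtain C where C: "\<And>n. K n \<le> C" by blast
  have "q n x \<le> C * nrm x" if "x \<in> S" for n x
    using qK[OF that, of n] C[of n] nrm_nonneg[OF that] by (meson mult_right_mono order_trans)
  then show ?thesis by blast
qed

end

section \<open>Semigroups and closed forms\<close>

text \<open>All identities are required up to seminorm zero only, which for functions means almost
  everywhere. Boundedness is stated separately for each time; a bound that is uniform near time zero
  has to be derived.\<close>

locale c0_semigroup = semi_hilbert S ip for S :: "'v::real_vector set" and ip +
  fixes P :: "real \<Rightarrow> 'v \<Rightarrow> 'v"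
  assumes P_mem: "0 \<le> t \<Longrightarrow> x \<in> S \<Longrightarrow> P t x \<in> S"
    and P_add: "0 \<le> t \<Longrightarrow> x \<in> S \<Longrightarrow> y \<in> S \<Longrightarrow> nrm (P t (x + y) - (P t x + P t y)) = 0"
    and P_scale: "0 \<le> t \<Longrightarrow> x \<in> S \<Longrightarrow> nrm (P t (c *\<^sub>R x) - c *\<^sub>R P t x) = 0"
    and P_bdd: "0 \<le> t \<Longrightarrow> \<exists>K. \<forall>x\<in>S. nrm (P t x) \<le> K * nrm x"
    and P_zero: "x \<in> S \<Longrightarrow> nrm (P 0 x - x) = 0"
    and P_semigroup: "0 \<le> s \<Longrightarrow> 0 \<le> t \<Longrightarrow> x \<in> S \<Longrightarrow> nrm (P (s + t) x - P s (P t x)) = 0"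
    and P_cont: "x \<in> S \<Longrightarrow> ((\<lambda>t. nrm (P t x - x)) \<longlongrightarrow> 0) (at_right 0)"
begin

definition generator :: "('v \<times> 'v) set" where
  "generator = {(f, g). f \<in> S \<and> g \<in> S \<and>
     ((\<lambda>t. nrm ((1 / t) *\<^sub>R (P t f - f) - g)) \<longlongrightarrow> 0) (at_right 0)}"

lemma nrm_P_add: "0 \<le> t \<Longrightarrow> x \<in> S \<Longrightarrow> y \<in> S \<Longrightarrow> nrm (P t (x + y)) = nrm (P t x + P t y)"
  by (rule nrm_eq_cong) (auto simp: P_mem P_add)

lemma nrm_P_scale: "0 \<le> t \<Longrightarrow> x \<in> S \<Longrightarrow> nrm (P t (c *\<^sub>R x)) = \<bar>c\<bar> * nrm (P t x)"
  using nrm_eq_cong[OF _ _ P_scale[of t x c]] by (simp add: P_mem nrm_scale)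

lemma nrm_P_diff:
  assumes "0 \<le> t" "x \<in> S" "y \<in> S"
  shows "nrm (P t x - P t y) = nrm (P t (x - y))"
proof -
  have "nrm (P t ((x - y) + y) - (P t (x - y) + P t y)) = 0"
    using assms by (intro P_add) auto
  then have "nrm ((P t x - P t y) - P t (x - y)) = 0"
    by (simp add: algebra_simps)
  then show ?thesis using assms by (intro nrm_eq_cong) (auto simp: P_mem)
qed

text \<open>Otherwise there are times \<open>t n\<close> tending to zero at which
  \<open>P (t n)\<close> violates the bound with constant \<open>n\<close>. Strong continuity at
  zero bounds each sequence \<open>P (t n) x\<close>, so the uniform boundedness principle gives a
  common constant, a contradiction.\<close>

lemma locally_bounded:
  obtains \<delta> K where "0 < \<delta>" "0 \<le> K" "\<And>t x. 0 \<le> t \<Longrightarrow> t \<le> \<delta> \<Longrightarrow> x \<in> S \<Longrightarrow> nrm (P t x) \<le> K * nrm x"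
proof -
  have "\<exists>\<delta>>0. \<exists>K. \<forall>t. 0 \<le> t \<longrightarrow> t \<le> \<delta> \<longrightarrow> (\<forall>x\<in>S. nrm (P t x) \<le> K * nrm x)"
  proof (rule ccontr)
    assume neg: "\<not> ?thesis"
    have "\<exists>t. 0 \<le> t \<and> t \<le> inverse (real (Suc n)) \<and> (\<exists>x\<in>S. real n * nrm x < nrm (P t x))" for n
    proof (rule ccontr)
      assume "\<not> ?thesis"
      then have "\<forall>t. 0 \<le> t \<longrightarrow> t \<le> inverse (real (Suc n)) \<longrightarrow> (\<forall>x\<in>S. nrm (P t x) \<le> real n * nrm x)"
        by force
      moreover have "inverse (real (Suc n)) > 0" by simp
      ultimately show False using neg by blast
    qed
    then obtain t where t0: "\<And>n. 0 \<le> t n" and t1: "\<And>n. t n \<le> inverse (real (Suc n))"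
      and tb: "\<And>n. \<exists>x\<in>S. real n * nrm x < nrm (P (t n) x)" by metis
    have "\<exists>K. \<forall>n. \<forall>x\<in>S. nrm (P (t n) x) \<le> K * nrm x"
    proof (rule uniform_boundedness)
      fix x assume x: "x \<in> S"
      have "\<forall>\<^sub>F s in at_right 0. nrm (P s x - x) < 1"
        using P_cont[OF x] by (intro order_tendstoD) auto
      then obtain b where b: "b > 0" "\<And>s. 0 < s \<Longrightarrow> s < b \<Longrightarrow> nrm (P s x - x) < 1"
        by (auto simp: eventually_at_right_field)
      obtain N where N: "inverse (real (Suc N)) < b" using reals_Archimedean[OF b(1)] by blast
      have "nrm (P (t n) x) \<le> nrm x + 1" if "n \<ge> N" for n
      proof -
        have "inverse (real (Suc n)) \<le> inverse (real (Suc N))" using that by (intro le_imp_inverse_le) auto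
        then have "t n < b" using t1[of n] N by linarith
        then have "nrm (P (t n) x - x) \<le> 1"
          using b(2)[of "t n"] t0[of n] P_zero[OF x] by (cases "t n = 0") auto
        then show ?thesis using nrm_triangle_ineq2[of "P (t n) x" x] x t0[of n] by (simp add: P_mem)
      qed
      moreover have "nrm (P (t n) x) \<le> (\<Sum>k<N. nrm (P (t k) x))" if "n < N" for n
        using that x t0 by (intro member_le_sum) (auto simp: nrm_nonneg P_mem)
      moreover have "0 \<le> (\<Sum>k<N. nrm (P (t k) x))" using x t0 by (intro sum_nonneg) (auto simp: nrm_nonneg P_mem)
      ultimately have "nrm (P (t n) x) \<le> (\<Sum>k<N. nrm (P (t k) x)) + (nrm x + 1)" for n
        using nrm_nonneg[OF x] by (smt (verit) not_le)
      then show "\<exists>B. \<forall>n. nrm (P (t n) x) \<le> B" by blast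
    next
      fix n x y assume "x \<in> S" "y \<in> S"
      then show "nrm (P (t n) (x + y)) \<le> nrm (P (t n) x) + nrm (P (t n) y)"
        using t0[of n] by (simp add: nrm_P_add nrm_triangle P_mem)
    qed (use t0 in \<open>auto simp: nrm_P_scale P_bdd\<close>)
    then obtain K where K: "\<And>n x. x \<in> S \<Longrightarrow> nrm (P (t n) x) \<le> K * nrm x" by blast
    obtain n where n: "K \<le> real n" using real_arch_simple by blast
    obtain x where x: "x \<in> S" "real n * nrm x < nrm (P (t n) x)" using tb by blast
    have "K * nrm x \<le> real n * nrm x" using n nrm_nonneg[OF x(1)] by (rule mult_right_mono)
    then show False using K[OF x(1), of n] x(2) by linarith
  qed
  then obtain \<delta> K where \<delta>: "\<delta> > 0" and K: "\<And>t x. 0 \<le> t \<Longrightarrow> t \<le> \<delta> \<Longrightarrow> x \<in> S \<Longrightarrow> nrm (P t x) \<le> K * nrm x"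
    by blast
  show thesis
  proof (rule that[OF \<delta>, of "\<bar>K\<bar>"])
    fix t x assume a: "0 \<le> t" "t \<le> \<delta>" "x \<in> S"
    show "nrm (P t x) \<le> \<bar>K\<bar> * nrm x"
      using K[OF a] nrm_nonneg[OF a(3)] by (meson abs_ge_self mult_right_mono order_trans)
  qed simp
qed

text \<open>Split \<open>[0, t]\<close> into \<open>Suc n\<close> steps of length \<open>h\<close>.
  Each step contributes \<open>P (k h) (P h u - u)\<close>, of size at most
  \<open>K * nrm (P h u - u)\<close>, and this is about \<open>K * h * nrm w\<close>. Letting
  \<open>n\<close> tend to infinity replaces the usual integral formula for
  \<open>P t u - u\<close>.\<close>

lemma generator_Lipschitz:
  assumes K: "0 \<le> K" "\<And>t x. 0 \<le> t \<Longrightarrow> t \<le> \<delta> \<Longrightarrow> x \<in> S \<Longrightarrow> nrm (P t x) \<le> K * nrm x"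
    and uw: "(u, w) \<in> generator" and t: "0 < t" "t \<le> \<delta>"
  shows "nrm (P t u - u) \<le> K * t * nrm w"
proof -
  have u: "u \<in> S" and w: "w \<in> S"
    and lim: "((\<lambda>t. nrm ((1 / t) *\<^sub>R (P t u - u) - w)) \<longlongrightarrow> 0) (at_right 0)"
    using uw by (auto simp: generator_def)
  have tel: "nrm (P (real k * h) u - u) \<le> real k * (K * nrm (P h u - u))"
    if h: "0 \<le> h" "real k * h \<le> \<delta>" for k h
    using h(2)
  proof (induction k)
    case 0
    then show ?case using P_zero[OF u] by simp
  next
    case (Suc k)
    have kh: "real k * h \<le> \<delta>" using Suc.prems h(1) by (simp add: algebra_simps)
    have mem: "P h u \<in> S" "P (real k * h) u \<in> S" "P (real k * h) (P h u) \<in> S" "P (real k * h + h) u \<in> S"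
      using h(1) u by (auto intro!: P_mem)
    have "nrm (P (real (Suc k) * h) u - u) \<le>
        nrm (P (real k * h + h) u - P (real k * h) (P h u)) + nrm (P (real k * h) (P h u) - u)"
      using nrm_triangle2[OF mem(4,3) u] by (simp add: algebra_simps)
    also have "\<dots> \<le> 0 + (nrm (P (real k * h) (P h u) - P (real k * h) u) + nrm (P (real k * h) u - u))"
      using nrm_triangle2[OF mem(3,2) u] P_semigroup[of "real k * h" h u] h(1) u by simp
    also have "\<dots> \<le> K * nrm (P h u - u) + real k * (K * nrm (P h u - u))"
      using Suc.IH[OF kh] K(2)[of "real k * h" "P h u - u"] kh h(1) u mem by (simp add: nrm_P_diff)
    finally show ?case by (simp add: algebra_simps)
  qed
  have ge: "nrm (P t u - u) \<le> K * t * (nrm ((1 / h) *\<^sub>R (P h u - u) - w) + nrm w)"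
    if h: "h = t * inverse (real (Suc n))" for n h
  proof -
    have h0: "h > 0" and th: "real (Suc n) * h = t" using t h by auto
    have mem: "P h u \<in> S" using h0 u by (auto intro: P_mem)
    have "nrm (P t u - u) \<le> real (Suc n) * (K * nrm (P h u - u))"
      using tel[of h "Suc n"] h0 t th by simp
    also have "\<dots> = K * t * nrm ((1 / h) *\<^sub>R (P h u - u))"
      using h0 th mem u by (simp add: nrm_scale flip: th)
    also have "\<dots> \<le> K * t * (nrm ((1 / h) *\<^sub>R (P h u - u) - w) + nrm w)"
      using nrm_triangle[of "(1 / h) *\<^sub>R (P h u - u) - w" w] mem u w K(1) t by (intro mult_left_mono) auto
    finally show ?thesis .
  qed
  have "filterlim (\<lambda>n. t * inverse (real (Suc n))) (at_right 0) sequentially"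
    unfolding filterlim_at using t tendsto_mult_right_zero[OF LIMSEQ_inverse_real_of_nat, of t]
    by (auto simp del: of_nat_Suc)
  from filterlim_compose[OF lim this]
  have "(\<lambda>n. K * t * (nrm ((1 / (t * inverse (real (Suc n)))) *\<^sub>R (P (t * inverse (real (Suc n))) u - u) - w) + nrm w))
      \<longlonglongrightarrow> K * t * (0 + nrm w)"
    by (intro tendsto_intros)
  then show ?thesis using ge by (auto intro: LIMSEQ_le_const)
qed

end

section \<open>Closed forms, resolvents and the obstruction to compactness\<close>

text \<open>In \<open>closed\<close> the vector \<open>x\<close> is any limit in \<open>H\<close>.
  Applied to a constant sequence it shows that \<open>F\<close> contains with a vector everything at
  \<open>H\<close>-distance zero from it, and that \<open>E\<close> does not see the
  difference.\<close>

locale closed_form = L: semi_hilbert H ip + E: semi_inner F E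
  for H :: "'v::real_vector set" and ip and F :: "'v set" and E +
  assumes F_sub: "F \<subseteq> H"
    and closed: "(\<And>n. u n \<in> F) \<Longrightarrow> x \<in> H \<Longrightarrow> L.conv u x \<Longrightarrow> E.Cau u \<Longrightarrow> x \<in> F \<and> E.conv u x"
begin

lemma F_H [simp, intro]: "x \<in> F \<Longrightarrow> x \<in> H"
  using F_sub by auto

definition form_operator :: "('v \<times> 'v) set" where
  "form_operator = {(u, w). u \<in> F \<and> w \<in> H \<and> (\<forall>v\<in>F. E u v = - ip w v)}"

text \<open>The vector \<open>u\<close> solves \<open>u + \<epsilon> A u = f\<close> weakly, where
  \<open>A\<close> is the nonnegative operator of \<open>E\<close>. It comes from Riesz
  representation for \<open>B\<close>, whose completeness is the closedness of \<open>E\<close>.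
  Testing the equation with \<open>u - f\<close> shows that \<open>u\<close> is near
  \<open>f\<close> when \<open>\<epsilon> * E f f\<close> is small.\<close>

lemma resolvent:
  assumes f: "f \<in> F" and e: "\<epsilon> > 0"
  shows "\<exists>u\<in>F. (u, (1 / \<epsilon>) *\<^sub>R (u - f)) \<in> form_operator \<and> ip (u - f) (u - f) \<le> \<epsilon> * E f f"
proof -
  define B where "B u v = \<epsilon> * E u v + ip u v" for u v
  interpret B: semi_inner F B
  proof
    show "subspace F" by (rule E.subspace_S)
  qed (use e in \<open>auto simp: B_def E.ip_simps L.ip_simps algebra_simps E.ip_nonneg L.ip_nonneg
        E.ip_commute L.ip_commute\<close>)
  have LB: "L.nrm x \<le> B.nrm x" if "x \<in> F" for x
    unfolding L.nrm_def B.nrm_def B_def using that e by (simp add: E.ip_nonneg)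
  have EB: "E.nrm x \<le> B.nrm x / sqrt \<epsilon>" if "x \<in> F" for x
  proof -
    have "sqrt (\<epsilon> * E x x) \<le> B.nrm x"
      unfolding B.nrm_def B_def using that e by (simp add: L.ip_nonneg)
    then show ?thesis using e by (simp add: E.nrm_def real_sqrt_mult field_simps)
  qed
  interpret B: semi_hilbert F B
  proof
    fix u assume u: "\<And>n. u n \<in> F" and c: "B.Cau u"
    have "L.Cau u" unfolding L.Cau_def
    proof (intro allI impI)
      fix r :: real assume "r > 0"
      then obtain N where N: "\<forall>m\<ge>N. \<forall>n\<ge>N. B.nrm (u m - u n) < r" using c unfolding B.Cau_def by blast
      then show "\<exists>N. \<forall>m\<ge>N. \<forall>n\<ge>N. L.nrm (u m - u n) < r"
        using LB u by (meson E.mem_diff le_less_trans)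
    qed
    then obtain x where x: "x \<in> H" and cx: "L.conv u x" using L.complete u F_H by metis
    have "E.Cau u" unfolding E.Cau_def
    proof (intro allI impI)
      fix r :: real assume "r > 0"
      then have "r * sqrt \<epsilon> > 0" using e by simp
      then obtain N where N: "\<forall>m\<ge>N. \<forall>n\<ge>N. B.nrm (u m - u n) < r * sqrt \<epsilon>"
        using c unfolding B.Cau_def by blast
      have "E.nrm (u m - u n) < r" if "m \<ge> N" "n \<ge> N" for m n
      proof -
        have "B.nrm (u m - u n) / sqrt \<epsilon> < r" using N that e by (simp add: field_simps)
        then show ?thesis using EB[of "u m - u n"] u by (meson E.mem_diff le_less_trans)
      qed
      then show "\<exists>N. \<forall>m\<ge>N. \<forall>n\<ge>N. E.nrm (u m - u n) < r" by blast
    qed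
    then have xF: "x \<in> F" and ex: "E.conv u x" using closed[OF u x cx] by auto
    have "(\<lambda>n. sqrt (\<epsilon> * (E.nrm (u n - x))\<^sup>2 + (L.nrm (u n - x))\<^sup>2)) \<longlonglongrightarrow> sqrt (\<epsilon> * 0\<^sup>2 + 0\<^sup>2)"
      using ex cx unfolding E.conv_def L.conv_def by (intro tendsto_intros)
    moreover have "B.nrm (u n - x) = sqrt (\<epsilon> * (E.nrm (u n - x))\<^sup>2 + (L.nrm (u n - x))\<^sup>2)" for n
      using u[of n] xF x by (simp add: B.nrm_def B_def E.nrm_sq L.nrm_sq)
    ultimately have "B.conv u x" unfolding B.conv_def by simp
    then show "\<exists>x\<in>F. B.conv u x" using xF by blast
  qed
  have "\<exists>u\<in>F. \<forall>v\<in>F. B u v = ip f v"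
  proof (rule B.Riesz[where K = "L.nrm f"])
    fix x assume x: "x \<in> F"
    show "\<bar>ip f x\<bar> \<le> L.nrm f * B.nrm x"
      using L.Cauchy_Schwarz[of f x] LB[OF x] f x
      by (meson F_H L.nrm_nonneg mult_left_mono order_trans)
  qed (use f in \<open>auto simp: L.ip_simps\<close>)
  then obtain u where u: "u \<in> F" and uv: "\<And>v. v \<in> F \<Longrightarrow> \<epsilon> * E u v + ip u v = ip f v"
    unfolding B_def by blast
  have "E u v = - ip ((1 / \<epsilon>) *\<^sub>R (u - f)) v" if v: "v \<in> F" for v
    using uv[OF v] e u f v by (simp add: L.ip_simps field_simps)
  then have "(u, (1 / \<epsilon>) *\<^sub>R (u - f)) \<in> form_operator"
    using u f by (auto simp: form_operator_def)
  moreover have "ip (u - f) (u - f) \<le> \<epsilon> * E f f"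
  proof -
    have "ip (u - f) (u - f) = - \<epsilon> * E u (u - f)"
      using uv[of "u - f"] u f by (simp add: L.ip_simps)
    also have "\<dots> = \<epsilon> * (E u f - E u u)" using u f by (simp add: E.ip_simps algebra_simps)
    also have "\<dots> \<le> \<epsilon> * E f f"
    proof (rule mult_left_mono)
      \<comment> \<open>Completing the square: this bounds \<open>E u f - E u u\<close> by
        \<open>E f f / 4\<close>.\<close>
      have "0 \<le> E ((2 *\<^sub>R u - f)) ((2 *\<^sub>R u - f))" using u f by (intro E.ip_nonneg) auto
      also have "\<dots> = 4 * E u u - 4 * E u f + E f f"
        using u f by (simp add: E.ip_simps E.ip_commute[of f u])
      finally show "E u f - E u u \<le> E f f" using E.ip_nonneg[OF f] by simp
    qed (use e in simp)
    finally show ?thesis .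
  qed
  ultimately show ?thesis using u by blast
qed

text \<open>The resolvent moves each \<open>f n\<close> by at most \<open>1/8\<close> into the domain of the generator with a
  uniform bound on the graph norm, where \<open>P t\<close> is uniformly close to the identity for small \<open>t\<close>.
  Hence the images under \<open>P t\<close> are still separated.\<close>

theorem not_compact_semigroup:
  fixes f :: "nat \<Rightarrow> 'v"
  assumes P: "c0_semigroup H ip P" and gen: "form_operator \<subseteq> c0_semigroup.generator H ip P"
    and compact: "\<And>t (x :: nat \<Rightarrow> 'v). 0 < t \<Longrightarrow> (\<And>n. x n \<in> H) \<Longrightarrow> bounded (range (\<lambda>n. L.nrm (x n))) \<Longrightarrow>
      \<exists>r g. strict_mono r \<and> g \<in> H \<and> L.conv (\<lambda>n. P t (x (r n))) g"
    and f: "\<And>n. f n \<in> F" and C: "\<And>n. E (f n) (f n) \<le> C"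
    and bdd: "\<And>n. L.nrm (f n) \<le> C'"
    and sep: "\<And>m n. m \<noteq> n \<Longrightarrow> 1 \<le> L.nrm (f m - f n)"
  shows False
proof -
  interpret P: c0_semigroup H ip P by fact
  have C0: "0 \<le> C" using C[of 0] E.ip_nonneg[OF f[of 0]] by linarith
  \<comment> \<open>The factor 64 is the square of 8, for a displacement of at most
    \<open>1/8\<close>; the summand 1 covers \<open>C = 0\<close>.\<close>
  define \<epsilon> where "\<epsilon> = 1 / (64 * (C + 1))"
  have e: "\<epsilon> > 0" using C0 by (simp add: \<epsilon>_def)
  have eC: "\<epsilon> * C \<le> (1 / 8)\<^sup>2" using C0 by (simp add: \<epsilon>_def field_simps power2_eq_square)
  obtain u where uF: "\<And>n. u n \<in> F" and ug: "\<And>n. (u n, (1 / \<epsilon>) *\<^sub>R (u n - f n)) \<in> form_operator"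
    and ue: "\<And>n. ip (u n - f n) (u n - f n) \<le> \<epsilon> * E (f n) (f n)"
    using resolvent[OF f e] by metis
  define w where "w n = (1 / \<epsilon>) *\<^sub>R (u n - f n)" for n
  have uf: "L.nrm (u n - f n) \<le> 1 / 8" for n
  proof (rule power2_le_imp_le)
    have "\<epsilon> * E (f n) (f n) \<le> \<epsilon> * C" using C e by (intro mult_left_mono) auto
    then show "(L.nrm (u n - f n))\<^sup>2 \<le> (1 / 8)\<^sup>2" using ue[of n] eC uF f by (simp add: L.nrm_sq)
  qed simp
  have wb: "L.nrm (w n) \<le> 1 / \<epsilon>" for n
  proof -
    have "L.nrm (w n) = (1 / \<epsilon>) * L.nrm (u n - f n)"
      unfolding w_def using uF f e by (simp add: L.nrm_scale)
    also have "\<dots> \<le> (1 / \<epsilon>) * 1" using uf[of n] e by (intro mult_left_mono) auto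
    finally show ?thesis by simp
  qed
  obtain \<delta> K where \<delta>: "0 < \<delta>" and K0: "0 \<le> K"
    and K: "\<And>t x. 0 \<le> t \<Longrightarrow> t \<le> \<delta> \<Longrightarrow> x \<in> H \<Longrightarrow> L.nrm (P t x) \<le> K * L.nrm x"
    using P.locally_bounded by metis
  \<comment> \<open>Since \<open>nrm (w n) \<le> 1 / \<epsilon>\<close>, this choice makes the
    Lipschitz bound \<open>K * t / \<epsilon>\<close> at most \<open>1/8\<close>.\<close>
  define t where "t = min \<delta> (\<epsilon> / (8 * (K + 1)))"
  have t: "0 < t" "t \<le> \<delta>" using \<delta> e K0 by (auto simp: t_def)
  have Pu: "L.nrm (P t (u n) - u n) \<le> 1 / 8" for n
  proof -
    have "L.nrm (P t (u n) - u n) \<le> K * t * L.nrm (w n)"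
      using P.generator_Lipschitz[OF K0 K _ t] ug gen unfolding w_def by blast
    also have "\<dots> \<le> K * t * (1 / \<epsilon>)" using wb K0 t by (intro mult_left_mono) auto
    also have "\<dots> \<le> (K + 1) * (\<epsilon> / (8 * (K + 1))) * (1 / \<epsilon>)"
      using K0 e t by (intro mult_mono) (auto simp: t_def)
    also have "\<dots> = 1 / 8" using K0 e by simp
    finally show ?thesis .
  qed
  have ub: "L.nrm (u n) \<le> C' + 1" for n
    using L.nrm_triangle[of "u n - f n" "f n"] uf[of n] bdd[of n] uF[of n] f[of n] by simp
  have "bounded (range (\<lambda>n. L.nrm (u n)))"
    using ub uF by (auto intro!: boundedI[where B = "C' + 1"] simp: L.nrm_nonneg)
  then obtain r g where r: "strict_mono r" and g: "g \<in> H" and cg: "L.conv (\<lambda>n. P t (u (r n))) g"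
    using compact[OF t(1), of u] uF by blast
  have PH: "P t (u n) \<in> H" for n using t uF by (auto intro: P.P_mem)
  obtain N where N: "\<And>m n. m \<ge> N \<Longrightarrow> n \<ge> N \<Longrightarrow> L.nrm (P t (u (r m)) - P t (u (r n))) < 1 / 8"
    using L.conv_imp_Cau[OF PH g cg] unfolding L.Cau_def by (metis zero_less_divide_1_iff zero_less_numeral)
  let ?a = "r N" and ?b = "r (Suc N)"
  have ab: "?a \<noteq> ?b" using r by (simp add: strict_mono_eq)
  have sym: "L.nrm (f n - u n) \<le> 1 / 8" "L.nrm (u n - P t (u n)) \<le> 1 / 8" for n
    using uf[of n] Pu[of n] L.nrm_diff_commute[of "f n" "u n"] L.nrm_diff_commute[of "u n" "P t (u n)"]
      uF[of n] f[of n] PH[of n] by auto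
  \<comment> \<open>Five gaps of at most \<open>1/8\<close> each: from \<open>f\<close> to
    \<open>u\<close> and from \<open>u\<close> to \<open>P t u\<close> at both indices, and between
    the two images. Their sum stays below the separation 1.\<close>
  have "L.nrm (f ?a - f ?b) \<le> L.nrm (f ?a - u ?a) + (L.nrm (u ?a - P t (u ?a)) +
      (L.nrm (P t (u ?a) - P t (u ?b)) + (L.nrm (P t (u ?b) - u ?b) + L.nrm (u ?b - f ?b))))"
    using L.nrm_triangle2[of "f ?a" "u ?a" "f ?b"] L.nrm_triangle2[of "u ?a" "P t (u ?a)" "f ?b"]
      L.nrm_triangle2[of "P t (u ?a)" "P t (u ?b)" "f ?b"] L.nrm_triangle2[of "P t (u ?b)" "u ?b" "f ?b"]
      uF f PH by (smt (verit) F_H)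
  then show False
    using sep[OF ab] sym(1)[of ?a] sym(2)[of ?a] N[of N "Suc N"] Pu[of ?b] uf[of ?b] by simp
qed

end

section \<open>Forms with compact embedding\<close>

text \<open>Density is put as triviality of the orthogonal complement of \<open>F\<close>: this is
  what uniqueness of expansion coefficients consumes, and what testing against Lipschitz functions
  supplies.\<close>

locale compact_closed_form = closed_form H ip F E
  for H :: "'v::real_vector set" and ip and F :: "'v set" and E +
  assumes compact_embedding: "(\<And>n. (u :: nat \<Rightarrow> 'v) n \<in> F) \<Longrightarrow> (\<And>n. E (u n) (u n) \<le> C) \<Longrightarrow>
      (\<And>n. ip (u n) (u n) \<le> C) \<Longrightarrow> \<exists>r g. strict_mono r \<and> g \<in> H \<and> L.conv (\<lambda>n. u (r n)) g"
    and dense: "f \<in> H \<Longrightarrow> (\<And>v. v \<in> F \<Longrightarrow> ip f v = 0) \<Longrightarrow> L.nrm f = 0"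
begin

text \<open>Minimise the Rayleigh quotient on the complement \<open>W\<close> of the earlier
  eigenvectors. Compactness of the embedding gives a limit in \<open>H\<close> of a minimising
  sequence, minimality upgrades this to convergence in energy, and the first variation is the
  eigenvalue equation.\<close>

lemma next_eigenvector:
  fixes e :: "nat \<Rightarrow> 'v" and n :: nat
  defines "W \<equiv> {u \<in> F. \<forall>i<n. ip u (e i) = 0}"
  assumes e: "\<And>i. i < n \<Longrightarrow> e i \<in> F"
    and orth: "\<And>i j. i < n \<Longrightarrow> j < n \<Longrightarrow> i \<noteq> j \<Longrightarrow> ip (e i) (e j) = 0"
    and norm: "\<And>i. i < n \<Longrightarrow> ip (e i) (e i) = 1 \<or> e i = 0"
    and eig: "\<And>i v. i < n \<Longrightarrow> v \<in> F \<Longrightarrow> E (e i) v = l i * ip (e i) v"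
    and ex: "w \<in> W" "ip w w \<noteq> 0"
  shows "\<exists>x \<kappa>. x \<in> W \<and> 0 \<le> \<kappa> \<and> ip x x = 1 \<and> (\<forall>v\<in>F. E x v = \<kappa> * ip x v) \<and>
    (\<forall>u\<in>W. \<kappa> * ip u u \<le> E u u)"
proof -
  have WF: "u \<in> F" if "u \<in> W" for u using that by (simp add: W_def)
  have W_add: "u + v \<in> W" and W_scale: "c *\<^sub>R u \<in> W" if "u \<in> W" "v \<in> W" for u v c
    using that e by (auto simp: W_def L.ip_simps)
  define U where "U = {u \<in> W. ip u u = 1}"
  define \<kappa> where "\<kappa> = (INF u\<in>U. E u u)"
  have unit: "(1 / sqrt (ip u u)) *\<^sub>R u \<in> U" if "u \<in> W" "ip u u \<noteq> 0" for u
  proof -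
    have "ip u u > 0" using that WF[OF that(1)] L.ip_nonneg[of u] by simp
    then show ?thesis using W_scale that WF[OF that(1)] by (simp add: U_def L.ip_simps)
  qed
  have Une: "U \<noteq> {}" using unit[OF ex] by blast
  have bb: "bdd_below ((\<lambda>u. E u u) ` U)"
    using E.ip_nonneg WF by (auto intro!: bdd_belowI2[where m = 0] simp: U_def)
  have l0: "0 \<le> \<kappa>"
    unfolding \<kappa>_def using Une E.ip_nonneg WF by (intro cINF_greatest) (auto simp: U_def)
  have min: "\<kappa> * ip u u \<le> E u u" if u: "u \<in> W" for u
  proof (cases "ip u u = 0")
    case True
    then show ?thesis using E.ip_nonneg[OF WF[OF u]] by simp
  next
    case False
    then have p: "ip u u > 0" using WF[OF u] L.ip_nonneg[of u] by simp
    have "\<kappa> \<le> E ((1 / sqrt (ip u u)) *\<^sub>R u) ((1 / sqrt (ip u u)) *\<^sub>R u)"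
      unfolding \<kappa>_def by (rule cINF_lower[OF bb unit[OF u False]])
    also have "\<dots> = E u u / ip u u" using WF[OF u] p by (simp add: E.ip_simps)
    finally show ?thesis using p by (simp add: field_simps)
  qed
  have "\<exists>u\<in>U. E u u < \<kappa> + 1 / real (Suc n)" for n
  proof (rule ccontr)
    assume "\<not> ?thesis"
    then have "\<forall>u\<in>U. \<kappa> + 1 / real (Suc n) \<le> E u u" by force
    then have "\<kappa> + 1 / real (Suc n) \<le> \<kappa>" using Une unfolding \<kappa>_def by (intro cINF_greatest) auto
    then show False by (simp add: field_simps)
  qed
  then obtain u where u: "\<And>n. u n \<in> U" and Eu: "\<And>n. E (u n) (u n) < \<kappa> + 1 / real (Suc n)" by metis
  have uW: "u n \<in> W" and u1: "ip (u n) (u n) = 1" for n using u[of n] by (auto simp: U_def)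
  have "\<exists>r g. strict_mono r \<and> g \<in> H \<and> L.conv (\<lambda>n. u (r n)) g"
  proof (rule compact_embedding[where C = "\<kappa> + 1"])
    fix n
    have "1 / real (Suc n) \<le> 1" by simp
    then show "E (u n) (u n) \<le> \<kappa> + 1" using Eu[of n] by linarith
  qed (use uW u1 l0 WF in auto)
  then obtain r g where r: "strict_mono r" and g: "g \<in> H" and cg: "L.conv (\<lambda>n. u (r n)) g" by blast
  define v where "v n = u (r n)" for n
  have cv: "L.conv v g" using cg by (simp add: v_def[abs_def])
  have vW: "v n \<in> W" and v1: "ip (v n) (v n) = 1" and vF: "v n \<in> F" for n
    using uW u1 WF by (auto simp: v_def)
  have Ev: "E (v n) (v n) \<le> \<kappa> + inverse (real (Suc n))" for n
  proof -
    have "inverse (real (Suc (r n))) \<le> inverse (real (Suc n))"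
      using seq_suble[OF r, of n] by (intro le_imp_inverse_le) auto
    then show ?thesis using Eu[of "r n"] unfolding v_def divide_inverse by linarith
  qed
  \<comment> \<open>By the parallelogram identity \<open>E (a - b)\<close> equals
    \<open>2 E a + 2 E b - E (a + b)\<close>, and minimality bounds \<open>E (a + b)\<close> below
    by \<open>4 \<kappa> - \<kappa> ip (a - b)\<close>. So energy distances are controlled by the
    excess energies and by distances in \<open>H\<close>.\<close>
  have "E.Cau v"
  proof (rule E.CauI[where b = "\<lambda>n. 2 * inverse (real (Suc n)) + 2 * \<kappa> * (L.nrm (v n - g))\<^sup>2"])
    have "(\<lambda>n. 2 * inverse (real (Suc n)) + 2 * \<kappa> * (L.nrm (v n - g))\<^sup>2) \<longlonglongrightarrow> 2 * 0 + 2 * \<kappa> * 0\<^sup>2"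
      using cv LIMSEQ_inverse_real_of_nat unfolding L.conv_def by (intro tendsto_intros)
    then show "(\<lambda>n. 2 * inverse (real (Suc n)) + 2 * \<kappa> * (L.nrm (v n - g))\<^sup>2) \<longlonglongrightarrow> 0" by simp
    fix m n
    let ?a = "v m" and ?b = "v n"
    have "ip (?a - ?b) (?a - ?b) \<le> 2 * (L.nrm (?a - g))\<^sup>2 + 2 * (L.nrm (?b - g))\<^sup>2"
    proof -
      have "0 \<le> ip ((?a - g) + (?b - g)) ((?a - g) + (?b - g))" using vF g by (intro L.ip_nonneg) auto
      moreover have "ip (?a - ?b) (?a - ?b) + ip ((?a - g) + (?b - g)) ((?a - g) + (?b - g)) =
          2 * ip (?a - g) (?a - g) + 2 * ip (?b - g) (?b - g)"
        using vF[of m] vF[of n] g by (simp add: L.ip_simps)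
      ultimately show ?thesis using vF g by (simp add: L.nrm_sq)
    qed
    then have "\<kappa> * ip (?a - ?b) (?a - ?b) \<le> \<kappa> * (2 * (L.nrm (?a - g))\<^sup>2 + 2 * (L.nrm (?b - g))\<^sup>2)"
      using l0 by (rule mult_left_mono)
    moreover have "E (?a - ?b) (?a - ?b) = 2 * E ?a ?a + 2 * E ?b ?b - E (?a + ?b) (?a + ?b)"
      using vF by (simp add: E.ip_simps)
    moreover have "\<kappa> * ip (?a + ?b) (?a + ?b) = 4 * \<kappa> - \<kappa> * ip (?a - ?b) (?a - ?b)"
      using vF v1 by (simp add: L.ip_simps L.ip_commute[of ?b ?a] algebra_simps)
    moreover have "\<kappa> * ip (?a + ?b) (?a + ?b) \<le> E (?a + ?b) (?a + ?b)"
      using vW by (intro min W_add)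
    ultimately show "E (?a - ?b) (?a - ?b) \<le> (2 * inverse (real (Suc m)) + 2 * \<kappa> * (L.nrm (?a - g))\<^sup>2) +
        (2 * inverse (real (Suc n)) + 2 * \<kappa> * (L.nrm (?b - g))\<^sup>2)"
      using Ev[of m] Ev[of n] by (simp add: algebra_simps)
  qed (rule vF)
  then have gF: "g \<in> F" and eg: "E.conv v g" using closed[OF vF g cv] by auto
  have "(\<lambda>n. ip (v n) (v n)) \<longlonglongrightarrow> ip g g" using cv vF g by (intro L.conv_ip) auto
  then have g1: "ip g g = 1" using v1 by (simp add: LIMSEQ_const_iff)
  have Eg: "E g g \<le> \<kappa>"
  proof (rule LIMSEQ_le)
    show "(\<lambda>n. E (v n) (v n)) \<longlonglongrightarrow> E g g" using eg vF gF by (intro E.conv_ip) auto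
    show "(\<lambda>n. \<kappa> + inverse (real (Suc n))) \<longlonglongrightarrow> \<kappa>"
      using LIMSEQ_inverse_real_of_nat_add[of \<kappa>] by simp
  qed (use Ev in auto)
  have ge: "ip g (e i) = 0" if "i < n" for i
  proof -
    have "(\<lambda>k. ip (v k) (e i)) \<longlonglongrightarrow> ip g (e i)" using cv vF g e[OF that] by (intro L.conv_ip_left) auto
    moreover have "ip (v k) (e i) = 0" for k using vW[of k] that by (simp add: W_def)
    ultimately show ?thesis by (simp add: LIMSEQ_const_iff)
  qed
  have gW: "g \<in> W" using gF ge by (simp add: W_def)
  \<comment> \<open>First variation: by minimality \<open>E u u - \<kappa> * ip u u\<close> is
    nonnegative on \<open>W\<close> and at most zero at \<open>g\<close>.\<close>
  have eqW: "E g y = \<kappa> * ip g y" if y: "y \<in> W" for y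
  proof -
    have "0 \<le> t\<^sup>2 * (E y y - \<kappa> * ip y y) + 2 * t * (E g y - \<kappa> * ip g y)" for t
    proof -
      have "\<kappa> * ip (g + t *\<^sub>R y) (g + t *\<^sub>R y) \<le> E (g + t *\<^sub>R y) (g + t *\<^sub>R y)"
        using gW y W_scale by (intro min W_add) auto
      then have "\<kappa> * (1 + 2 * t * ip g y + t\<^sup>2 * ip y y) \<le> E g g + 2 * t * E g y + t\<^sup>2 * E y y"
        using gF WF[OF y] g1 by (simp add: L.ip_expand E.ip_expand)
      then show ?thesis using Eg by (simp add: algebra_simps)
    qed
    from quadratic_nonneg_linear_coeff[OF this] show ?thesis by simp
  qed
  \<comment> \<open>The equation extends from \<open>W\<close> to \<open>F\<close>: subtracting the
    projection \<open>p\<close> lands in \<open>W\<close>, and both forms vanish on \<open>g\<close>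
    and \<open>p\<close> because the \<open>e i\<close> are eigenvectors orthogonal to
    \<open>g\<close>.\<close>
  have "E g y = \<kappa> * ip g y" if y: "y \<in> F" for y
  proof -
    define p where "p = (\<Sum>i<n. ip y (e i) *\<^sub>R e i)"
    have pF: "p \<in> F" using e by (auto simp: p_def)
    have "ip p (e j) = ip y (e j)" if j: "j < n" for j
    proof -
      have "ip p (e j) = (\<Sum>i<n. ip y (e i) * ip (e i) (e j))"
        unfolding p_def using e j by (subst L.ip_sum_left) (auto simp: L.ip_simps)
      also have "\<dots> = (\<Sum>i<n. if i = j then ip y (e j) * ip (e j) (e j) else 0)"
        using orth j by (intro sum.cong) auto
      also have "\<dots> = ip y (e j)" using j norm[OF j] y by auto
      finally show ?thesis .
    qed
    then have "y - p \<in> W" using pF y e by (simp add: W_def L.ip_simps)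
    then have "E g (y - p) = \<kappa> * ip g (y - p)" by (rule eqW)
    moreover have "E g p = 0"
      unfolding p_def using e gF ge eig
      by (subst E.ip_sum_right) (auto simp: E.ip_simps E.ip_commute[OF gF] L.ip_commute[of _ g])
    moreover have "ip g p = 0"
      unfolding p_def using e gF ge by (subst L.ip_sum_right) (auto simp: L.ip_simps)
    ultimately show ?thesis using y pF gF by (simp add: E.ip_simps L.ip_simps)
  qed
  then show ?thesis using gW l0 g1 min by blast
qed

text \<open>Should the form domain be finite-dimensional, the sequence of eigenvectors is continued by
  zero vectors with eigenvalues that still tend to infinity.\<close>

lemma eigenbasis_exists:
  obtains e l where "\<And>n. e n \<in> F" "\<And>n. 0 \<le> l n" "\<And>i j. i \<noteq> j \<Longrightarrow> ip (e i) (e j) = 0"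
    "\<And>n v. v \<in> F \<Longrightarrow> E (e n) v = l n * ip (e n) v"
    "\<And>n. ip (e n) (e n) = 1 \<or> e n = 0" "filterlim l at_top sequentially"
    "\<And>n u. u \<in> F \<Longrightarrow> (\<And>i. i < n \<Longrightarrow> ip u (e i) = 0) \<Longrightarrow> l n * ip u u \<le> E u u"
proof -
  \<comment> \<open>The recursion runs over pairs of a vector and its eigenvalue. The last clause,
    minimality on the complement of the earlier vectors, is recorded because it later bounds the
    remainders of expansions.\<close>
  define Q where "Q f n r \<longleftrightarrow> fst r \<in> F \<and> 0 \<le> snd r \<and> (\<forall>i<n. ip (fst r) (fst (f i)) = 0) \<and>
      (\<forall>v\<in>F. E (fst r) v = snd r * ip (fst r) v) \<and>
      (ip (fst r) (fst r) = 1 \<or> fst r = 0 \<and> snd r = real n) \<and>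
      (\<forall>u\<in>F. (\<forall>i<n. ip u (fst (f i)) = 0) \<longrightarrow> snd r * ip u u \<le> E u u)"
    for f :: "nat \<Rightarrow> 'v \<times> real" and n r
  have "\<exists>f. \<forall>n. Q f n (f n)"
  proof (rule dependent_wellorder_choice)
    fix r n and f g :: "nat \<Rightarrow> 'v \<times> real" assume "\<And>m. m < n \<Longrightarrow> f m = g m"
    then show "Q f n r = Q g n r" by (simp add: Q_def)
  next
    fix n and f :: "nat \<Rightarrow> 'v \<times> real" assume IH: "\<And>m. m < n \<Longrightarrow> Q f m (f m)"
    let ?e = "\<lambda>i. fst (f i)"
    show "\<exists>r. Q f n r"
    proof (cases "\<exists>w\<in>F. (\<forall>i<n. ip w (?e i) = 0) \<and> ip w w \<noteq> 0")
      case True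
      have orth: "ip (?e i) (?e j) = 0" if "i < n" "j < n" "i \<noteq> j" for i j
      proof (cases "i < j")
        case True
        then have "ip (?e j) (?e i) = 0" "?e i \<in> F" "?e j \<in> F"
          using IH[of i] IH[of j] that unfolding Q_def by blast+
        then show ?thesis using L.ip_commute[of "?e i" "?e j"] by simp
      next
        case False
        then show ?thesis using IH[of i] that unfolding Q_def by (meson linorder_neqE_nat)
      qed
      obtain w where w: "w \<in> {u \<in> F. \<forall>i<n. ip u (?e i) = 0}" "ip w w \<noteq> 0" using True by blast
      have IH': "?e i \<in> F" "ip (?e i) (?e i) = 1 \<or> ?e i = 0"
        "\<And>v. v \<in> F \<Longrightarrow> E (?e i) v = snd (f i) * ip (?e i) v" if "i < n" for i
        using IH[OF that] unfolding Q_def by blast+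
      have "\<exists>x \<kappa>. x \<in> {u \<in> F. \<forall>i<n. ip u (?e i) = 0} \<and> 0 \<le> \<kappa> \<and> ip x x = 1 \<and>
          (\<forall>v\<in>F. E x v = \<kappa> * ip x v) \<and> (\<forall>u\<in>{u \<in> F. \<forall>i<n. ip u (?e i) = 0}. \<kappa> * ip u u \<le> E u u)"
        by (rule next_eigenvector[where l = "\<lambda>i. snd (f i)", OF IH'(1) orth IH'(2) IH'(3) w])
      then obtain x \<kappa> where "x \<in> F" "\<forall>i<n. ip x (?e i) = 0" "0 \<le> \<kappa>" "ip x x = 1"
        "\<forall>v\<in>F. E x v = \<kappa> * ip x v" "\<forall>u\<in>F. (\<forall>i<n. ip u (?e i) = 0) \<longrightarrow> \<kappa> * ip u u \<le> E u u" by auto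
      then have "Q f n (x, \<kappa>)" by (simp add: Q_def)
      then show ?thesis by blast
    next
      case False
      have "Q f n (0, real n)"
        using False IH E.ip_nonneg by (auto simp: Q_def)
      then show ?thesis by blast
    qed
  qed
  then obtain f where f: "\<And>n. Q f n (f n)" by blast
  define e where "e n = fst (f n)" for n
  define l where "l n = snd (f n)" for n
  have eF: "e n \<in> F" and l0: "0 \<le> l n" and norm: "ip (e n) (e n) = 1 \<or> e n = 0 \<and> l n = real n"
    and eig: "v \<in> F \<Longrightarrow> E (e n) v = l n * ip (e n) v" for n v
    using f[of n] by (auto simp: Q_def e_def l_def)
  have lmin: "l n * ip u u \<le> E u u" if "u \<in> F" "\<And>i. i < n \<Longrightarrow> ip u (e i) = 0" for n u
    using f[of n] that by (auto simp: Q_def e_def l_def)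
  have orth': "ip (e j) (e i) = 0" if "i < j" for i j using f[of j] that by (simp add: Q_def e_def)
  have orth: "ip (e i) (e j) = 0" if "i \<noteq> j" for i j
    using orth'[of i j] orth'[of j i] that L.ip_commute[of "e i" "e j"] eF by (cases "i < j") auto
  have "filterlim l at_top sequentially"
    unfolding filterlim_at_top
  proof (intro allI)
    fix Z
    show "\<forall>\<^sub>F n in sequentially. Z \<le> l n"
    proof (rule ccontr)
      assume "\<not> ?thesis"
      then have inf: "infinite {n. l n < Z}"
        by (simp add: not_eventually not_le frequently_cofinite flip: cofinite_eq_sequentially)
      \<comment> \<open>A zero vector at index \<open>n\<close> carries the value \<open>n\<close>,
        so only finitely many of these lie below \<open>Z\<close>.\<close>
      have "finite {n. e n = 0 \<and> l n = real n \<and> l n < Z}"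
      proof (rule finite_subset)
        show "{n. e n = 0 \<and> l n = real n \<and> l n < Z} \<subseteq> {..nat \<lceil>Z\<rceil>}"
          by (auto; linarith)
      qed simp
      moreover have "{n. l n < Z} \<subseteq> {n. e n = 0 \<and> l n = real n \<and> l n < Z} \<union> {n. l n < Z \<and> ip (e n) (e n) = 1}"
        using norm by auto
      ultimately have "infinite {n. l n < Z \<and> ip (e n) (e n) = 1}"
        using inf by (meson finite_Un finite_subset)
      \<comment> \<open>Infinitely many unit vectors with eigenvalues below \<open>Z\<close> have
        bounded energy and hence a convergent subsequence, although orthonormal vectors keep the
        squared distance 2.\<close>
      then obtain s :: "nat \<Rightarrow> nat" where s: "strict_mono s" and
        sn: "\<And>n. s n \<in> {n. l n < Z \<and> ip (e n) (e n) = 1}"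
        using infinite_enumerate by blast
      have Es: "E (e (s n)) (e (s n)) \<le> max Z 1" "ip (e (s n)) (e (s n)) \<le> max Z 1" for n
        using sn[of n] eig[OF eF[of "s n"], of "s n"] by auto
      have "\<exists>r g. strict_mono r \<and> g \<in> H \<and> L.conv (\<lambda>n. e (s (r n))) g"
        using compact_embedding[where u = "\<lambda>n. e (s n)", OF eF Es] .
      then obtain r g where r: "strict_mono r" and g: "g \<in> H" and cg: "L.conv (\<lambda>n. e (s (r n))) g"
        by blast
      have "L.Cau (\<lambda>n. e (s (r n)))" using eF g cg by (intro L.conv_imp_Cau) auto
      then obtain N where N: "\<forall>m\<ge>N. \<forall>n\<ge>N. L.nrm (e (s (r m)) - e (s (r n))) < 1"
        unfolding L.Cau_def using zero_less_one by blast
      let ?a = "s (r N)" and ?b = "s (r (Suc N))"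
      have "?a \<noteq> ?b" using s r by (simp add: strict_mono_eq)
      then have "ip (e ?a - e ?b) (e ?a - e ?b) = 2"
        using orth[of ?a ?b] orth[of ?b ?a] sn eF by (simp add: L.ip_simps)
      moreover have "(L.nrm (e ?a - e ?b))\<^sup>2 < 1\<^sup>2"
        using N eF by (intro power_strict_mono) (auto simp: L.nrm_nonneg)
      ultimately show False using eF by (simp add: L.nrm_sq)
    qed
  qed
  then show thesis using that[of e l] eF l0 orth eig norm lmin by blast
qed

end

text \<open>The tail is written as a sum over \<open>{..<n}\<close> with a cut-off because
  differences of the partial sums \<open>lin\<close> take this shape.\<close>

lemma sum_tail_le:
  fixes b :: "nat \<Rightarrow> real"
  assumes "summable b" "\<And>i. 0 \<le> b i" "m \<le> n"
  shows "(\<Sum>i<n. if m \<le> i then b i else 0) \<le> suminf b - (\<Sum>i<m. b i)"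
proof -
  have "(\<Sum>i<n. if m \<le> i then b i else 0) = (\<Sum>i=m..<n. b i)"
    by (rule sum.mono_neutral_cong_right) auto
  moreover have "(\<Sum>i<m. b i) + (\<Sum>i=m..<n. b i) = (\<Sum>i<n. b i)"
    using assms(3) by (simp add: lessThan_atLeast0 sum.atLeastLessThan_concat)
  moreover have "(\<Sum>i<n. b i) \<le> suminf b" using assms by (intro sum_le_suminf) auto
  ultimately show ?thesis by linarith
qed

lemma tail_tendsto:
  fixes b :: "nat \<Rightarrow> real"
  assumes "summable b"
  shows "(\<lambda>m. suminf b - (\<Sum>i<m. b i)) \<longlonglongrightarrow> 0"
  using tendsto_diff[OF tendsto_const summable_LIMSEQ[OF assms], of "suminf b"] by simp

section \<open>Expansion in eigenvectors\<close>

locale eigenbasis = compact_closed_form H ip F E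
  for H :: "'v::real_vector set" and ip and F :: "'v set" and E +
  fixes e :: "nat \<Rightarrow> 'v" and l :: "nat \<Rightarrow> real"
  assumes e_mem [simp, intro]: "e n \<in> F"
    and l_nonneg [simp]: "0 \<le> l n"
    and e_orth: "i \<noteq> j \<Longrightarrow> ip (e i) (e j) = 0"
    and e_eigen: "v \<in> F \<Longrightarrow> E (e n) v = l n * ip (e n) v"
    and e_norm: "ip (e n) (e n) = 1 \<or> e n = 0"
    and l_top: "filterlim l at_top sequentially"
    and l_min: "u \<in> F \<Longrightarrow> (\<And>i. i < n \<Longrightarrow> ip u (e i) = 0) \<Longrightarrow> l n * ip u u \<le> E u u"
begin

definition coef :: "'v \<Rightarrow> nat \<Rightarrow> real" where "coef f n = ip f (e n)"

definition lin :: "(nat \<Rightarrow> real) \<Rightarrow> nat \<Rightarrow> 'v" where "lin a N = (\<Sum>i<N. a i *\<^sub>R e i)"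

text \<open>The sequence vanishes at the indices with \<open>e i = 0\<close>. Without this the
  coefficients of \<open>lin a N\<close> need not give back \<open>a\<close>.\<close>

definition supp :: "(nat \<Rightarrow> real) \<Rightarrow> bool" where "supp a \<longleftrightarrow> (\<forall>i. a i * ip (e i) (e i) = a i)"

lemma supp_coef [simp]: "f \<in> H \<Longrightarrow> supp (coef f)"
  unfolding supp_def coef_def using e_norm by (metis F_H L.ip_zero_right e_mem mult.right_neutral mult_zero_left)

lemma supp_mult [simp]: "supp a \<Longrightarrow> supp (\<lambda>i. m i * a i)"
  by (simp add: supp_def)

lemma lin_F [simp, intro]: "lin a N \<in> F"
  by (auto simp: lin_def)

lemma lin_H [simp, intro]: "lin a N \<in> H"
  by blast

lemma ip_lin_left: "y \<in> H \<Longrightarrow> ip (lin a N) y = (\<Sum>i<N. a i * coef y i)"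
  unfolding lin_def coef_def by (subst L.ip_sum_left) (auto simp: L.ip_simps L.ip_commute)

lemma coef_lin: "supp a \<Longrightarrow> coef (lin a N) j = (if j < N then a j else 0)"
proof -
  assume a: "supp a"
  have "coef (lin a N) j = (\<Sum>i<N. a i * ip (e i) (e j))"
    unfolding coef_def lin_def by (subst L.ip_sum_left) (auto simp: L.ip_simps)
  also have "\<dots> = (\<Sum>i<N. if i = j then a j else 0)"
    using a e_orth by (intro sum.cong) (auto simp: supp_def)
  finally show ?thesis by simp
qed

lemma ip_lin_lin: "supp a \<Longrightarrow> ip (lin a N) (lin a N) = (\<Sum>i<N. (a i)\<^sup>2)"
  by (simp add: ip_lin_left coef_lin power2_eq_square)

lemma E_lin_left: "y \<in> F \<Longrightarrow> E (lin a N) y = (\<Sum>i<N. l i * a i * coef y i)"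
  unfolding lin_def coef_def
  by (subst E.ip_sum_left) (auto simp: E.ip_simps e_eigen L.ip_commute intro!: sum.cong)

lemma E_lin_lin: "supp a \<Longrightarrow> E (lin a N) (lin a N) = (\<Sum>i<N. l i * (a i)\<^sup>2)"
  by (simp add: E_lin_left coef_lin power2_eq_square mult.assoc)

lemma lin_diff: "m \<le> n \<Longrightarrow> lin a n - lin a m = lin (\<lambda>i. if m \<le> i then a i else 0) n"
proof -
  assume mn: "m \<le> n"
  have "lin a n = (\<Sum>i<m. a i *\<^sub>R e i) + (\<Sum>i=m..<n. a i *\<^sub>R e i)"
    unfolding lin_def using mn by (simp add: lessThan_atLeast0 sum.atLeastLessThan_concat)
  moreover have "(\<Sum>i=m..<n. a i *\<^sub>R e i) = lin (\<lambda>i. if m \<le> i then a i else 0) n"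
    unfolding lin_def by (rule sum.mono_neutral_cong_left) auto
  ultimately show ?thesis by (simp add: lin_def)
qed

lemma lin_Cau:
  assumes a: "supp a" and s: "summable (\<lambda>i. (a i)\<^sup>2)"
  shows "L.Cau (lin a)"
proof (rule L.CauI[OF _ tail_tendsto[OF s]])
  fix m n :: nat assume mn: "m \<le> n"
  let ?b = "\<lambda>i. if m \<le> i then a i else 0"
  have "ip (lin a m - lin a n) (lin a m - lin a n) = ip (lin ?b n) (lin ?b n)"
    using L.ip_minus_left[of "lin a n - lin a m"] by (simp add: L.ip_minus_right flip: lin_diff[OF mn])
      (simp add: L.ip_simps)
  also have "\<dots> = (\<Sum>i<n. (?b i)\<^sup>2)" using a by (intro ip_lin_lin) (auto simp: supp_def)
  also have "\<dots> = (\<Sum>i<n. if m \<le> i then (a i)\<^sup>2 else 0)" by (intro sum.cong) auto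
  also have "\<dots> \<le> suminf (\<lambda>i. (a i)\<^sup>2) - (\<Sum>i<m. (a i)\<^sup>2)" by (rule sum_tail_le[OF s _ mn]) simp
  also have "\<dots> \<le> \<dots> + (suminf (\<lambda>i. (a i)\<^sup>2) - (\<Sum>i<n. (a i)\<^sup>2))"
    using sum_le_suminf[OF s, of "{..<n}"] by simp
  finally show "ip (lin a m - lin a n) (lin a m - lin a n) \<le> \<dots>" .
qed simp

lemma lin_E_Cau:
  assumes a: "supp a" and s: "summable (\<lambda>i. l i * (a i)\<^sup>2)"
  shows "E.Cau (lin a)"
proof (rule E.CauI[OF _ tail_tendsto[OF s]])
  fix m n :: nat assume mn: "m \<le> n"
  let ?b = "\<lambda>i. if m \<le> i then a i else 0"
  have "E (lin a m - lin a n) (lin a m - lin a n) = E (lin ?b n) (lin ?b n)"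
    by (simp add: E.ip_simps flip: lin_diff[OF mn])
  also have "\<dots> = (\<Sum>i<n. l i * (?b i)\<^sup>2)" using a by (intro E_lin_lin) (auto simp: supp_def)
  also have "\<dots> = (\<Sum>i<n. if m \<le> i then l i * (a i)\<^sup>2 else 0)" by (intro sum.cong) auto
  also have "\<dots> \<le> suminf (\<lambda>i. l i * (a i)\<^sup>2) - (\<Sum>i<m. l i * (a i)\<^sup>2)"
    by (rule sum_tail_le[OF s _ mn]) simp
  also have "\<dots> \<le> \<dots> + (suminf (\<lambda>i. l i * (a i)\<^sup>2) - (\<Sum>i<n. l i * (a i)\<^sup>2))"
    using sum_le_suminf[OF s, of "{..<n}"] by simp
  finally show "E (lin a m - lin a n) (lin a m - lin a n) \<le> \<dots>" .
qed simp

lemma Bessel: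
  assumes f: "f \<in> H"
  shows "(\<Sum>i<N. (coef f i)\<^sup>2) \<le> ip f f"
proof -
  let ?s = "lin (coef f) N"
  have "0 \<le> ip (f - ?s) (f - ?s)" using f by (intro L.ip_nonneg) auto
  also have "\<dots> = ip f f - 2 * ip ?s f + ip ?s ?s"
    using f by (simp add: L.ip_simps L.ip_commute[of f ?s])
  also have "\<dots> = ip f f - (\<Sum>i<N. (coef f i)\<^sup>2)"
    using f ip_lin_lin[OF supp_coef[OF f], of N] by (simp add: ip_lin_left[OF f] power2_eq_square)
  finally show ?thesis by simp
qed

lemma summable_coef: "f \<in> H \<Longrightarrow> summable (\<lambda>i. (coef f i)\<^sup>2)"
  by (rule summableI_nonneg_bounded[where x = "ip f f"]) (auto simp: Bessel)

text \<open>The remainder is orthogonal to the first \<open>N\<close> eigenvectors, so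
  \<open>l_min\<close> bounds its squared norm by its energy divided by \<open>l N\<close>. That
  energy is at most \<open>E u u\<close>, and \<open>l N\<close> tends to infinity.\<close>

lemma conv_lin_F:
  assumes u: "u \<in> F"
  shows "L.conv (lin (coef u)) u"
proof -
  let ?r = "\<lambda>N. u - lin (coef u) N"
  have le: "l N * (L.nrm (lin (coef u) N - u))\<^sup>2 \<le> E u u" for N
  proof -
    have "l N * ip (?r N) (?r N) \<le> E (?r N) (?r N)"
    proof (rule l_min)
      fix i assume "i < N"
      then show "ip (?r N) (e i) = 0"
        using coef_lin[OF supp_coef[of u], of N i] u by (simp add: L.ip_simps coef_def)
    qed (use u in auto)
    also have "\<dots> = E u u - 2 * E (lin (coef u) N) u + E (lin (coef u) N) (lin (coef u) N)"
      using u by (simp add: E.ip_simps E.ip_commute[OF u, of "lin (coef u) N"])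
    also have "\<dots> = E u u - (\<Sum>i<N. l i * (coef u i)\<^sup>2)"
      using u by (simp add: E_lin_left[OF u] E_lin_lin[OF supp_coef] power2_eq_square mult.assoc)
    also have "\<dots> \<le> E u u" by (simp add: sum_nonneg)
    finally show ?thesis using u L.nrm_diff_commute[of u "lin (coef u) N"] by (simp add: L.nrm_sq[symmetric])
  qed
  have "(\<lambda>N. (L.nrm (lin (coef u) N - u))\<^sup>2) \<longlonglongrightarrow> 0"
  proof (rule Lim_null_comparison)
    have "\<forall>\<^sub>F N in sequentially. 0 < l N" using l_top by (simp add: filterlim_at_top_dense)
    then show "\<forall>\<^sub>F N in sequentially. norm ((L.nrm (lin (coef u) N - u))\<^sup>2) \<le> E u u * inverse (l N)"
      by eventually_elim (use le in \<open>simp add: field_simps\<close>)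
    show "(\<lambda>N. E u u * inverse (l N)) \<longlonglongrightarrow> 0"
      by (intro tendsto_mult_right_zero tendsto_inverse_0_at_top l_top)
  qed
  then have "(\<lambda>N. sqrt ((L.nrm (lin (coef u) N - u))\<^sup>2)) \<longlonglongrightarrow> sqrt 0" by (rule tendsto_real_sqrt)
  then show ?thesis unfolding L.conv_def using u by (simp add: L.nrm_nonneg)
qed

text \<open>Vectors of \<open>F\<close> are limits of combinations of the \<open>e i\<close>, so
  \<open>f\<close> is orthogonal to all of \<open>F\<close> and density applies.\<close>

lemma null_if_coef_zero:
  assumes f: "f \<in> H" and z: "\<And>i. coef f i = 0"
  shows "L.nrm f = 0"
proof (rule dense[OF f])
  fix v assume v: "v \<in> F"
  have "(\<lambda>N. ip (lin (coef v) N) f) \<longlonglongrightarrow> ip v f"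
    using conv_lin_F[OF v] f v by (intro L.conv_ip_left) auto
  then have "ip v f = 0" using f z by (simp add: ip_lin_left LIMSEQ_const_iff)
  then show "ip f v = 0" using f v by (simp add: L.ip_commute)
qed

lemma eq_if_coef_eq: "f \<in> H \<Longrightarrow> g \<in> H \<Longrightarrow> (\<And>i. coef f i = coef g i) \<Longrightarrow> L.nrm (f - g) = 0"
  by (rule null_if_coef_zero) (auto simp: coef_def L.ip_simps)

text \<open>An arbitrary choice among the limits, which are unique only up to seminorm zero;
  everything proved about it goes through its coefficients.\<close>

definition series :: "(nat \<Rightarrow> real) \<Rightarrow> 'v" where "series a = (SOME x. x \<in> H \<and> L.conv (lin a) x)"

context
  fixes a assumes a: "supp a" "summable (\<lambda>i. (a i)\<^sup>2)"
begin

lemma series_mem: "series a \<in> H" and conv_series: "L.conv (lin a) (series a)"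
proof -
  have "\<exists>x. x \<in> H \<and> L.conv (lin a) x" using L.complete[OF _ lin_Cau[OF a]] by auto
  then have "series a \<in> H \<and> L.conv (lin a) (series a)" unfolding series_def by (rule someI_ex)
  then show "series a \<in> H" "L.conv (lin a) (series a)" by auto
qed

lemma coef_series: "coef (series a) j = a j"
proof -
  have "(\<lambda>N. coef (lin a N) j) \<longlonglongrightarrow> coef (series a) j"
    unfolding coef_def using conv_series series_mem by (intro L.conv_ip_left) auto
  moreover have "(\<lambda>N. coef (lin a N) j) \<longlonglongrightarrow> a j"
  proof (rule tendsto_eventually)
    show "\<forall>\<^sub>F N in sequentially. coef (lin a N) j = a j"
      using eventually_gt_at_top[of j] by eventually_elim (simp add: coef_lin a)
  qed
  ultimately show ?thesis by (rule LIMSEQ_unique)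
qed

end

text \<open>The expansion converges to some vector with the same coefficients as \<open>f\<close>,
  and such a vector differs from \<open>f\<close> by a null vector. This extends
  \<open>conv_lin_F\<close> from the form domain to all of \<open>H\<close>.\<close>

lemma conv_lin_coef:
  assumes f: "f \<in> H"
  shows "L.conv (lin (coef f)) f"
proof -
  let ?g = "series (coef f)"
  note s = supp_coef[OF f] summable_coef[OF f]
  have n: "L.nrm (?g - f) = 0" using f by (intro eq_if_coef_eq series_mem s) (auto simp: coef_series[OF s])
  show ?thesis
    unfolding L.conv_def
  proof (rule Lim_null_comparison)
    show "\<forall>\<^sub>F N in sequentially. norm (L.nrm (lin (coef f) N - f)) \<le> L.nrm (lin (coef f) N - ?g)"
      using L.nrm_triangle2[of _ ?g f] f series_mem[OF s] n
      by (intro always_eventually allI) (simp add: L.nrm_nonneg)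
    show "(\<lambda>N. L.nrm (lin (coef f) N - ?g)) \<longlonglongrightarrow> 0" using conv_series[OF s] by (simp add: L.conv_def)
  qed
qed

lemma Parseval: "f \<in> H \<Longrightarrow> g \<in> H \<Longrightarrow> (\<lambda>i. coef f i * coef g i) sums ip f g"
  unfolding sums_def using L.conv_ip_left[OF _ _ _ conv_lin_coef, of f g]
  by (simp add: ip_lin_left)

lemma nrm_sq_suminf: "f \<in> H \<Longrightarrow> (L.nrm f)\<^sup>2 = (\<Sum>i. (coef f i)\<^sup>2)"
  using sums_unique[OF Parseval[of f f]] by (simp add: L.nrm_sq power2_eq_square[of "coef f _"])

text \<open>Dominated convergence for the Parseval series. With it, limits in the norm reduce to
  limits of single coefficients and a summable bound.\<close>

lemma nrm_tendsto_0:
  assumes x: "\<forall>\<^sub>F t in T. x t \<in> H" and lim: "\<And>i. ((\<lambda>t. coef (x t) i) \<longlongrightarrow> 0) T"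
    and b: "\<forall>\<^sub>F t in T. \<forall>i. (coef (x t) i)\<^sup>2 \<le> b i" and s: "summable b" and T: "T \<noteq> bot"
  shows "((\<lambda>t. L.nrm (x t)) \<longlongrightarrow> 0) T"
proof -
  have "((\<lambda>t. \<Sum>i. (coef (x t) i)\<^sup>2) \<longlongrightarrow> (\<Sum>i. 0\<^sup>2)) T"
  proof (rule tannerys_theorem[THEN conjunct2, THEN conjunct2])
    show "((\<lambda>t. (coef (x t) i)\<^sup>2) \<longlongrightarrow> 0\<^sup>2) T" for i by (intro tendsto_power lim)
    have "\<forall>\<^sub>F p in at_top \<times>\<^sub>F T. (\<forall>i. (coef (x (snd p)) i)\<^sup>2 \<le> b i)"
      using eventually_compose_filterlim[OF b filterlim_snd] .
    then show "\<forall>\<^sub>F (i, t) in at_top \<times>\<^sub>F T. norm ((coef (x t) i)\<^sup>2) \<le> b i"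
      by eventually_elim auto
  qed (use s T in auto)
  then have "((\<lambda>t. sqrt (\<Sum>i. (coef (x t) i)\<^sup>2)) \<longlongrightarrow> sqrt 0) T" by (intro tendsto_real_sqrt) simp
  moreover have "\<forall>\<^sub>F t in T. sqrt (\<Sum>i. (coef (x t) i)\<^sup>2) = L.nrm (x t)"
    using x by eventually_elim (simp add: L.nrm_nonneg flip: nrm_sq_suminf)
  ultimately show ?thesis by (simp add: tendsto_cong)
qed

text \<open>The partial sums converge to \<open>x\<close> in \<open>H\<close> and are Cauchy in
  energy by summability, so closedness puts \<open>x\<close> into \<open>F\<close> and gives the
  values of \<open>E\<close> termwise.\<close>

lemma in_form_domain:
  assumes x: "x \<in> H" and s: "summable (\<lambda>i. l i * (coef x i)\<^sup>2)"
  shows "x \<in> F" and "E x x = (\<Sum>i. l i * (coef x i)\<^sup>2)"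
    and "v \<in> F \<Longrightarrow> (\<lambda>i. l i * coef x i * coef v i) sums E x v"
proof -
  have *: "x \<in> F \<and> E.conv (lin (coef x)) x"
    using x s by (intro closed conv_lin_coef lin_E_Cau) auto
  then show xF: "x \<in> F" by simp
  show **: "(\<lambda>i. l i * coef x i * coef v i) sums E x v" if v: "v \<in> F" for v
    unfolding sums_def using E.conv_ip_left[OF _ xF v, of "lin (coef x)"] * v by (simp add: E_lin_left)
  show "E x x = (\<Sum>i. l i * (coef x i)\<^sup>2)"
    using sums_unique[OF **[OF xF]] by (simp add: power2_eq_square mult.assoc)
qed

section \<open>The semigroup defined by the spectrum\<close>

definition spectral_semigroup :: "real \<Rightarrow> 'v \<Rightarrow> 'v" where
  "spectral_semigroup t f = series (\<lambda>i. exp (- l i * t) * coef f i)"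

lemma exp_coef:
  assumes f: "f \<in> H" and t: "0 \<le> t"
  shows "supp (\<lambda>i. exp (- l i * t) * coef f i)" "summable (\<lambda>i. (exp (- l i * t) * coef f i)\<^sup>2)"
    "(exp (- l i * t) * coef f i)\<^sup>2 \<le> (coef f i)\<^sup>2"
proof -
  have *: "(exp (- l i * t) * coef f i)\<^sup>2 \<le> (coef f i)\<^sup>2" for i
    using t by (simp add: power_mult_distrib mult_left_le_one_le power_le_one)
  then show "(exp (- l i * t) * coef f i)\<^sup>2 \<le> (coef f i)\<^sup>2" .
  show "summable (\<lambda>i. (exp (- l i * t) * coef f i)\<^sup>2)"
    by (rule summable_comparison_test'[OF summable_coef[OF f], of 0]) (use * in simp)
  show "supp (\<lambda>i. exp (- l i * t) * coef f i)" using f by simp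
qed

lemma spectral_semigroup_mem [simp, intro]: "f \<in> H \<Longrightarrow> 0 \<le> t \<Longrightarrow> spectral_semigroup t f \<in> H"
  and coef_semigroup: "f \<in> H \<Longrightarrow> 0 \<le> t \<Longrightarrow> coef (spectral_semigroup t f) i = exp (- l i * t) * coef f i"
  unfolding spectral_semigroup_def using exp_coef by (auto simp: series_mem coef_series)

lemma coef_simps: "f \<in> H \<Longrightarrow> g \<in> H \<Longrightarrow> coef (f + g) i = coef f i + coef g i"
  "f \<in> H \<Longrightarrow> g \<in> H \<Longrightarrow> coef (f - g) i = coef f i - coef g i"
  "f \<in> H \<Longrightarrow> coef (c *\<^sub>R f) i = c * coef f i"
  by (auto simp: coef_def L.ip_simps)

lemma c0_spectral_semigroup: "c0_semigroup H ip spectral_semigroup"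
proof
  fix t x assume t: "(0::real) \<le> t"
  show "\<exists>K. \<forall>x\<in>H. L.nrm (spectral_semigroup t x) \<le> K * L.nrm x"
  proof (intro exI[of _ 1] ballI)
    fix x assume x: "x \<in> H"
    have "(\<Sum>i. (coef (spectral_semigroup t x) i)\<^sup>2) \<le> (\<Sum>i. (coef x i)\<^sup>2)"
      by (intro suminf_le summable_coef spectral_semigroup_mem x t)
        (simp only: coef_semigroup[OF x t] exp_coef(3)[OF x t])
    then have "(L.nrm (spectral_semigroup t x))\<^sup>2 \<le> (L.nrm x)\<^sup>2"
      by (simp only: nrm_sq_suminf[OF x] nrm_sq_suminf[OF spectral_semigroup_mem[OF x t]])
    from power2_le_imp_le[OF this L.nrm_nonneg[OF x]]
    show "L.nrm (spectral_semigroup t x) \<le> 1 * L.nrm x" by simp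
  qed
next
  fix x assume x: "x \<in> H"
  show "((\<lambda>t. L.nrm (spectral_semigroup t x - x)) \<longlongrightarrow> 0) (at_right 0)"
  proof (rule nrm_tendsto_0)
    have ev: "\<forall>\<^sub>F t in at_right (0::real). 0 < t" by (rule eventually_at_right_less)
    show "\<forall>\<^sub>F t in at_right 0. spectral_semigroup t x - x \<in> H"
      using ev by eventually_elim (use x in auto)
    show "((\<lambda>t. coef (spectral_semigroup t x - x) i) \<longlongrightarrow> 0) (at_right 0)" for i
    proof (rule Lim_transform_eventually)
      show "\<forall>\<^sub>F t in at_right 0. (exp (- l i * t) - 1) * coef x i = coef (spectral_semigroup t x - x) i"
        using ev by eventually_elim (use x in \<open>simp add: coef_simps coef_semigroup algebra_simps\<close>)
      show "((\<lambda>t. (exp (- l i * t) - 1) * coef x i) \<longlongrightarrow> 0) (at_right 0)"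
        by (auto intro!: tendsto_eq_intros)
    qed
    show "\<forall>\<^sub>F t in at_right 0. \<forall>i. (coef (spectral_semigroup t x - x) i)\<^sup>2 \<le> (coef x i)\<^sup>2"
      using ev
    proof eventually_elim
      case (elim t)
      have "(exp (- (l i * t)) - 1)\<^sup>2 * (coef x i)\<^sup>2 \<le> 1 * (coef x i)\<^sup>2" for i
      proof (rule mult_right_mono)
        have "\<bar>exp (- (l i * t)) - 1\<bar> \<le> 1" using elim by (simp add: abs_le_iff)
        then show "(exp (- (l i * t)) - 1)\<^sup>2 \<le> 1" by (simp add: abs_square_le_1)
      qed simp
      then show ?case using elim x
        by (auto simp: coef_simps coef_semigroup algebra_simps simp flip: power_mult_distrib)
    qed
  qed (use summable_coef[OF x] in auto)
\<comment> \<open>The algebraic laws hold up to seminorm zero because both sides have the same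
  coefficients.\<close>
qed (auto intro!: eq_if_coef_eq simp: coef_semigroup coef_simps algebra_simps exp_add exp_diff exp_minus divide_inverse)

text \<open>Both relations say that \<open>coef w i = - l i * coef u i\<close> for all
  \<open>i\<close>. For the generator this is the derivative of the exponential at zero; for the
  form operator it is the defining equation tested with \<open>e i\<close>.\<close>

lemma generator_semigroup: "c0_semigroup.generator H ip spectral_semigroup = form_operator"
proof -
  interpret P: c0_semigroup H ip spectral_semigroup by (rule c0_spectral_semigroup)
  have ev: "\<forall>\<^sub>F t in at_right (0::real). 0 < t" by (rule eventually_at_right_less)
  have der: "((\<lambda>t. (exp (- l i * t) - 1) / t) \<longlongrightarrow> - l i) (at_right 0)" for i
  proof -
    have "((\<lambda>t. exp (- l i * t)) has_real_derivative - l i) (at 0)"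
      by (auto intro!: derivative_eq_intros)
    then show ?thesis
      by (simp add: has_field_derivative_iff filterlim_at_split)
  qed
  have cdiff: "coef ((1 / t) *\<^sub>R (spectral_semigroup t f - f) - g) i = (exp (- l i * t) - 1) / t * coef f i - coef g i"
    if "0 < t" "f \<in> H" "g \<in> H" for t f g i
    using that by (simp add: coef_simps coef_semigroup field_simps)
  show ?thesis
  proof (intro equalityI subrelI)
    fix f g assume fg: "(f, g) \<in> P.generator"
    then have f: "f \<in> H" and g: "g \<in> H"
      and lim: "((\<lambda>t. L.nrm ((1 / t) *\<^sub>R (spectral_semigroup t f - f) - g)) \<longlongrightarrow> 0) (at_right 0)"
      by (auto simp: P.generator_def)
    have cg: "coef g i = - l i * coef f i" for i
    proof -
      have "((\<lambda>t. coef ((1 / t) *\<^sub>R (spectral_semigroup t f - f) - g) i) \<longlongrightarrow> 0) (at_right 0)"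
      proof (rule Lim_null_comparison)
        show "\<forall>\<^sub>F t in at_right 0. norm (coef ((1 / t) *\<^sub>R (spectral_semigroup t f - f) - g) i) \<le>
            L.nrm ((1 / t) *\<^sub>R (spectral_semigroup t f - f) - g) * L.nrm (e i)"
          using ev
        proof eventually_elim
          case (elim t)
          then show ?case unfolding coef_def real_norm_def using f g by (intro L.Cauchy_Schwarz) auto
        qed
      qed (rule tendsto_mult_left_zero[OF lim])
      moreover have "((\<lambda>t. coef ((1 / t) *\<^sub>R (spectral_semigroup t f - f) - g) i) \<longlongrightarrow> - l i * coef f i - coef g i) (at_right 0)"
      proof (rule Lim_transform_eventually)
        show "((\<lambda>t. (exp (- l i * t) - 1) / t * coef f i - coef g i) \<longlongrightarrow> - l i * coef f i - coef g i) (at_right 0)"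
          by (intro tendsto_intros der)
        show "\<forall>\<^sub>F t in at_right 0. (exp (- l i * t) - 1) / t * coef f i - coef g i =
            coef ((1 / t) *\<^sub>R (spectral_semigroup t f - f) - g) i"
          using ev by eventually_elim (simp add: cdiff f g)
      qed
      ultimately have "- l i * coef f i - coef g i = 0" by (intro tendsto_unique) auto
      then show ?thesis by simp
    qed
    \<comment> \<open>Parseval for \<open>g\<close> and \<open>f\<close>: the series is
      \<open>- ip g f\<close>, so membership in the domain of the generator already forces finite
      energy.\<close>
    have "summable (\<lambda>i. l i * (coef f i)\<^sup>2)"
      using sums_summable[OF sums_minus[OF Parseval[OF g f]]]
      by (simp add: cg power2_eq_square mult.assoc)
    note dom = in_form_domain[OF f this]
    have "E f v = - ip g v" if v: "v \<in> F" for v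
    proof -
      have "(\<lambda>i. l i * coef f i * coef v i) sums (- ip g v)"
        using sums_minus[OF Parseval[OF g F_H[OF v]]] by (simp add: cg)
      then show ?thesis using dom(3)[OF v] sums_unique2 by blast
    qed
    then show "(f, g) \<in> form_operator" using dom(1) g by (simp add: form_operator_def)
  next
    fix u w assume "(u, w) \<in> form_operator"
    then have uF: "u \<in> F" and w: "w \<in> H" and uw: "\<And>v. v \<in> F \<Longrightarrow> E u v = - ip w v"
      by (auto simp: form_operator_def)
    have u: "u \<in> H" using uF by simp
    have cw: "coef w i = - l i * coef u i" for i
      using uw[of "e i"] e_eigen[OF uF, of i] E.ip_commute[OF uF, of "e i"] L.ip_commute[of u "e i"] uF
      by (simp add: coef_def)
    have "((\<lambda>t. L.nrm ((1 / t) *\<^sub>R (spectral_semigroup t u - u) - w)) \<longlongrightarrow> 0) (at_right 0)"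
    proof (rule nrm_tendsto_0)
      show "\<forall>\<^sub>F t in at_right 0. (1 / t) *\<^sub>R (spectral_semigroup t u - u) - w \<in> H"
        using ev by eventually_elim (use u w in auto)
      show "((\<lambda>t. coef ((1 / t) *\<^sub>R (spectral_semigroup t u - u) - w) i) \<longlongrightarrow> 0) (at_right 0)" for i
      proof (rule Lim_transform_eventually)
        have "((\<lambda>t. (exp (- l i * t) - 1) / t * coef u i - coef w i) \<longlongrightarrow> - l i * coef u i - coef w i) (at_right 0)"
          by (intro tendsto_intros der)
        then show "((\<lambda>t. (exp (- l i * t) - 1) / t * coef u i - coef w i) \<longlongrightarrow> 0) (at_right 0)"
          by (simp add: cw)
        show "\<forall>\<^sub>F t in at_right 0. (exp (- l i * t) - 1) / t * coef u i - coef w i =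
            coef ((1 / t) *\<^sub>R (spectral_semigroup t u - u) - w) i"
          using ev by eventually_elim (simp add: cdiff u w)
      qed
      show "\<forall>\<^sub>F t in at_right 0. \<forall>i. (coef ((1 / t) *\<^sub>R (spectral_semigroup t u - u) - w) i)\<^sup>2 \<le> (coef w i)\<^sup>2"
        using ev
      proof eventually_elim
        case (elim t)
        have "(coef ((1 / t) *\<^sub>R (spectral_semigroup t u - u) - w) i)\<^sup>2 \<le> (coef w i)\<^sup>2" for i
        proof -
          \<comment> \<open>The error in coefficient \<open>i\<close> is
            \<open>?d * coef u i\<close>. From \<open>1 - l t \<le> exp (- l t) \<le> 1\<close> one
            gets \<open>0 \<le> ?d \<le> l i\<close>, so its square is at most that of
            \<open>coef w i\<close>, a summable bound independent of \<open>t\<close>.\<close>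
          let ?d = "(exp (- l i * t) - 1) / t + l i"
          have "1 - l i * t \<le> exp (- l i * t)" using exp_ge_add_one_self[of "- l i * t"] by simp
          moreover have "exp (- l i * t) \<le> 1" using elim by simp
          ultimately have "0 \<le> ?d" "?d \<le> l i" using elim by (auto simp: field_simps)
          then have "?d\<^sup>2 * (coef u i)\<^sup>2 \<le> (l i)\<^sup>2 * (coef u i)\<^sup>2" by (intro mult_right_mono power_mono) auto
          moreover have "coef ((1 / t) *\<^sub>R (spectral_semigroup t u - u) - w) i = ?d * coef u i"
            unfolding cdiff[OF elim u w] cw by (simp add: algebra_simps)
          ultimately show ?thesis by (simp add: cw power_mult_distrib)
        qed
        then show ?case ..
      qed
    qed (use summable_coef[OF w] in auto)
    then show "(u, w) \<in> P.generator" using u w by (simp add: P.generator_def)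
  qed
qed

text \<open>With \<open>y = l i * t\<close> the energy bound is
  \<open>y * exp (- 2 * y) \<le> 1\<close>, a consequence of \<open>y \<le> exp y\<close>. Large
  eigenvalues are damped faster than the energy weights them.\<close>

lemma spectral_semigroup_smoothing:
  assumes f: "f \<in> H" and t: "0 < t"
  shows "spectral_semigroup t f \<in> F" "E (spectral_semigroup t f) (spectral_semigroup t f) \<le> ip f f / t"
    "ip (spectral_semigroup t f) (spectral_semigroup t f) \<le> ip f f"
proof -
  let ?g = "spectral_semigroup t f"
  have g: "?g \<in> H" using f t by simp
  have le: "l i * (coef ?g i)\<^sup>2 \<le> (coef f i)\<^sup>2 / t" for i
  proof -
    define y where "y = l i * t"
    have y: "0 \<le> y" using t by (simp add: y_def)
    have "y \<le> exp y" using exp_ge_add_one_self[of y] by linarith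
    also have "\<dots> \<le> (exp y)\<^sup>2" using y by (simp add: power2_eq_square)
    finally have "y * (exp (- y))\<^sup>2 \<le> 1" by (simp add: exp_minus field_simps)
    then have "(y * (exp (- y))\<^sup>2) * (coef f i)\<^sup>2 / t \<le> 1 * (coef f i)\<^sup>2 / t"
      using t by (intro divide_right_mono mult_right_mono) auto
    moreover have "l i * (coef ?g i)\<^sup>2 = (y * (exp (- y))\<^sup>2) * (coef f i)\<^sup>2 / t"
      using t f by (simp add: coef_semigroup y_def power_mult_distrib)
    ultimately show ?thesis by simp
  qed
  have sf: "summable (\<lambda>i. (coef f i)\<^sup>2 / t)" using summable_coef[OF f] by (rule summable_divide)
  have s: "summable (\<lambda>i. l i * (coef ?g i)\<^sup>2)"
    by (rule summable_comparison_test'[OF sf, of 0]) (use le in simp)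
  note dom = in_form_domain[OF g s]
  show "?g \<in> F" by (rule dom(1))
  have "E ?g ?g \<le> (\<Sum>i. (coef f i)\<^sup>2 / t)" unfolding dom(2) using le s sf by (intro suminf_le) auto
  also have "\<dots> = ip f f / t"
    using f summable_coef[OF f] by (simp add: suminf_divide flip: L.nrm_sq nrm_sq_suminf)
  finally show "E ?g ?g \<le> ip f f / t" .
  have "(\<Sum>i. (coef ?g i)\<^sup>2) \<le> (\<Sum>i. (coef f i)\<^sup>2)"
    using f t exp_coef(3)[OF f, of t] by (intro suminf_le summable_coef) (auto simp: coef_semigroup)
  then show "ip ?g ?g \<le> ip f f" using f g by (simp flip: L.nrm_sq add: nrm_sq_suminf)
qed

lemma spectral_semigroup_compact:
  fixes f :: "nat \<Rightarrow> 'v"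
  assumes t: "0 < t" and f: "\<And>n. f n \<in> H" and b: "bounded (range (\<lambda>n. L.nrm (f n)))"
  shows "\<exists>r g. strict_mono r \<and> g \<in> H \<and> L.conv (\<lambda>n. spectral_semigroup t (f (r n))) g"
proof -
  obtain B where B: "\<And>n. \<bar>L.nrm (f n)\<bar> \<le> B" using b by (auto simp: bounded_iff)
  have ff: "ip (f n) (f n) \<le> B\<^sup>2" for n
    using power_mono[OF B[of n] abs_ge_zero, of 2] f[of n] by (simp add: L.nrm_sq)
  show ?thesis
  proof (rule compact_embedding[where C = "max (B\<^sup>2) (B\<^sup>2 / t)"])
    fix n
    show "spectral_semigroup t (f n) \<in> F" by (rule spectral_semigroup_smoothing[OF f t])
    show "E (spectral_semigroup t (f n)) (spectral_semigroup t (f n)) \<le> max (B\<^sup>2) (B\<^sup>2 / t)"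
      using spectral_semigroup_smoothing(2)[OF f t, of n] divide_right_mono[OF ff[of n], of t] t by linarith
    show "ip (spectral_semigroup t (f n)) (spectral_semigroup t (f n)) \<le> max (B\<^sup>2) (B\<^sup>2 / t)"
      using spectral_semigroup_smoothing(3)[OF f t, of n] ff[of n] by linarith
  qed
qed

end

context compact_closed_form begin

theorem compact_semigroup:
  obtains P where "c0_semigroup H ip P" "c0_semigroup.generator H ip P = form_operator"
    "\<And>t (f :: nat \<Rightarrow> 'v). 0 < t \<Longrightarrow> (\<And>n. f n \<in> H) \<Longrightarrow> bounded (range (\<lambda>n. L.nrm (f n))) \<Longrightarrow>
      \<exists>r g. strict_mono r \<and> g \<in> H \<and> L.conv (\<lambda>n. P t (f (r n))) g"
proof -
  obtain e l where el: "\<And>n. e n \<in> F" "\<And>n. 0 \<le> l n" "\<And>i j. i \<noteq> j \<Longrightarrow> ip (e i) (e j) = 0"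
    "\<And>n v. v \<in> F \<Longrightarrow> E (e n) v = l n * ip (e n) v"
    "\<And>n. ip (e n) (e n) = 1 \<or> e n = 0" "filterlim l at_top sequentially"
    "\<And>n u. u \<in> F \<Longrightarrow> (\<And>i. i < n \<Longrightarrow> ip u (e i) = 0) \<Longrightarrow> l n * ip u u \<le> E u u"
    using eigenbasis_exists by metis
  interpret eigenbasis H ip F E e l
    by unfold_locales (use el in auto)
  show thesis
    using that[of spectral_semigroup] c0_spectral_semigroup generator_semigroup spectral_semigroup_compact by blast
qed

end

section \<open>Square-integrable functions\<close>

text \<open>With pointwise scaling, real functions form a real vector space, so the locales above
  apply to functions themselves without passing to equivalence classes.\<close>

instantiation "fun" :: (type, real_vector) real_vector
begin

definition "scaleR c f = (\<lambda>x. c *\<^sub>R f x)"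

instance
proof
  fix a b :: real and f g :: "'a \<Rightarrow> 'b"
  show "a *\<^sub>R (f + g) = a *\<^sub>R f + a *\<^sub>R g"
    by (rule ext) (simp add: scaleR_fun_def scaleR_add_right)
  show "(a + b) *\<^sub>R f = a *\<^sub>R f + b *\<^sub>R f"
    by (rule ext) (simp add: scaleR_fun_def scaleR_add_left)
  show "a *\<^sub>R b *\<^sub>R f = (a * b) *\<^sub>R f"
    by (rule ext) (simp add: scaleR_fun_def)
  show "1 *\<^sub>R f = f"
    by (rule ext) (simp add: scaleR_fun_def)
qed

end

lemma scaleR_fun_apply [simp]: "(c *\<^sub>R f) x = c *\<^sub>R f x"
  by (simp add: scaleR_fun_def)

lemma L2I: "f \<in> borel_measurable M \<Longrightarrow> integrable M (\<lambda>x. (f x)\<^sup>2) \<Longrightarrow> f \<in> L2 M"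
  by (simp add: L2_def)

lemma L2_measurable: "f \<in> L2 M \<Longrightarrow> f \<in> borel_measurable M"
  and L2_integrable_sq: "f \<in> L2 M \<Longrightarrow> integrable M (\<lambda>x. (f x)\<^sup>2)"
  by (auto simp: L2_def)

lemma L2_integrable_mult:
  assumes "f \<in> L2 M" "g \<in> L2 M"
  shows "integrable M (\<lambda>x. f x * g x)"
proof (rule Bochner_Integration.integrable_bound)
  show "integrable M (\<lambda>x. (f x)\<^sup>2 + (g x)\<^sup>2)" using assms by (auto intro: L2_integrable_sq)
  show "(\<lambda>x. f x * g x) \<in> borel_measurable M"
    using assms[THEN L2_measurable] by measurable
  have "\<bar>a * b\<bar> \<le> a\<^sup>2 + b\<^sup>2" for a b :: real
  proof -
    have "2 * (\<bar>a\<bar> * \<bar>b\<bar>) \<le> a\<^sup>2 + b\<^sup>2" using sum_squares_bound[of "\<bar>a\<bar>" "\<bar>b\<bar>"] by simp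
    moreover have "0 \<le> \<bar>a\<bar> * \<bar>b\<bar>" by simp
    ultimately show ?thesis unfolding abs_mult by linarith
  qed
  then show "AE x in M. norm (f x * g x) \<le> norm ((f x)\<^sup>2 + (g x)\<^sup>2)" by auto
qed

lemma subspace_L2: "subspace (L2 M)"
  unfolding subspace_def
proof (intro conjI ballI allI)
  show "0 \<in> L2 M" by (auto intro!: L2I simp: zero_fun_def)
next
  fix f g assume fg: "f \<in> L2 M" "g \<in> L2 M"
  have "integrable M (\<lambda>x. (f x)\<^sup>2 + 2 * (f x * g x) + (g x)\<^sup>2)"
    using L2_integrable_mult[OF fg] fg[THEN L2_integrable_sq] by simp
  moreover have "f + g \<in> borel_measurable M"
    unfolding plus_fun_def using fg[THEN L2_measurable] by measurable
  ultimately show "f + g \<in> L2 M" by (intro L2I) (simp_all add: power2_sum ac_simps)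
next
  fix c f assume f: "f \<in> L2 M"
  have "c *\<^sub>R f \<in> borel_measurable M"
    unfolding scaleR_fun_def using f[THEN L2_measurable] by measurable
  then show "c *\<^sub>R f \<in> L2 M" using L2_integrable_sq[OF f] by (intro L2I) (simp_all add: power_mult_distrib)
qed

lemma semi_inner_L2: "semi_inner (L2 M) (L2_inner M)"
proof
  fix f g h and c :: real assume fgh: "f \<in> L2 M" "g \<in> L2 M" "h \<in> L2 M"
  then show "L2_inner M (f + g) h = L2_inner M f h + L2_inner M g h"
    by (simp add: L2_inner_def distrib_right L2_integrable_mult)
  show "L2_inner M (c *\<^sub>R f) h = c * L2_inner M f h"
    by (simp add: L2_inner_def mult.assoc)
  show "L2_inner M f g = L2_inner M g f" by (simp add: L2_inner_def mult.commute)
  show "0 \<le> L2_inner M f f" by (simp add: L2_inner_def)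
qed (rule subspace_L2)

lemma nrm_L2: "semi_inner.nrm (L2_inner M) = L2_norm M"
  by (simp add: semi_inner.nrm_def[OF semi_inner_L2] L2_norm_def fun_eq_iff)

lemma L2_inner_self: "L2_inner M f f = (LINT x|M. (f x)\<^sup>2)"
  by (simp add: L2_inner_def power2_eq_square)

lemma L2_inner_self_nn:
  assumes "f \<in> L2 M"
  shows "ennreal (L2_inner M f f) = (\<integral>\<^sup>+x. ennreal ((f x)\<^sup>2) \<partial>M)"
  unfolding L2_inner_self using L2_integrable_sq[OF assms] by (simp add: nn_integral_eq_integral)

text \<open>Convergence in \<open>L2\<close> is \<open>L1\<close> convergence to zero of the squared
  differences.\<close>

lemma L2_AE_subseq:
  assumes f: "\<And>n. f n \<in> L2 M" and g: "g \<in> L2 M"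
    and lim: "semi_inner.conv (L2_inner M) f g"
  obtains r where "strict_mono r" "AE x in M. (\<lambda>n. f (r n) x) \<longlonglongrightarrow> g x"
proof -
  interpret semi_inner "L2 M" "L2_inner M" by (rule semi_inner_L2)
  have "(\<lambda>n. (nrm (f n - g))\<^sup>2) \<longlonglongrightarrow> 0\<^sup>2" 
    by (rule tendsto_power[OF lim[unfolded conv_def]])
  moreover have "(nrm (f n - g))\<^sup>2 = (LINT x|M. norm (((f n - g) x)\<^sup>2))" for n
    using f[of n] g by (simp add: nrm_sq L2_inner_self)
  ultimately have "(\<lambda>n. LINT x|M. norm (((f n - g) x)\<^sup>2)) \<longlonglongrightarrow> 0" by simp
  moreover have "integrable M (\<lambda>x. ((f n - g) x)\<^sup>2)" for n
    using f g by (intro L2_integrable_sq mem_diff)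
  ultimately obtain r where r: "strict_mono r" and ae: "AE x in M. (\<lambda>n. ((f (r n) - g) x)\<^sup>2) \<longlonglongrightarrow> 0"
    using tendsto_L1_AE_subseq[of M "\<lambda>n x. ((f n - g) x)\<^sup>2"] by blast
  show thesis
  proof (rule that[OF r], use ae in eventually_elim)
    case (elim x)
    then have "(\<lambda>n. sqrt (((f (r n) - g) x)\<^sup>2)) \<longlonglongrightarrow> sqrt 0" by (rule tendsto_real_sqrt)
    then have "(\<lambda>n. f (r n) x - g x) \<longlonglongrightarrow> 0" by (simp add: tendsto_rabs_zero_iff)
    then show ?case by (rule LIM_zero_cancel)
  qed
qed

lemma subseq_rapidly_Cauchy:
  assumes "semi_inner.Cau (L2_inner M) f" and f: "\<And>n. f n \<in> L2 M"
  obtains r where "strict_mono r" "\<And>k n. n \<ge> r k \<Longrightarrow> L2_norm M (f n - f (r k)) < (1/2) ^ k"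
proof -
  interpret semi_inner "L2 M" "L2_inner M" by (rule semi_inner_L2)
  have "\<exists>N. \<forall>m\<ge>N. \<forall>n\<ge>N. L2_norm M (f m - f n) < (1/2) ^ k" for k :: nat
    using assms(1) unfolding Cau_def nrm_L2 by simp
  then obtain N where N: "\<And>k m n. m \<ge> N k \<Longrightarrow> n \<ge> N k \<Longrightarrow> L2_norm M (f m - f n) < (1/2) ^ k" by metis
  define r where "r = rec_nat (N 0) (\<lambda>k p. max (Suc p) (N (Suc k)))"
  have r0: "r 0 = N 0" and rS: "r (Suc k) = max (Suc (r k)) (N (Suc k))" for k by (simp_all add: r_def)
  have "N k \<le> r k" for k by (cases k) (auto simp: r0 rS)
  then show thesis
    by (intro that[of r]) (auto simp: strict_mono_Suc_iff rS intro!: N intro: order_trans)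
qed

text \<open>Riesz-Fischer. A rapidly Cauchy subsequence converges almost everywhere; Fatou's lemma
  carries the bounds on distances within the sequence over to the pointwise limit.\<close>

lemma L2_complete:
  assumes f: "\<And>n. f n \<in> L2 M" and C: "semi_inner.Cau (L2_inner M) f"
  shows "\<exists>g\<in>L2 M. semi_inner.conv (L2_inner M) f g"
proof -
  interpret semi_inner "L2 M" "L2_inner M" by (rule semi_inner_L2)
  obtain r where r: "strict_mono r" and rap: "\<And>k n. n \<ge> r k \<Longrightarrow> L2_norm M (f n - f (r k)) < (1/2) ^ k"
    using subseq_rapidly_Cauchy[OF C f] by metis
  have [measurable]: "f n \<in> borel_measurable M" for n using f by (rule L2_measurable)
  define d where "d k x = f (r (Suc k)) x - f (r k) x" for k x
  have [measurable]: "d k \<in> borel_measurable M" for k unfolding d_def by measurable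
  have sqn: "(\<integral>\<^sup>+x. ennreal ((f n x - f (r k) x)\<^sup>2) \<partial>M) \<le> ennreal ((1/4) ^ k)" if "n \<ge> r k" for n k
  proof -
    have "(L2_norm M (f n - f (r k)))\<^sup>2 \<le> ((1/2) ^ k)\<^sup>2"
      using rap[OF that] nrm_nonneg[of "f n - f (r k)"] f
      by (intro power_mono) (auto simp: nrm_L2[symmetric])
    then have "L2_inner M (f n - f (r k)) (f n - f (r k)) \<le> (1/4) ^ k"
      using nrm_sq[of "f n - f (r k)"] f
      by (simp add: nrm_L2 power2_eq_square flip: power_mult_distrib)
    then have "ennreal (L2_inner M (f n - f (r k)) (f n - f (r k))) \<le> ennreal ((1/4) ^ k)"
      by (rule ennreal_leI)
    then show ?thesis using L2_inner_self_nn[of "f n - f (r k)" M] f by simp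
  qed
  \<comment> \<open>The integrals of \<open>(d k)\<^sup>2\<close> are at most
    \<open>(1/4) ^ k\<close>, so a weight \<open>2 ^ k\<close> can be afforded. Almost everywhere
    finiteness of the weighted sum then makes \<open>d k x\<close> decay like
    \<open>sqrt (1/2) ^ k\<close>, which is summable.\<close>
  have "(\<integral>\<^sup>+x. (\<Sum>k. ennreal (2 ^ k * (d k x)\<^sup>2)) \<partial>M) = (\<Sum>k. \<integral>\<^sup>+x. ennreal (2 ^ k * (d k x)\<^sup>2) \<partial>M)"
    by (rule nn_integral_suminf) measurable
  also have "\<dots> \<le> (\<Sum>k. ennreal ((1/2) ^ k))"
  proof (intro suminf_le summableI)
    fix k
    have "(\<integral>\<^sup>+x. ennreal (2 ^ k * (d k x)\<^sup>2) \<partial>M) = ennreal (2 ^ k) * (\<integral>\<^sup>+x. ennreal ((d k x)\<^sup>2) \<partial>M)"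
      by (simp add: ennreal_mult nn_integral_cmult)
    also have "\<dots> \<le> ennreal (2 ^ k) * ennreal ((1/4) ^ k)"
      unfolding d_def using r by (intro mult_left_mono sqn) (auto simp: strict_mono_less_eq)
    also have "\<dots> = ennreal ((1/2) ^ k)"
      by (simp flip: ennreal_mult power_mult_distrib)
    finally show "(\<integral>\<^sup>+x. ennreal (2 ^ k * (d k x)\<^sup>2) \<partial>M) \<le> ennreal ((1/2) ^ k)" .
  qed
  also have "\<dots> = ennreal (\<Sum>k. (1/2) ^ k)" by (intro suminf_ennreal2) auto
  finally have fin: "(\<integral>\<^sup>+x. (\<Sum>k. ennreal (2 ^ k * (d k x)\<^sup>2)) \<partial>M) \<noteq> \<infinity>"
    by (metis ennreal_neq_top infinity_ennreal_def neq_top_trans)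
  have "AE x in M. (\<Sum>k. ennreal (2 ^ k * (d k x)\<^sup>2)) \<noteq> \<infinity>"
    by (rule nn_integral_PInf_AE[OF _ fin]) measurable
  then have conv_ae: "AE x in M. convergent (\<lambda>k. f (r k) x)"
  proof eventually_elim
    case (elim x)
    have s: "summable (\<lambda>k. 2 ^ k * (d k x)\<^sup>2)"
      by (rule summable_suminf_not_top) (use elim in auto)
    define B where "B = (\<Sum>k. 2 ^ k * (d k x)\<^sup>2)"
    have nd: "norm (d k x) \<le> sqrt B * (sqrt (1/2)) ^ k" for k
    proof -
      have "2 ^ k * (d k x)\<^sup>2 \<le> B"
        using sum_le_suminf[OF s, of "{k}"] by (simp add: B_def)
      then have "(d k x)\<^sup>2 \<le> B * (1/2) ^ k" by (simp add: field_simps power_divide)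
      then have "sqrt ((d k x)\<^sup>2) \<le> sqrt (B * (1/2) ^ k)" by (rule real_sqrt_le_mono)
      moreover have "sqrt (B * (1/2) ^ k) = sqrt B * sqrt (1/2) ^ k"
        by (simp only: real_sqrt_mult real_sqrt_power)
      ultimately show ?thesis by simp
    qed
    have "summable (\<lambda>k. sqrt B * (sqrt (1/2)) ^ k)"
      by (intro summable_mult summable_geometric) simp
    then have "summable (\<lambda>k. d k x)" using nd by (rule summable_comparison_test'[where N = 0])
    then have "convergent (\<lambda>n. \<Sum>k<n. d k x)" by (rule summable_iff_convergent[THEN iffD1])
    moreover have "(\<Sum>k<n. d k x) = f (r n) x - f (r 0) x" for n
      unfolding d_def by (rule sum_lessThan_telescope)
    ultimately have "convergent (\<lambda>n. f (r n) x - f (r 0) x)" by simp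
    from convergent_add[OF this convergent_const, of "f (r 0) x"]
    show ?case by simp
  qed
  define g where "g x = lim (\<lambda>k. f (r k) x)" for x
  have [measurable]: "g \<in> borel_measurable M" unfolding g_def by measurable
  have lim: "AE x in M. (\<lambda>k. f (r k) x) \<longlonglongrightarrow> g x"
    using conv_ae by eventually_elim (simp add: g_def convergent_LIMSEQ_iff)
  \<comment> \<open>Fatou in the second index. The constant is the square of
    \<open>2 * (1/2) ^ k\<close>, the triangle bound through \<open>f (r k)\<close>.\<close>
  have tail: "(\<integral>\<^sup>+x. ennreal ((f n x - g x)\<^sup>2) \<partial>M) \<le> ennreal (4 * (1/4) ^ k)" if n: "n \<ge> r k" for n k
  proof -
    have "(\<integral>\<^sup>+x. ennreal ((f n x - g x)\<^sup>2) \<partial>M) = (\<integral>\<^sup>+x. liminf (\<lambda>j. ennreal ((f n x - f (r j) x)\<^sup>2)) \<partial>M)"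
    proof (rule nn_integral_cong_AE, use lim in eventually_elim)
      case (elim x)
      then have "(\<lambda>j. ennreal ((f n x - f (r j) x)\<^sup>2)) \<longlonglongrightarrow> ennreal ((f n x - g x)\<^sup>2)"
        by (intro tendsto_ennrealI tendsto_power tendsto_diff tendsto_const)
      from lim_imp_Liminf[OF _ this] show ?case by simp
    qed
    also have "\<dots> \<le> liminf (\<lambda>j. \<integral>\<^sup>+x. ennreal ((f n x - f (r j) x)\<^sup>2) \<partial>M)"
      by (rule nn_integral_liminf) measurable
    also have "\<dots> \<le> ennreal (4 * (1/4) ^ k)"
    proof (rule Liminf_le)
      show "\<forall>\<^sub>F j in sequentially. (\<integral>\<^sup>+x. ennreal ((f n x - f (r j) x)\<^sup>2) \<partial>M) \<le> ennreal (4 * (1/4) ^ k)"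
        using eventually_ge_at_top[of k]
      proof eventually_elim
        case (elim j)
        have "L2_norm M (f n - f (r j)) \<le> L2_norm M (f n - f (r k)) + L2_norm M (f (r k) - f (r j))"
          using nrm_triangle2[of "f n" "f (r k)" "f (r j)"] f by (simp add: nrm_L2)
        also have "\<dots> \<le> 2 * (1/2) ^ k"
          using rap[OF n] rap[of k "r j"] elim r nrm_diff_commute[of "f (r k)" "f (r j)"] f
          by (simp add: nrm_L2 strict_mono_less_eq)
        finally have "(L2_norm M (f n - f (r j)))\<^sup>2 \<le> (2 * (1/2) ^ k)\<^sup>2"
          using nrm_nonneg[of "f n - f (r j)"] f by (intro power_mono) (auto simp: nrm_L2[symmetric])
        also have "\<dots> = 4 * (1/4) ^ k"
          by (simp add: power2_eq_square flip: power_mult_distrib)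
        finally have "L2_inner M (f n - f (r j)) (f n - f (r j)) \<le> 4 * (1/4) ^ k"
          using nrm_sq[of "f n - f (r j)"] f by (simp add: nrm_L2)
        then have "ennreal (L2_inner M (f n - f (r j)) (f n - f (r j))) \<le> ennreal (4 * (1/4) ^ k)"
          by (rule ennreal_leI)
        then show ?case using L2_inner_self_nn[of "f n - f (r j)" M] f by simp
      qed
    qed auto
    finally show ?thesis .
  qed
  have diff: "f n - g \<in> L2 M" if n: "n \<ge> r 0" for n
  proof (rule L2I)
    show "f n - g \<in> borel_measurable M" unfolding fun_diff_def by measurable
    have "(\<integral>\<^sup>+x. ennreal ((f n x - g x)\<^sup>2) \<partial>M) < \<infinity>"
      using tail[OF n] by (simp add: le_less_trans)
    then show "integrable M (\<lambda>x. ((f n - g) x)\<^sup>2)" by (intro integrableI_nonneg) auto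
  qed
  have "f (r 0) - (f (r 0) - g) \<in> L2 M" by (intro mem_diff diff f order_refl)
  moreover have "f (r 0) - (f (r 0) - g) = g" by (simp add: fun_eq_iff)
  ultimately have g: "g \<in> L2 M" by metis
  have fg: "f n - g \<in> L2 M" for n by (rule mem_diff[OF f g])
  have "conv f g"
    unfolding conv_def nrm_L2
  proof (rule LIMSEQ_I)
    fix e :: real assume e: "e > 0"
    obtain k where k: "(1/2) ^ k < e / 2" using real_arch_pow_inv[of "e/2" "1/2"] e by auto
    have "L2_norm M (f n - g) < e" if "n \<ge> r k" for n
    proof (rule power2_less_imp_less)
      have "ennreal (L2_inner M (f n - g) (f n - g)) \<le> ennreal (4 * (1/4) ^ k)"
        using tail[OF that] L2_inner_self_nn[OF fg] by simp
      then have "(L2_norm M (f n - g))\<^sup>2 \<le> 4 * (1/4) ^ k"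
        using nrm_sq[OF fg] by (simp add: nrm_L2)
      also have "\<dots> = (2 * (1/2) ^ k)\<^sup>2" by (simp add: power2_eq_square flip: power_mult_distrib)
      also have "\<dots> < e\<^sup>2" using k by (intro power_strict_mono) auto
      finally show "(L2_norm M (f n - g))\<^sup>2 < e\<^sup>2" .
    qed (use e in simp)
    moreover have "0 \<le> L2_norm M (f n - g)" for n
      using nrm_nonneg[OF fg] by (simp add: nrm_L2)
    ultimately show "\<exists>no. \<forall>n\<ge>no. norm (L2_norm M (f n - g) - 0) < e" by auto
  qed
  then show ?thesis using g by blast
qed

interpretation L2: semi_hilbert "L2 M" "L2_inner M" for M
  by (intro semi_hilbert.intro semi_inner_L2 semi_hilbert_axioms.intro L2_complete)

section \<open>Transfer between the definitions for functions and the abstract locales\<close>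

lemma L2_norm_diff_eq_0_iff:
  assumes "f \<in> L2 M" "g \<in> L2 M"
  shows "L2_norm M (f - g) = 0 \<longleftrightarrow> (AE x in M. f x = g x)"
proof -
  have "L2_norm M (f - g) = 0 \<longleftrightarrow> (LINT x|M. ((f - g) x)\<^sup>2) = 0"
    by (simp add: L2_norm_def L2_inner_self)
  also have "\<dots> \<longleftrightarrow> (AE x in M. ((f - g) x)\<^sup>2 = 0)"
    using assms by (intro integral_nonneg_eq_0_iff_AE L2_integrable_sq L2.mem_diff) simp_all
  finally show ?thesis by simp
qed

text \<open>Equality almost everywhere is vanishing of the seminorm of the difference, which matches
  the two lists of axioms clause by clause.\<close>

lemma L2_C0_semigroup_iff: "L2_C0_semigroup M P \<longleftrightarrow> c0_semigroup (L2 M) (L2_inner M) P"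
proof
  assume P: "L2_C0_semigroup M P"
  have B: "L2_bounded_operator M (P t)" if "0 \<le> t" for t using P that by (simp add: L2_C0_semigroup_def)
  have mem: "P t f \<in> L2 M" if "0 \<le> t" "f \<in> L2 M" for t f
    using B[OF that(1)] that(2) by (auto simp: L2_bounded_operator_def)
  show "c0_semigroup (L2 M) (L2_inner M) P"
  proof
    fix t f assume t: "(0::real) \<le> t" and f: "f \<in> L2 M"
    show "P t f \<in> L2 M" by (rule mem[OF t f])
    show "L2.nrm M (P t (f + g) - (P t f + P t g)) = 0" if g: "g \<in> L2 M" for g
    proof -
      have "AE x in M. P t (f + g) x = (P t f + P t g) x"
        using f g B[OF t] by (simp add: L2_bounded_operator_def plus_fun_def)
      then show ?thesis
        unfolding nrm_L2 using mem[OF t] f g by (subst L2_norm_diff_eq_0_iff) (simp_all del: plus_fun_apply)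
    qed
    show "L2.nrm M (P t (c *\<^sub>R f) - c *\<^sub>R P t f) = 0" for c
    proof -
      have "AE x in M. P t (c *\<^sub>R f) x = (c *\<^sub>R P t f) x"
        using f B[OF t] by (simp add: L2_bounded_operator_def scaleR_fun_def)
      then show ?thesis
        unfolding nrm_L2 using mem[OF t] f by (subst L2_norm_diff_eq_0_iff) (simp_all del: scaleR_fun_apply)
    qed
    show "L2.nrm M (P (s + t) f - P s (P t f)) = 0" if s: "0 \<le> s" for s
      unfolding nrm_L2 using mem t s f P
      by (subst L2_norm_diff_eq_0_iff) (auto simp: L2_C0_semigroup_def)
  next
    fix t :: real assume t: "0 \<le> t"
    show "\<exists>K. \<forall>f\<in>L2 M. L2.nrm M (P t f) \<le> K * L2.nrm M f"
      unfolding nrm_L2 using B[OF t] by (auto simp: L2_bounded_operator_def)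
  next
    fix f assume f: "f \<in> L2 M"
    show "L2.nrm M (P 0 f - f) = 0"
      unfolding nrm_L2 using mem f P
      by (subst L2_norm_diff_eq_0_iff) (auto simp: L2_C0_semigroup_def)
    show "((\<lambda>t. L2.nrm M (P t f - f)) \<longlongrightarrow> 0) (at_right 0)"
      unfolding nrm_L2 using f P by (auto simp: L2_C0_semigroup_def fun_diff_def)
  qed
next
  assume "c0_semigroup (L2 M) (L2_inner M) P"
  then interpret P: c0_semigroup "L2 M" "L2_inner M" P .
  have B: "L2_bounded_operator M (P t)" if t: "0 \<le> t" for t
    unfolding L2_bounded_operator_def
  proof (intro conjI ballI allI)
    fix f g c assume f: "f \<in> L2 M" and g: "g \<in> L2 M"
    show "P t f \<in> L2 M" using t f by (rule P.P_mem)
    show "AE x in M. P t (\<lambda>y. f y + g y) x = P t f x + P t g x"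
    proof -
      have "AE x in M. P t (f + g) x = (P t f + P t g) x"
        using P.P_add[OF t f g] t f g by (simp add: nrm_L2 L2_norm_diff_eq_0_iff P.P_mem)
      then show ?thesis unfolding plus_fun_def .
    qed
    show "AE x in M. P t (\<lambda>y. c * f y) x = c * P t f x"
    proof -
      have "AE x in M. P t (c *\<^sub>R f) x = (c *\<^sub>R P t f) x"
        using P.P_scale[OF t f, of c] t f by (simp add: nrm_L2 L2_norm_diff_eq_0_iff P.P_mem)
      then show ?thesis unfolding scaleR_fun_def real_scaleR_def .
    qed
  next
    show "\<exists>K. \<forall>f\<in>L2 M. L2_norm M (P t f) \<le> K * L2_norm M f"
      using P.P_bdd[OF t] by (simp add: nrm_L2)
  qed
  show "L2_C0_semigroup M P"
    unfolding L2_C0_semigroup_def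
  proof (intro conjI ballI allI impI B)
    fix f assume f: "f \<in> L2 M"
    show "AE x in M. P 0 f x = f x"
      using P.P_zero[OF f] f by (simp add: nrm_L2 L2_norm_diff_eq_0_iff P.P_mem)
    show "((\<lambda>t. L2_norm M (\<lambda>x. P t f x - f x)) \<longlongrightarrow> 0) (at_right 0)"
      using P.P_cont[OF f] by (simp add: nrm_L2 fun_diff_def)
    fix s t :: real assume st: "0 \<le> s" "0 \<le> t"
    show "AE x in M. P (s + t) f x = P s (P t f) x"
      using P.P_semigroup[OF st f] f st by (simp add: nrm_L2 L2_norm_diff_eq_0_iff P.P_mem)
  qed
qed

lemma semigroup_generator_eq:
  assumes "L2_C0_semigroup M P"
  shows "semigroup_generator M P = c0_semigroup.generator (L2 M) (L2_inner M) P"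
proof -
  interpret P: c0_semigroup "L2 M" "L2_inner M" P using assms by (simp add: L2_C0_semigroup_iff)
  have "(1 / t) *\<^sub>R (P t f - f) - g = (\<lambda>x. (P t f x - f x) / t - g x)" for t f g
    by (simp add: fun_eq_iff)
  then show ?thesis by (simp add: semigroup_generator_def P.generator_def nrm_L2)
qed

lemma form_generator_eq:
  assumes "closed_form (L2 M) (L2_inner M) F E"
  shows "form_generator M E F = closed_form.form_operator (L2 M) (L2_inner M) F E"
proof -
  interpret closed_form "L2 M" "L2_inner M" F E by fact
  show ?thesis by (simp add: form_generator_def form_operator_def L2_inner_def)
qed

lemma compact_operator_iff:
  assumes P: "L2_C0_semigroup M P" and t: "0 \<le> t"
  shows "L2_compact_operator M (P t) \<longleftrightarrow>
    (\<forall>f :: nat \<Rightarrow> _. (\<forall>n. f n \<in> L2 M) \<longrightarrow> bounded (range (\<lambda>n. L2.nrm M (f n))) \<longrightarrow>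
      (\<exists>r g. strict_mono r \<and> g \<in> L2 M \<and> L2.conv M (\<lambda>n. P t (f (r n))) g))"
  using P t unfolding L2_compact_operator_def L2.conv_def nrm_L2 fun_diff_def L2_C0_semigroup_def by simp

lemma L2_AE_cong:
  assumes h: "h \<in> L2 M" and f: "f \<in> borel_measurable M" and eq: "AE x in M. f x = h x"
  shows "f \<in> L2 M" "L2.nrm M (h - f) = 0"
proof -
  have "integrable M (\<lambda>x. (f x)\<^sup>2)"
  proof (rule integrable_cong_AE_imp[OF L2_integrable_sq[OF h]])
    show "(\<lambda>x. (f x)\<^sup>2) \<in> borel_measurable M" using f by measurable
    show "AE x in M. (h x)\<^sup>2 = (f x)\<^sup>2" using eq by eventually_elim simp
  qed
  then show fL: "f \<in> L2 M" using f by (intro L2I)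
  show "L2.nrm M (h - f) = 0"
    unfolding nrm_L2 by (subst L2_norm_diff_eq_0_iff) (use h fL eq in auto)
qed

lemma L2_conv_cong:
  assumes u: "\<And>n. u n \<in> L2 M" and h: "h \<in> L2 M" and f: "f \<in> L2 M"
    and eq: "L2.nrm M (h - f) = 0" and c: "L2.conv M u h"
  shows "L2.conv M u f"
  unfolding L2.conv_def
proof (rule Lim_null_comparison)
  show "\<forall>\<^sub>F n in sequentially. norm (L2.nrm M (u n - f)) \<le> L2.nrm M (u n - h)"
  proof (intro always_eventually allI)
    fix n
    show "norm (L2.nrm M (u n - f)) \<le> L2.nrm M (u n - h)"
      using L2.nrm_triangle2[OF u h f, of n] eq L2.nrm_nonneg[OF L2.mem_diff[OF u f], of n] by simp
  qed
  show "(\<lambda>n. L2.nrm M (u n - h)) \<longlonglongrightarrow> 0" using c by (simp add: L2.conv_def)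
qed

text \<open>Completeness provides some limit in \<open>L2\<close>, and an almost everywhere
  convergent subsequence identifies it with the pointwise limit \<open>f\<close>.\<close>

lemma L2_AE_limit:
  assumes u: "\<And>n. u n \<in> L2 M" and C: "L2.Cau M u"
    and f: "f \<in> borel_measurable M" and ae: "AE x in M. (\<lambda>n. u n x) \<longlonglongrightarrow> f x"
  shows "f \<in> L2 M" "L2.conv M u f"
proof -
  obtain h where h: "h \<in> L2 M" and ch: "L2.conv M u h" using L2.complete[OF u C] by blast
  obtain r where r: "strict_mono r" and rh: "AE x in M. (\<lambda>n. u (r n) x) \<longlonglongrightarrow> h x"
    using L2_AE_subseq[OF u h ch] by blast
  have "AE x in M. f x = h x"
    using ae rh
  proof eventually_elim
    case (elim x)
    then show ?case using LIMSEQ_subseq_LIMSEQ[OF elim(1) r] LIMSEQ_unique by (auto simp: o_def)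
  qed
  from L2_AE_cong[OF h f this] show "f \<in> L2 M" "L2.conv M u f"
    using L2_conv_cong[OF u h _ _ ch] by auto
qed

section \<open>Weighted measures\<close>

lemma sets_weighted_measure [simp, measurable_cong]: "sets (weighted_measure \<beta>) = sets borel"
  by (simp add: weighted_measure_def)

lemma space_weighted_measure [simp]: "space (weighted_measure \<beta>) = UNIV"
  by (simp add: weighted_measure_def)

text \<open>The density is strictly positive, so the null sets are those of Lebesgue measure for
  every \<beta>. This allows limits for different weights to be compared pointwise.\<close>

lemma AE_weighted_measure: "(AE x in weighted_measure \<beta>. Q x) \<longleftrightarrow> (AE x in lborel. Q x)"
proof -
  have "0 < (1 + norm x) powr - \<beta>" for x :: 'a
    using norm_ge_zero[of x] by (simp add: add_nonneg_eq_0_iff)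
  then show ?thesis unfolding weighted_measure_def by (subst AE_density) auto
qed

lemma nn_integral_weighted_measure:
  assumes "f \<in> borel_measurable borel"
  shows "(\<integral>\<^sup>+x. f x \<partial>weighted_measure \<beta>) = (\<integral>\<^sup>+x. ennreal ((1 + norm x) powr - \<beta>) * f x \<partial>lborel)"
  unfolding weighted_measure_def using assms by (intro nn_integral_density) auto

lemma L2_if_nn_integral_finite:
  assumes f: "f \<in> borel_measurable M" and B: "(\<integral>\<^sup>+x. ennreal ((f x)\<^sup>2) \<partial>M) \<le> ennreal B" "0 \<le> B"
  shows "f \<in> L2 M" "L2_inner M f f \<le> B"
proof -
  have "integrable M (\<lambda>x. (f x)\<^sup>2)"
    using B le_less_trans[OF B(1) ennreal_less_top] by (intro integrableI_nonneg borel_measurable_power f) auto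
  then show fL: "f \<in> L2 M" using f by (intro L2I)
  have "ennreal (L2_inner M f f) \<le> ennreal B" using B(1) by (simp add: L2_inner_self_nn[OF fL])
  then show "L2_inner M f f \<le> B" using B(2) by simp
qed

section \<open>Increments of functions\<close>

text \<open>Giving each factor the square root of the jump density turns convergence in energy into
  convergence in \<open>L2\<close> of the product measure. On the diagonal the value is 0.\<close>

definition jump :: "real \<Rightarrow> ('a::euclidean_space \<Rightarrow> real) \<Rightarrow> 'a \<times> 'a \<Rightarrow> real" where
  "jump \<alpha> f = (\<lambda>(x, y). (f x - f y) *
     sqrt (stable_const DIM('a) \<alpha> / norm (x - y) powr (real DIM('a) + \<alpha>)))"

lemma jump_add: "jump \<alpha> (f + g) = jump \<alpha> f + jump \<alpha> g"
  and jump_scale: "jump \<alpha> (c *\<^sub>R f) = c *\<^sub>R jump \<alpha> f"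
  and jump_diff: "jump \<alpha> (f - g) = jump \<alpha> f - jump \<alpha> g"
  by (auto simp: jump_def fun_eq_iff algebra_simps)

lemma measurable_jump:
  fixes f :: "'a::euclidean_space \<Rightarrow> real"
  assumes [measurable]: "f \<in> borel_measurable lborel"
  shows "jump \<alpha> f \<in> borel_measurable (lborel \<Otimes>\<^sub>M lborel)"
  unfolding jump_def by measurable

lemma AE_lborel_pairI:
  fixes Q :: "'a::euclidean_space \<Rightarrow> bool"
  assumes "AE x in lborel. Q x"
  shows "AE z in lborel \<Otimes>\<^sub>M lborel. Q (fst z) \<and> Q (snd z)"
proof -
  obtain N where N: "{x \<in> space lborel. \<not> Q x} \<subseteq> N" "emeasure lborel N = 0" "N \<in> sets lborel"
    using assms by (rule AE_E)
  have "N \<times> UNIV \<in> null_sets (lborel \<Otimes>\<^sub>M lborel)" "UNIV \<times> N \<in> null_sets (lborel \<Otimes>\<^sub>M lborel)"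
    using N by (auto simp: null_sets_def lborel.emeasure_pair_measure_Times intro!: pair_measureI)
  then have "N \<times> UNIV \<union> UNIV \<times> N \<in> null_sets (lborel \<Otimes>\<^sub>M lborel)" by (rule null_sets.Un)
  then show ?thesis by (rule AE_I') (use N in auto)
qed

text \<open>Square integrability of \<open>f\<close> itself is deliberately absent, since functions
  of the extended Dirichlet space may lack it.\<close>

definition finite_energy :: "real \<Rightarrow> ('a::euclidean_space \<Rightarrow> real) set" where
  "finite_energy \<alpha> = {f \<in> borel_measurable lborel. jump \<alpha> f \<in> L2 (lborel \<Otimes>\<^sub>M lborel)}"

lemma finite_energyD:
  "f \<in> finite_energy \<alpha> \<Longrightarrow> f \<in> borel_measurable lborel"
  "f \<in> finite_energy \<alpha> \<Longrightarrow> jump \<alpha> f \<in> L2 (lborel \<Otimes>\<^sub>M lborel)"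
  by (auto simp: finite_energy_def)

lemma subspace_finite_energy: "subspace (finite_energy \<alpha>)"
  unfolding subspace_def finite_energy_def
proof (intro conjI ballI allI; clarify)
  have "jump \<alpha> 0 = (0 :: 'a \<times> 'a \<Rightarrow> real)" by (auto simp: jump_def fun_eq_iff)
  then show "(0 :: 'a \<Rightarrow> real) \<in> borel_measurable lborel \<and> jump \<alpha> (0 :: 'a \<Rightarrow> real) \<in> L2 (lborel \<Otimes>\<^sub>M lborel)"
    by (simp add: borel_measurable_const[of "0::real", folded zero_fun_def])
next
  fix f g :: "'a \<Rightarrow> real"
  assume [measurable]: "f \<in> borel_measurable lborel" "g \<in> borel_measurable lborel"
    and "jump \<alpha> f \<in> L2 (lborel \<Otimes>\<^sub>M lborel)" "jump \<alpha> g \<in> L2 (lborel \<Otimes>\<^sub>M lborel)"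
  then show "f + g \<in> borel_measurable lborel \<and> jump \<alpha> (f + g) \<in> L2 (lborel \<Otimes>\<^sub>M lborel)"
    by (simp add: jump_add L2.mem_add) (simp add: plus_fun_def)
next
  fix c and f :: "'a \<Rightarrow> real"
  assume [measurable]: "f \<in> borel_measurable lborel" and "jump \<alpha> f \<in> L2 (lborel \<Otimes>\<^sub>M lborel)"
  then show "c *\<^sub>R f \<in> borel_measurable lborel \<and> jump \<alpha> (c *\<^sub>R f) \<in> L2 (lborel \<Otimes>\<^sub>M lborel)"
    by (simp add: jump_scale L2.mem_scale) (simp add: scaleR_fun_def)
qed

section \<open>A recursion along dyadic shells\<close>

text \<open>Summing the recursion up to \<open>n\<close> and absorbing \<open>q * sum b\<close> on
  the left leaves the boundary term \<open>q * b n\<close>. As the recursion bounds each term by the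
  next one, only the assumed limit excludes solutions growing like
  \<open>(1 / q) ^ k\<close>.\<close>

lemma geometric_recursion_bound:
  fixes b e :: "nat \<Rightarrow> real"
  assumes b: "\<And>k. 0 \<le> b k" and q: "0 \<le> q" "q < 1" and B: "0 \<le> B"
    and step: "\<And>k. b k \<le> q * b (Suc k) + B * e k"
    and T: "\<And>K. (\<Sum>k<K. e k) \<le> T" and lim: "b \<longlonglongrightarrow> 0"
  shows "(\<Sum>k<K. b k) \<le> B * T / (1 - q)"
proof -
  have main: "(1 - q) * (\<Sum>k<n. b k) \<le> q * b n + B * T" for n
  proof -
    have "(\<Sum>k<n. b k) \<le> (\<Sum>k<n. q * b (Suc k) + B * e k)" by (intro sum_mono step)
    also have "\<dots> = q * (\<Sum>k<n. b (Suc k)) + B * (\<Sum>k<n. e k)"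
      by (simp add: sum.distrib sum_distrib_left)
    also have "(\<Sum>k<n. b (Suc k)) = (\<Sum>k<n. b k) + b n - b 0"
      by (induction n) auto
    also have "q * ((\<Sum>k<n. b k) + b n - b 0) + B * (\<Sum>k<n. e k) \<le> q * ((\<Sum>k<n. b k) + b n) + B * T"
      using b[of 0] q B T[of n] by (intro add_mono mult_left_mono) auto
    finally show ?thesis by (simp add: algebra_simps)
  qed
  have "(1 - q) * (\<Sum>k<K. b k) \<le> q * b n + B * T" if "n \<ge> K" for n
  proof -
    have "(\<Sum>k<K. b k) \<le> (\<Sum>k<n. b k)" using that b by (intro sum_mono2) auto
    then have "(1 - q) * (\<Sum>k<K. b k) \<le> (1 - q) * (\<Sum>k<n. b k)" using q by (intro mult_left_mono) auto
    then show ?thesis using main[of n] by linarith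
  qed
  moreover have "(\<lambda>n. q * b n + B * T) \<longlonglongrightarrow> q * 0 + B * T" by (intro tendsto_intros lim)
  ultimately have "(1 - q) * (\<Sum>k<K. b k) \<le> q * 0 + B * T" by (intro LIMSEQ_le_const) auto
  then show ?thesis using q by (simp add: field_simps)
qed

lemma dyadic_bracket:
  fixes t :: real
  assumes "1 \<le> t"
  obtains k :: nat where "2 ^ k \<le> t" "t < 2 ^ Suc k"
proof -
  define n where "n = (LEAST n. t < 2 ^ n)"
  have ex: "\<exists>n. t < 2 ^ n" using real_arch_pow[of 2 t] by auto
  then have n: "t < 2 ^ n" unfolding n_def by (rule LeastI_ex)
  then obtain k where k: "n = Suc k" using assms by (cases n) auto
  have "\<not> t < 2 ^ k" using not_less_Least[of k "\<lambda>n. t < 2 ^ n"] k by (simp add: n_def)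
  then show thesis using that[of k] n k by simp
qed

definition shell :: "nat \<Rightarrow> 'a::euclidean_space set" where
  "shell k = (case k of 0 \<Rightarrow> ball 0 1 | Suc j \<Rightarrow> ball 0 (2 ^ Suc j) - ball 0 (2 ^ j))"

lemma shell_0: "shell 0 = ball 0 1" and shell_Suc: "shell (Suc j) = ball 0 (2 ^ Suc j) - ball 0 (2 ^ j)"
  by (simp_all add: shell_def)

lemma shell_borel [measurable]: "shell k \<in> sets borel"
  by (cases k) (auto simp: shell_0 shell_Suc)

lemma norm_shell: "x \<in> shell k \<Longrightarrow> norm x < 2 ^ k"
  by (cases k) (auto simp: shell_0 shell_Suc)

lemma norm_shell_Suc: "x \<in> shell (Suc j) \<Longrightarrow> 2 ^ j \<le> norm x"
  by (auto simp: shell_Suc)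

lemma shell_disjoint: "j \<noteq> k \<Longrightarrow> shell j \<inter> shell k = {}"
proof -
  have *: "shell j \<inter> shell k = {}" if "j < k" for j k
  proof -
    define i where "i = k - 1"
    have k: "k = Suc i" "j \<le> i" using that by (auto simp: i_def)
    have "(2::real) ^ j \<le> 2 ^ i" using k by (intro power_increasing) auto
    then have "x \<notin> shell k" if "x \<in> shell j" for x
      unfolding k(1) using norm_shell[OF that] norm_shell_Suc[of x i] by linarith
    then show ?thesis by blast
  qed
  show "j \<noteq> k \<Longrightarrow> shell j \<inter> shell k = {}" using *[of j k] *[of k j] by (cases "j < k") auto
qed

lemma shell_cover: "\<exists>k. x \<in> shell k"
proof (cases "norm x < 1")
  case True
  then show ?thesis by (intro exI[of _ 0]) (simp add: shell_0)
next
  case False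
  then have "1 \<le> norm x" by simp
  then obtain k :: nat where "2 ^ k \<le> norm x" "norm x < 2 ^ Suc k" by (rule dyadic_bracket)
  then show ?thesis by (intro exI[of _ "Suc k"]) (auto simp: shell_Suc)
qed

lemma measure_ball: "0 \<le> r \<Longrightarrow> measure lborel (ball (0::'a::euclidean_space) r) =
    unit_ball_vol (real DIM('a)) * r ^ DIM('a)"
  by (rule content_ball)

lemma shell_finite: "emeasure lborel (shell k :: 'a::euclidean_space set) < \<infinity>"
proof (rule le_less_trans[OF emeasure_mono])
  show "shell k \<subseteq> ball (0::'a) (2 ^ k)" using norm_shell by auto
qed (use emeasure_lborel_ball_finite[of "0::'a" "2 ^ k"] in auto)

lemma measure_shell_0: "measure lborel (shell 0 :: 'a::euclidean_space set) = unit_ball_vol (real DIM('a))"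
  by (simp add: shell_0 measure_ball)

lemma measure_shell_Suc: "measure lborel (shell (Suc j) :: 'a::euclidean_space set) =
    unit_ball_vol (real DIM('a)) * (2 ^ DIM('a) - 1) * (2 ^ DIM('a)) ^ j"
proof -
  have "measure lborel (shell (Suc j) :: 'a set) =
      measure lborel (ball (0::'a) (2 ^ Suc j)) - measure lborel (ball (0::'a) (2 ^ j))"
    unfolding shell_Suc using emeasure_lborel_ball_finite[of "0::'a" "2 ^ Suc j"]
    by (intro measure_Diff) (auto intro!: subset_ball)
  then show ?thesis
    by (simp add: measure_ball algebra_simps power_mult_distrib power_commutes flip: power_mult)
qed

lemma nn_integral_fst_Times:
  fixes g :: "'a::euclidean_space \<Rightarrow> ennreal"
  assumes [measurable]: "g \<in> borel_measurable lborel" "P \<in> sets borel" "Q \<in> sets borel"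
  shows "(\<integral>\<^sup>+z\<in>P \<times> Q. g (fst z) \<partial>(lborel \<Otimes>\<^sub>M lborel)) = (\<integral>\<^sup>+x\<in>P. g x \<partial>lborel) * emeasure lborel Q"
    and "(\<integral>\<^sup>+z\<in>P \<times> Q. g (snd z) \<partial>(lborel \<Otimes>\<^sub>M lborel)) = emeasure lborel P * (\<integral>\<^sup>+x\<in>Q. g x \<partial>lborel)"
proof -
  have "(\<integral>\<^sup>+z\<in>P \<times> Q. g (fst z) \<partial>(lborel \<Otimes>\<^sub>M lborel)) =
      (\<integral>\<^sup>+x. \<integral>\<^sup>+y. g x * indicator P x * indicator Q y \<partial>lborel \<partial>lborel)"
    by (subst lborel.nn_integral_fst[symmetric]) (auto simp: indicator_times mult.assoc)
  also have "\<dots> = (\<integral>\<^sup>+x. (g x * indicator P x) * emeasure lborel Q \<partial>lborel)"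
    by (intro nn_integral_cong) (simp add: nn_integral_cmult)
  finally show "(\<integral>\<^sup>+z\<in>P \<times> Q. g (fst z) \<partial>(lborel \<Otimes>\<^sub>M lborel)) = (\<integral>\<^sup>+x\<in>P. g x \<partial>lborel) * emeasure lborel Q"
    by (simp add: nn_integral_multc)
  have "(\<integral>\<^sup>+z\<in>P \<times> Q. g (snd z) \<partial>(lborel \<Otimes>\<^sub>M lborel)) =
      (\<integral>\<^sup>+x. \<integral>\<^sup>+y. indicator P x * (g y * indicator Q y) \<partial>lborel \<partial>lborel)"
    by (subst lborel.nn_integral_fst[symmetric]) (auto simp: indicator_times ac_simps)
  also have "\<dots> = (\<integral>\<^sup>+x. indicator P x * (\<integral>\<^sup>+y\<in>Q. g y \<partial>lborel) \<partial>lborel)"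
    by (intro nn_integral_cong) (simp add: nn_integral_cmult)
  finally show "(\<integral>\<^sup>+z\<in>P \<times> Q. g (snd z) \<partial>(lborel \<Otimes>\<^sub>M lborel)) = emeasure lborel P * (\<integral>\<^sup>+x\<in>Q. g x \<partial>lborel)"
    by (simp add: nn_integral_multc)
qed

definition sq_on :: "('a::euclidean_space \<Rightarrow> real) \<Rightarrow> 'a set \<Rightarrow> real" where
  "sq_on f P = (LINT x|lborel. indicator P x * (f x)\<^sup>2)"

definition energy_on :: "real \<Rightarrow> ('a::euclidean_space \<Rightarrow> real) \<Rightarrow> ('a \<times> 'a) set \<Rightarrow> real" where
  "energy_on \<alpha> f B = (LINT z|(lborel \<Otimes>\<^sub>M lborel). indicator B z * (jump \<alpha> f z)\<^sup>2)"

lemma sq_on_nonneg: "0 \<le> sq_on f P" and energy_on_nonneg: "0 \<le> energy_on \<alpha> f B"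
  by (simp_all add: sq_on_def energy_on_def)

text \<open>Young's inequality with a coefficient of \<open>b\<^sup>2\<close> as close to 1 as
  desired; the fixed coefficient 2 could destroy the contraction between shells.\<close>

lemma weighted_square_ineq:
  fixes a b :: real
  assumes "0 < \<epsilon>"
  shows "a\<^sup>2 \<le> (1 + \<epsilon>) * b\<^sup>2 + (1 + 1 / \<epsilon>) * (a - b)\<^sup>2"
proof -
  have "0 \<le> (\<epsilon> * b - (a - b))\<^sup>2 / \<epsilon>" using assms by simp
  also have "\<dots> = (1 + \<epsilon>) * b\<^sup>2 + (1 + 1 / \<epsilon>) * (a - b)\<^sup>2 - a\<^sup>2"
    using assms by (simp add: field_simps power2_eq_square)
  finally show ?thesis by simp
qed

section \<open>Half-open cubes and averages over them\<close>

definition cell :: "real \<Rightarrow> ('a::euclidean_space \<Rightarrow> int) \<Rightarrow> 'a set" where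
  "cell h p = {x. \<forall>b\<in>Basis. \<lfloor>(x \<bullet> b) / h\<rfloor> = p b}"

lemma cell_borel [measurable]: "cell h p \<in> sets (borel :: 'a::euclidean_space measure)"
proof -
  have "{x \<in> space (borel :: 'a measure). \<forall>b\<in>Basis. \<lfloor>(x \<bullet> b) / h\<rfloor> = p b} \<in> sets borel"
    by measurable
  then show ?thesis by (simp add: cell_def)
qed

context
  fixes h :: real
  assumes h: "0 < h"
begin

lemma cell_iff: "x \<in> cell h p \<longleftrightarrow> (\<forall>b\<in>Basis. of_int (p b) * h \<le> x \<bullet> b \<and> x \<bullet> b < (of_int (p b) + 1) * h)"
  using h by (simp add: cell_def floor_eq_iff field_simps)

lemma emeasure_cell: "emeasure lborel (cell h p :: 'a::euclidean_space set) = ennreal (h ^ DIM('a))"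
proof -
  define l where "l = (\<Sum>b\<in>Basis. (of_int (p b) * h) *\<^sub>R (b :: 'a))"
  define u where "u = (\<Sum>b\<in>Basis. ((of_int (p b) + 1) * h) *\<^sub>R (b :: 'a))"
  have lu: "l \<bullet> b = of_int (p b) * h" "u \<bullet> b = (of_int (p b) + 1) * h" if "b \<in> Basis" for b
    using that by (simp_all add: l_def u_def)
  have d: "(u - l) \<bullet> b = h" if "b \<in> Basis" for b
    using lu[OF that] by (simp add: inner_diff_left algebra_simps)
  have le: "l \<bullet> b \<le> u \<bullet> b" if "b \<in> Basis" for b using lu[OF that] h by (simp add: algebra_simps)
  have vol: "emeasure lborel (box l u) = ennreal (h ^ DIM('a))" "emeasure lborel (cbox l u) = ennreal (h ^ DIM('a))"
    using le d by (simp_all add: emeasure_lborel_box emeasure_lborel_cbox)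
  have "box l u \<subseteq> cell h p" "cell h p \<subseteq> cbox l u"
    unfolding cell_iff mem_box subset_iff using lu by (auto simp: cell_iff mem_box less_imp_le)
  then show ?thesis
    using emeasure_mono[of "box l u" "cell h p" lborel] emeasure_mono[of "cell h p" "cbox l u" lborel] vol
    by (intro antisym) auto
qed

lemma cell_diameter:
  fixes x y :: "'a::euclidean_space"
  assumes "x \<in> cell h p" "y \<in> cell h p"
  shows "norm (x - y) \<le> real DIM('a) * h"
proof -
  have "norm (x - y) \<le> (\<Sum>b\<in>Basis. \<bar>(x - y) \<bullet> b\<bar>)" by (rule norm_le_l1)
  also have "\<dots> \<le> (\<Sum>b\<in>(Basis :: 'a set). h)"
  proof (rule sum_mono)
    fix b :: 'a assume b: "b \<in> Basis"
    have "of_int (p b) * h \<le> x \<bullet> b" "x \<bullet> b < of_int (p b) * h + h"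
      "of_int (p b) * h \<le> y \<bullet> b" "y \<bullet> b < of_int (p b) * h + h"
      using assms b by (auto simp: cell_iff algebra_simps)
    then show "\<bar>(x - y) \<bullet> b\<bar> \<le> h" unfolding inner_diff_left abs_le_iff by linarith
  qed
  also have "\<dots> = real DIM('a) * h" by simp
  finally show ?thesis .
qed

lemma cell_bounded: "bounded (cell h p :: 'a::euclidean_space set)"
  unfolding bounded_two_points using cell_diameter[of _ p] by (auto simp: dist_norm)

text \<open>A cell depends only on the values of its index on \<open>Basis\<close>; extensional
  functions make the index unique, so distinct grid points have disjoint cells.\<close>

definition grid :: "real \<Rightarrow> ('a::euclidean_space \<Rightarrow> int) set" where
  "grid R = Basis \<rightarrow>\<^sub>E {- \<lceil>R / h\<rceil>..\<lceil>R / h\<rceil>}"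

lemma finite_grid: "finite (grid R :: ('a::euclidean_space \<Rightarrow> int) set)"
  unfolding grid_def by (intro finite_PiE) auto

lemma grid_cover:
  assumes "x \<in> ball (0::'a::euclidean_space) R"
  shows "\<exists>p\<in>grid R. x \<in> cell h p"
proof
  let ?p = "restrict (\<lambda>b. \<lfloor>(x \<bullet> b) / h\<rfloor>) Basis"
  show "x \<in> cell h ?p" by (simp add: cell_def)
  have ab: "\<bar>(x \<bullet> b) / h\<bar> \<le> R / h" if "b \<in> Basis" for b
    using Basis_le_norm[OF that, of x] assms h by (simp add: divide_right_mono)
  then show "?p \<in> grid R"
    unfolding grid_def
  proof (intro restrict_PiE_iff[THEN iffD2] ballI)
    fix b :: 'a assume "b \<in> Basis"
    then have "- (R / h) \<le> (x \<bullet> b) / h" "(x \<bullet> b) / h \<le> R / h"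
      using abs_le_D1[OF ab] abs_le_D2[OF ab] by (simp_all add: minus_le_iff)
    then show "\<lfloor>(x \<bullet> b) / h\<rfloor> \<in> {- \<lceil>R / h\<rceil>..\<lceil>R / h\<rceil>}" by (simp; linarith)
  qed
qed

lemma cell_disjoint:
  assumes "p \<in> grid R" "q \<in> grid R" "p \<noteq> (q :: 'a::euclidean_space \<Rightarrow> int)"
  shows "cell h p \<inter> cell h q = {}"
proof -
  obtain b where "b \<in> Basis" "p b \<noteq> q b"
    using assms PiE_ext[of p Basis "\<lambda>_. {- \<lceil>R / h\<rceil>..\<lceil>R / h\<rceil>}" q] unfolding grid_def by blast
  then show ?thesis by (auto simp: cell_def)
qed

end

definition int_on :: "('a::euclidean_space \<Rightarrow> real) \<Rightarrow> 'a set \<Rightarrow> real" where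
  "int_on f P = (LINT x|lborel. indicator P x * f x)"

context
  fixes f :: "'a::euclidean_space \<Rightarrow> real" and Q :: "'a set"
  assumes f [measurable]: "f \<in> borel_measurable lborel" and Q [measurable]: "Q \<in> sets borel"
    and fin: "emeasure lborel Q < \<infinity>" and int: "integrable lborel (\<lambda>x. indicator Q x * (f x)\<^sup>2)"
begin

lemma integrable_int_on: "integrable lborel (\<lambda>x. indicator Q x * f x)"
proof (rule Bochner_Integration.integrable_bound)
  show "integrable lborel (\<lambda>x. indicator Q x * (f x)\<^sup>2 + indicator Q x :: real)"
    using int fin by (intro Bochner_Integration.integrable_add) auto
  have "\<bar>a\<bar> \<le> a\<^sup>2 + 1" for a :: real
    using sum_squares_bound[of "\<bar>a\<bar>" 1] abs_ge_zero[of a] by simp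
  then show "AE x in lborel. norm (indicator Q x * f x) \<le> norm (indicator Q x * (f x)\<^sup>2 + indicator Q x :: real)"
    by (auto simp: indicator_def)
qed measurable

text \<open>Expanding the square under the double integral gives twice the variance of
  \<open>f\<close> on \<open>Q\<close>, up to normalisation. The identity yields the Poincare
  inequality, and its nonnegativity bounds the average by the mean square.\<close>

lemma increments_within:
  "(\<integral>\<^sup>+z\<in>Q \<times> Q. ennreal ((f (fst z) - f (snd z))\<^sup>2) \<partial>(lborel \<Otimes>\<^sub>M lborel)) =
    ennreal (2 * (measure lborel Q * sq_on f Q - (int_on f Q)\<^sup>2))"
  "(int_on f Q)\<^sup>2 \<le> measure lborel Q * sq_on f Q"
proof -
  let ?v = "measure lborel Q" and ?I = "int_on f Q" and ?s = "sq_on f Q"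
  let ?q = "indicator Q :: 'a \<Rightarrow> real"
  have iq: "integrable lborel ?q" using fin by simp
  have lq: "(LINT y|lborel. ?q y) = ?v" using fin by simp
  note ints = int integrable_int_on iq
  have inner: "(\<integral>\<^sup>+y. ennreal (?q x * (?q y * (f x - f y)\<^sup>2)) \<partial>lborel) =
      ennreal (?q x * ((f x)\<^sup>2 * ?v - 2 * f x * ?I + ?s))"
    and inner_nn: "0 \<le> ?q x * ((f x)\<^sup>2 * ?v - 2 * f x * ?I + ?s)" for x
  proof -
    have eq: "?q x * (?q y * (f x - f y)\<^sup>2) =
        ?q x * ((f x)\<^sup>2 * ?q y - 2 * f x * (?q y * f y) + ?q y * (f y)\<^sup>2)" for y
      by (simp add: power2_diff algebra_simps)
    have i: "integrable lborel (\<lambda>y. ?q x * (?q y * (f x - f y)\<^sup>2))"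
      unfolding eq using ints by (intro integrable_mult_right Bochner_Integration.integrable_add Bochner_Integration.integrable_diff)
    have val: "(LINT y|lborel. ?q x * (?q y * (f x - f y)\<^sup>2)) = ?q x * ((f x)\<^sup>2 * ?v - 2 * f x * ?I + ?s)"
      unfolding eq using ints lq
      by (simp add: int_on_def sq_on_def Bochner_Integration.integral_add Bochner_Integration.integral_diff)
    show "(\<integral>\<^sup>+y. ennreal (?q x * (?q y * (f x - f y)\<^sup>2)) \<partial>lborel) =
        ennreal (?q x * ((f x)\<^sup>2 * ?v - 2 * f x * ?I + ?s))"
      unfolding val[symmetric] by (rule nn_integral_eq_integral[OF i]) simp
    show "0 \<le> ?q x * ((f x)\<^sup>2 * ?v - 2 * f x * ?I + ?s)"
      unfolding val[symmetric] by (rule integral_nonneg_AE) simp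
  qed
  have eq2: "?q x * ((f x)\<^sup>2 * ?v - 2 * f x * ?I + ?s) = ?v * (?q x * (f x)\<^sup>2) - 2 * ?I * (?q x * f x) + ?s * ?q x" for x
    by (simp add: algebra_simps)
  have i2: "integrable lborel (\<lambda>x. ?q x * ((f x)\<^sup>2 * ?v - 2 * f x * ?I + ?s))"
    unfolding eq2 using ints by (intro integrable_mult_right Bochner_Integration.integrable_add Bochner_Integration.integrable_diff)
  have val: "(LINT x|lborel. ?q x * ((f x)\<^sup>2 * ?v - 2 * f x * ?I + ?s)) = 2 * (?v * ?s - ?I\<^sup>2)"
  proof -
    have "(LINT x|lborel. ?v * (?q x * (f x)\<^sup>2) - 2 * ?I * (?q x * f x) + ?s * ?q x) =
        ?v * (LINT x|lborel. ?q x * (f x)\<^sup>2) - 2 * ?I * (LINT x|lborel. ?q x * f x) + ?s * (LINT x|lborel. ?q x)"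
      using ints by (simp add: Bochner_Integration.integral_add Bochner_Integration.integral_diff)
    also have "\<dots> = ?v * ?s - 2 * ?I * ?I + ?s * ?v" unfolding lq int_on_def sq_on_def ..
    finally show ?thesis unfolding eq2 by (simp add: power2_eq_square algebra_simps)
  qed
  have "(\<integral>\<^sup>+z\<in>Q \<times> Q. ennreal ((f (fst z) - f (snd z))\<^sup>2) \<partial>(lborel \<Otimes>\<^sub>M lborel)) =
      (\<integral>\<^sup>+x. \<integral>\<^sup>+y. ennreal (?q x * (?q y * (f x - f y)\<^sup>2)) \<partial>lborel \<partial>lborel)"
    by (subst lborel.nn_integral_fst[symmetric])
      (auto simp: indicator_def intro!: nn_integral_cong)
  also have "\<dots> = (\<integral>\<^sup>+x. ennreal (?q x * ((f x)\<^sup>2 * ?v - 2 * f x * ?I + ?s)) \<partial>lborel)" by (simp only: inner)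
  also have "\<dots> = ennreal (2 * (?v * ?s - ?I\<^sup>2))"
    using nn_integral_eq_integral[OF i2] inner_nn by (simp only: val) simp
  finally show "(\<integral>\<^sup>+z\<in>Q \<times> Q. ennreal ((f (fst z) - f (snd z))\<^sup>2) \<partial>(lborel \<Otimes>\<^sub>M lborel)) =
      ennreal (2 * (?v * ?s - ?I\<^sup>2))" .
  have "0 \<le> (LINT x|lborel. ?q x * ((f x)\<^sup>2 * ?v - 2 * f x * ?I + ?s))"
    by (intro integral_nonneg_AE) (use inner_nn in auto)
  then show "?I\<^sup>2 \<le> ?v * ?s" unfolding val by simp
qed

end

section \<open>Diagonal subsequences\<close>

lemma finite_common_subseq:
  fixes a :: "'i \<Rightarrow> nat \<Rightarrow> real"
  assumes "finite A" "\<And>p. p \<in> A \<Longrightarrow> \<exists>B. \<forall>n. \<bar>a p n\<bar> \<le> B"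
  shows "\<exists>r. strict_mono r \<and> (\<forall>p\<in>A. convergent (\<lambda>n. a p (r n)))"
  using assms
proof (induction A rule: finite_induct)
  case empty
  then show ?case using strict_mono_id by auto
next
  case (insert q A)
  obtain r where r: "strict_mono r" "\<forall>p\<in>A. convergent (\<lambda>n. a p (r n))"
    using insert by blast
  obtain B where B: "\<And>n. \<bar>a q n\<bar> \<le> B" using insert.prems[of q] by blast
  have "bounded (range (\<lambda>n. a q (r n)))" using B by (intro boundedI[of _ B]) auto
  from bounded_imp_convergent_subsequence[OF this] obtain l s where s: "strict_mono (s :: nat \<Rightarrow> nat)"
    "((\<lambda>n. a q (r n)) \<circ> s) \<longlonglongrightarrow> l" by blast
  have "convergent (\<lambda>n. a p (r (s n)))" if "p \<in> insert q A" for p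
  proof (cases "p = q")
    case True
    then show ?thesis using s(2) by (auto simp: o_def intro: convergentI)
  next
    case False
    then have "convergent (\<lambda>n. a p (r n))" using r that by auto
    then show ?thesis using convergent_subseq_convergent[OF _ s(1)] by (auto simp: o_def)
  qed
  moreover have "strict_mono (\<lambda>n. r (s n))" using r s strict_mono_o[of r s] by (simp add: o_def)
  ultimately show ?case by (intro exI[of _ "\<lambda>n. r (s n)"]) blast
qed

text \<open>Each level \<open>j\<close> has only finitely many bounded sequences, so successive
  extraction works. The diagonal sequence is a subsequence of level \<open>j\<close> only from index
  \<open>Suc j\<close> on, which does not affect convergence.\<close>

lemma diagonal_subseq:
  fixes a :: "nat \<Rightarrow> 'i \<Rightarrow> nat \<Rightarrow> real"
  assumes fin: "\<And>j. finite (A j)" and bdd: "\<And>j p. p \<in> A j \<Longrightarrow> \<exists>B. \<forall>n. \<bar>a j p n\<bar> \<le> B"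
  obtains r where "strict_mono r" "\<And>j p. p \<in> A j \<Longrightarrow> convergent (\<lambda>n. a j p (r n))"
proof -
  define P where "P j s \<longleftrightarrow> (\<forall>p\<in>A j. convergent (\<lambda>n. a j p (s n)))" for j and s :: "nat \<Rightarrow> nat"
  interpret subseqs P
  proof
    fix j and s :: "nat \<Rightarrow> nat" assume "strict_mono s"
    have "\<exists>B. \<forall>n. \<bar>a j p (s n)\<bar> \<le> B" if "p \<in> A j" for p using bdd[OF that] by blast
    from finite_common_subseq[OF fin this, of j] show "\<exists>r'. strict_mono r' \<and> P j (s \<circ> r')"
      by (simp add: P_def)
  qed
  have "convergent (\<lambda>n. a j p (diagseq n))" if p: "p \<in> A j" for j p
  proof -
    have "P j (diagseq \<circ> ((+) (Suc j)))"
    proof (rule diagseq_holds)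
      fix r s :: "nat \<Rightarrow> nat" and n assume r: "strict_mono r" and s: "P n s"
      show "P n (s \<circ> r)" unfolding P_def
      proof
        fix p assume "p \<in> A n"
        then have "convergent (\<lambda>k. a n p (s k))" using s by (simp add: P_def)
        then show "convergent (\<lambda>k. a n p ((s \<circ> r) k))"
          using convergent_subseq_convergent[OF _ r] by (auto simp: o_def)
      qed
    qed
    then have "convergent (\<lambda>n. a j p (diagseq (n + Suc j)))"
      using p by (simp add: P_def add.commute)
    then show ?thesis using convergent_ignore_initial_segment[of "\<lambda>n. a j p (diagseq n)" "Suc j"] by simp
  qed
  then show thesis using that subseq_diagseq by blast
qed

section \<open>Weighted functions on bounded sets and density of Lipschitz functions\<close>

lemma weight_le_1: "0 \<le> \<beta> \<Longrightarrow> (1 + norm x) powr - \<beta> \<le> 1"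
  using powr_mono2'[of "- \<beta>" 1 "1 + norm x"] by simp

text \<open>On \<open>ball 0 R\<close> the weight is at least \<open>(1 + R) powr - \<beta>\<close>,
  so weighted and Lebesgue integrals are comparable there.\<close>

lemma weighted_L2_local:
  fixes f :: "'a::euclidean_space \<Rightarrow> real"
  assumes f: "f \<in> L2 (weighted_measure \<beta>)" and \<beta>: "0 \<le> \<beta>"
    and Q [measurable]: "Q \<in> sets borel" and sub: "Q \<subseteq> ball 0 R"
  shows "integrable lborel (\<lambda>x. indicator Q x * (f x)\<^sup>2)"
    "sq_on f Q \<le> (1 + R) powr \<beta> * L2_inner (weighted_measure \<beta>) f f"
    "(\<integral>\<^sup>+x\<in>Q. ennreal ((f x)\<^sup>2) \<partial>lborel) = ennreal (sq_on f Q)"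
proof -
  let ?M = "weighted_measure \<beta> :: 'a measure"
  have [measurable]: "f \<in> borel_measurable borel" using L2_measurable[OF f] by (simp cong: measurable_cong_sets)
  have pt: "indicator Q x * (f x)\<^sup>2 \<le> (1 + R) powr \<beta> * ((1 + norm x) powr - \<beta> * (f x)\<^sup>2)" for x
  proof (cases "x \<in> Q")
    case True
    then have x: "norm x < R" using sub by auto
    have p: "0 < 1 + norm x" using norm_ge_zero[of x] by linarith
    have "(1 + norm x) powr \<beta> \<le> (1 + R) powr \<beta>" using x \<beta> by (intro powr_mono2) auto
    then have "(1 + norm x) powr \<beta> * (1 + norm x) powr - \<beta> \<le> (1 + R) powr \<beta> * (1 + norm x) powr - \<beta>"
      by (intro mult_right_mono) auto
    then have "1 \<le> (1 + R) powr \<beta> * (1 + norm x) powr - \<beta>" using p by (simp flip: powr_add)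
    then have "1 * (f x)\<^sup>2 \<le> ((1 + R) powr \<beta> * (1 + norm x) powr - \<beta>) * (f x)\<^sup>2" by (rule mult_right_mono) simp
    then show ?thesis using True by (simp add: mult.assoc)
  qed simp
  have "(\<integral>\<^sup>+x. ennreal (indicator Q x * (f x)\<^sup>2) \<partial>lborel) \<le>
      (\<integral>\<^sup>+x. ennreal ((1 + R) powr \<beta>) * (ennreal ((1 + norm x) powr - \<beta>) * ennreal ((f x)\<^sup>2)) \<partial>lborel)"
    using pt by (intro nn_integral_mono) (simp add: ennreal_leI flip: ennreal_mult)
  also have "\<dots> = ennreal ((1 + R) powr \<beta>) * (\<integral>\<^sup>+x. ennreal ((f x)\<^sup>2) \<partial>?M)"
    by (subst nn_integral_weighted_measure) (auto simp: nn_integral_cmult)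
  also have "\<dots> = ennreal ((1 + R) powr \<beta> * L2_inner ?M f f)"
    by (simp add: L2_inner_self_nn[OF f, symmetric] L2.ip_nonneg[OF f] ennreal_mult)
  finally have le: "(\<integral>\<^sup>+x. ennreal (indicator Q x * (f x)\<^sup>2) \<partial>lborel) \<le> ennreal ((1 + R) powr \<beta> * L2_inner ?M f f)" .
  show i: "integrable lborel (\<lambda>x. indicator Q x * (f x)\<^sup>2)"
    using le_less_trans[OF le ennreal_less_top] by (intro integrableI_nonneg) auto
  have eq: "(\<integral>\<^sup>+x. ennreal (indicator Q x * (f x)\<^sup>2) \<partial>lborel) = ennreal (sq_on f Q)"
    unfolding sq_on_def by (rule nn_integral_eq_integral[OF i]) simp
  show "sq_on f Q \<le> (1 + R) powr \<beta> * L2_inner ?M f f"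
    using le unfolding eq using L2.ip_nonneg[OF f] by (subst (asm) ennreal_le_iff) auto
  have "ennreal (indicator Q x * (f x)\<^sup>2) = ennreal ((f x)\<^sup>2) * indicator Q x" for x
    by (simp add: indicator_def)
  then show "(\<integral>\<^sup>+x\<in>Q. ennreal ((f x)\<^sup>2) \<partial>lborel) = ennreal (sq_on f Q)" using eq by simp
qed

lemma int_on_diff:
  assumes "integrable lborel (\<lambda>x. indicator Q x * f x)" "integrable lborel (\<lambda>x. indicator Q x * g x)"
  shows "int_on (f - g) Q = int_on f Q - int_on g Q"
  using assms by (simp add: int_on_def right_diff_distrib)

text \<open>The jump density, up to its constant, times \<open>min (norm z ^ 2) 1\<close>, the
  factor in the Levy integrability condition. It dominates the energy density of a bounded Lipschitz
  function.\<close>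

definition jump_kernel :: "real \<Rightarrow> 'a::euclidean_space \<Rightarrow> real" where
  "jump_kernel \<alpha> z = min ((norm z)\<^sup>2) 1 / norm z powr (real DIM('a) + \<alpha>)"

lemma ennreal_le_suminf: "f k \<le> suminf f" for f :: "nat \<Rightarrow> ennreal"
  using sum_le_suminf[of f "{k}"] by (simp add: summableI)

text \<open>Indicators of bounded open sets are monotone limits of Lipschitz cut-offs. So the
  weighted \<open>g\<close> integrates to zero over them, and a function with this property vanishes
  almost everywhere, as open sets generate the Borel sets.\<close>

lemma weighted_null_if_orthogonal:
  fixes g :: "'a::euclidean_space \<Rightarrow> real"
  assumes g: "g \<in> L2 (weighted_measure \<beta>)" and \<beta>: "0 \<le> \<beta>"
    and orth: "\<And>\<phi> L R. (\<And>x y. \<bar>\<phi> x - \<phi> y\<bar> \<le> L * norm (x - y)) \<Longrightarrow> (\<And>x. \<bar>\<phi> x\<bar> \<le> 1) \<Longrightarrow>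
      (\<And>x. x \<notin> ball 0 R \<Longrightarrow> \<phi> x = 0) \<Longrightarrow> L2_inner (weighted_measure \<beta>) g \<phi> = 0"
  shows "AE x in lborel. g x = 0"
proof -
  let ?w = "\<lambda>x :: 'a. (1 + norm x) powr - \<beta>"
  have w0: "0 < ?w x" for x using norm_ge_zero[of x] by (simp add: add_nonneg_eq_0_iff)
  have gm [measurable]: "g \<in> borel_measurable borel" using L2_measurable[OF g] by (simp cong: measurable_cong_sets)
  have inner: "L2_inner (weighted_measure \<beta>) g \<phi> = (LINT x|lborel. ?w x * (g x * \<phi> x))"
    if [measurable]: "\<phi> \<in> borel_measurable borel" for \<phi>
    unfolding L2_inner_def weighted_measure_def by (subst integral_density) (auto simp: w0 less_imp_le)
  have zero: "AE x in lborel. x \<in> ball 0 n \<longrightarrow> g x = 0" for n :: real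
  proof (cases "0 < n")
    case False
    then have e: "ball (0::'a) n = {}" by simp
    show ?thesis unfolding e by simp
  next
    case n: True
    let ?B = "ball (0::'a) n"
    have [measurable]: "?B \<in> sets borel" by simp
    define k where "k x = ?w x * g x * indicator ?B x" for x
    have km [measurable]: "k \<in> borel_measurable borel" unfolding k_def by measurable
    have ki: "integrable lborel k"
    proof -
      have fin: "emeasure lborel ?B < \<infinity>" by (rule emeasure_lborel_ball_finite)
      have sq: "integrable lborel (\<lambda>x. indicator ?B x * (g x)\<^sup>2)"
        by (rule weighted_L2_local(1)[OF g \<beta>, of _ n]) auto
      have "integrable lborel (\<lambda>x. indicator ?B x * g x)"
        by (rule integrable_int_on[OF _ _ fin sq]) (use gm in auto)
      then show ?thesis
      proof (rule Bochner_Integration.integrable_bound)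
        have "\<bar>?w x * g x\<bar> \<le> \<bar>g x\<bar>" for x
          using weight_le_1[OF \<beta>, of x] w0[of x] by (simp add: abs_mult mult_left_le_one_le)
        then show "AE x in lborel. norm (k x) \<le> norm (indicator ?B x * g x)"
          by (auto simp: k_def indicator_def)
      qed measurable
    qed
    have open0: "(LINT x|lborel. indicator U x * k x) = 0" if U: "open U" for U
    proof -
      \<comment> \<open>Intersecting with the ball gives the cut-offs bounded support and changes
        nothing, since \<open>k\<close> vanishes outside it.\<close>
      define W where "W = U \<inter> ?B"
      have W: "open W" "W \<subseteq> ?B" using U by (auto simp: W_def)
      \<comment> \<open>\<open>infdist\<close> to the empty set is 0 by convention, which would make
        all the cut-offs vanish.\<close>
      have ne: "- W \<noteq> {}" using W(2) bounded_ball[of "0::'a" n] not_bounded_UNIV bounded_subset by blast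
      have cl: "closed (- W)" using W(1) by (simp only: closed_Compl)
      define \<phi> where "\<phi> m x = min 1 (real m * infdist x (- W))" for m x
      have \<phi>0: "0 \<le> \<phi> m x" and \<phi>1: "\<phi> m x \<le> 1" for m x
        by (simp_all add: \<phi>_def infdist_nonneg)
      have \<phi>W: "\<phi> m x = 0" if "x \<notin> W" for m x using that by (simp add: \<phi>_def)
      have [measurable]: "\<phi> m \<in> borel_measurable borel" for m
        unfolding \<phi>_def by (intro borel_measurable_continuous_onI continuous_intros) 
      have Lip: "\<bar>\<phi> m x - \<phi> m y\<bar> \<le> real m * norm (x - y)" for m x y
      proof -
        have "\<bar>\<phi> m x - \<phi> m y\<bar> \<le> \<bar>real m * infdist x (- W) - real m * infdist y (- W)\<bar>"
          unfolding \<phi>_def by (simp add: min_def abs_if split: if_splits)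
        also have "\<dots> = real m * \<bar>infdist x (- W) - infdist y (- W)\<bar>"
          by (simp add: abs_mult flip: right_diff_distrib)
        also have "\<dots> \<le> real m * dist x y"
          using infdist_triangle[of x "- W" y] infdist_triangle[of y "- W" x]
          by (intro mult_left_mono) (auto simp: abs_le_iff dist_commute)
        finally show ?thesis by (simp add: dist_norm)
      qed
      have "(LINT x|lborel. \<phi> m x * k x) = 0" for m
      proof -
        have "L2_inner (weighted_measure \<beta>) g (\<phi> m) = 0"
        proof (rule orth[of _ "real m" n])
          show "\<bar>\<phi> m x\<bar> \<le> 1" for x using \<phi>0[of m x] \<phi>1[of m x] by simp
          show "\<phi> m x = 0" if "x \<notin> ball 0 n" for x using that W(2) \<phi>W by blast
        qed (rule Lip)
        moreover have "?w x * (g x * \<phi> m x) = \<phi> m x * k x" for x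
          using \<phi>W[of x m] W(2) by (cases "x \<in> W") (auto simp: k_def)
        ultimately show ?thesis by (simp add: inner)
      qed
      moreover have "(\<lambda>m. LINT x|lborel. \<phi> m x * k x) \<longlonglongrightarrow> (LINT x|lborel. indicator W x * k x)"
      proof (rule integral_dominated_convergence[where w = "\<lambda>x. \<bar>k x\<bar>"])
        have [measurable]: "W \<in> sets borel" using W(1) by simp
        show "(\<lambda>x. indicator W x * k x) \<in> borel_measurable lborel" by measurable
        show "AE x in lborel. (\<lambda>m. \<phi> m x * k x) \<longlonglongrightarrow> indicator W x * k x"
        proof (intro AE_I2 tendsto_mult tendsto_const)
          fix x :: 'a
          show "(\<lambda>m. \<phi> m x) \<longlonglongrightarrow> indicator W x"
          proof (cases "x \<in> W")
            case True
            have d: "0 < infdist x (- W)"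
              using in_closed_iff_infdist_zero[OF cl ne, of x] True infdist_nonneg[of x "- W"] by simp
            obtain M where M: "1 < real M * infdist x (- W)" using reals_Archimedean3[OF d] by blast
            have "\<phi> m x = 1" if "m \<ge> M" for m
            proof -
              have "real M * infdist x (- W) \<le> real m * infdist x (- W)" using that d by (intro mult_right_mono) auto
              then show ?thesis using M by (simp add: \<phi>_def)
            qed
            then have "\<forall>\<^sub>F m in sequentially. \<phi> m x = indicator W x"
              using True by (auto simp: eventually_sequentially)
            then show ?thesis by (rule tendsto_eventually)
          qed (simp add: \<phi>W)
        qed
        show "AE x in lborel. norm (\<phi> m x * k x) \<le> \<bar>k x\<bar>" for m
          using \<phi>0 \<phi>1 by (intro AE_I2) (simp add: abs_mult mult_left_le_one_le)
      qed (use ki in auto)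
      ultimately have "(LINT x|lborel. indicator W x * k x) = 0" by (simp add: LIMSEQ_const_iff)
      moreover have "indicator W x * k x = indicator U x * k x" for x by (simp add: W_def k_def indicator_def)
      ultimately show ?thesis by simp
    qed
    \<comment> \<open>The positive and negative parts of \<open>k\<close> are densities of finite
      measures. They agree on the open sets, which are closed under intersection, so the measures
      coincide and the two densities are equal almost everywhere.\<close>
    define P where "P = density lborel (\<lambda>x. ennreal (max 0 (k x)))"
    define N where "N = density lborel (\<lambda>x. ennreal (max 0 (- k x)))"
    have em: "emeasure P U = ennreal (LINT x|lborel. indicator U x * max 0 (k x))"
      "emeasure N U = ennreal (LINT x|lborel. indicator U x * max 0 (- k x))" if [measurable]: "U \<in> sets borel" for U
    proof -
      have i: "integrable lborel (\<lambda>x. indicator U x * max 0 (k x))" "integrable lborel (\<lambda>x. indicator U x * max 0 (- k x))"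
        using integrable_mult_indicator[of U lborel "\<lambda>x. max 0 (k x)"]
          integrable_mult_indicator[of U lborel "\<lambda>x. max 0 (- k x)"] ki by auto
      have c: "ennreal (max 0 t) * indicator U x = ennreal (indicator U x * max 0 t)" for t x
        by (simp add: indicator_def)
      show "emeasure P U = ennreal (LINT x|lborel. indicator U x * max 0 (k x))"
        unfolding P_def by (subst emeasure_density) (auto simp: c nn_integral_eq_integral[OF i(1)])
      show "emeasure N U = ennreal (LINT x|lborel. indicator U x * max 0 (- k x))"
        unfolding N_def by (subst emeasure_density) (auto simp: c nn_integral_eq_integral[OF i(2)])
    qed
    have "P = N"
    proof (rule measure_eqI_generator_eq[where E = "{S. open S}" and \<Omega> = UNIV and A = "\<lambda>_. UNIV"])
      show "Int_stable {S :: 'a set. open S}" by (auto simp: Int_stable_def)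
      show "sets P = sigma_sets UNIV {S. open S}" "sets N = sigma_sets UNIV {S. open S}"
        by (auto simp: P_def N_def borel_def)
      show "emeasure P (UNIV :: 'a set) \<noteq> \<infinity>" using em(1)[of UNIV] by simp
      fix U :: "'a set" assume "U \<in> {S. open S}"
      then have U: "open U" and Um [measurable]: "U \<in> sets borel" by auto
      have i: "integrable lborel (\<lambda>x. indicator U x * max 0 (k x))" "integrable lborel (\<lambda>x. indicator U x * max 0 (- k x))"
        using integrable_mult_indicator[of U lborel "\<lambda>x. max 0 (k x)"]
          integrable_mult_indicator[of U lborel "\<lambda>x. max 0 (- k x)"] ki by auto
      have "(LINT x|lborel. indicator U x * max 0 (k x)) - (LINT x|lborel. indicator U x * max 0 (- k x)) =
          (LINT x|lborel. indicator U x * max 0 (k x) - indicator U x * max 0 (- k x))"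
        using i by simp
      also have "\<dots> = (LINT x|lborel. indicator U x * k x)"
        by (intro Bochner_Integration.integral_cong) (auto simp: max_def indicator_def)
      also have "\<dots> = 0" by (rule open0[OF U])
      finally show "emeasure P U = emeasure N U" by (simp add: em)
    qed auto
    have "AE x in lborel. ennreal (max 0 (k x)) = ennreal (max 0 (- k x))"
      by (rule sigma_finite_measure.density_unique[OF sigma_finite_lborel _ _ \<open>P = N\<close>[unfolded P_def N_def]])
        measurable
    then show ?thesis
    proof eventually_elim
      case (elim x)
      then have "max 0 (k x) = max 0 (- k x)" by simp
      then have "k x = 0" by (auto simp: max_def split: if_splits)
      then show ?case using w0[of x] by (auto simp: k_def)
    qed
  qed
  have "AE x in lborel. \<forall>n. x \<in> ball 0 (real n) \<longrightarrow> g x = 0" unfolding AE_all_countable using zero by blast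
  then show ?thesis
  proof eventually_elim
    case (elim x)
    obtain n where "norm x < real n" using reals_Archimedean2 by blast
    then show ?case using elim by auto
  qed
qed

section \<open>Dilations and a bump function\<close>

lemma nn_integral_dilate:
  fixes g :: "'a::euclidean_space \<Rightarrow> ennreal"
  assumes [measurable]: "g \<in> borel_measurable borel" and R: "0 < R"
  shows "(\<integral>\<^sup>+x. g ((1 / R) *\<^sub>R x) \<partial>lborel) = ennreal (R ^ DIM('a)) * (\<integral>\<^sup>+x. g x \<partial>lborel)"
proof -
  have "(\<integral>\<^sup>+x. g x \<partial>lborel) =
      (\<integral>\<^sup>+x. g x \<partial>density (distr lborel borel (\<lambda>x. 0 + (1 / R) *\<^sub>R x)) (\<lambda>_. ennreal (\<bar>1 / R\<bar> ^ DIM('a))))"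
    using R lborel_affine[of "1 / R" "0 :: 'a"] by simp
  also have "\<dots> = ennreal ((1 / R) ^ DIM('a)) * (\<integral>\<^sup>+x. g ((1 / R) *\<^sub>R x) \<partial>lborel)"
    using R by (simp add: nn_integral_density nn_integral_distr nn_integral_cmult)
  finally have "ennreal (R ^ DIM('a)) * (\<integral>\<^sup>+x. g x \<partial>lborel) =
      ennreal (R ^ DIM('a) * (1 / R) ^ DIM('a)) * (\<integral>\<^sup>+x. g ((1 / R) *\<^sub>R x) \<partial>lborel)"
    using R by (simp add: ennreal_mult mult.assoc)
  also have "R ^ DIM('a) * (1 / R) ^ DIM('a) = 1" using R by (simp flip: power_mult_distrib)
  finally show ?thesis by simp
qed

definition dilate :: "real \<Rightarrow> ('a::euclidean_space \<Rightarrow> real) \<Rightarrow> 'a \<Rightarrow> real" where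
  "dilate R f x = f ((1 / R) *\<^sub>R x)"

lemma dilate_one: "dilate 1 f = f"
  by (simp add: dilate_def fun_eq_iff)

text \<open>Peak value 1 at \<open>norm x = 3 / 2\<close>. The slope 2 makes it vanish outside the
  open shell between the radii 1 and 2, so dilations by distinct powers of 2 have disjoint
  supports.\<close>

definition tent :: "'a::euclidean_space \<Rightarrow> real" where
  "tent x = max 0 (1 - \<bar>2 * norm x - 3\<bar>)"

lemma tent_bounds: "0 \<le> tent x" "tent x \<le> 1"
  by (simp_all add: tent_def)

lemma tent_support: "tent x \<noteq> 0 \<Longrightarrow> 1 < norm x \<and> norm x < 2"
  by (auto simp: tent_def max_def abs_if split: if_splits)

lemma tent_Lipschitz: "\<bar>tent x - tent y\<bar> \<le> 2 * norm (x - y)"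
proof -
  have "\<bar>tent x - tent y\<bar> \<le> \<bar>2 * norm x - 2 * norm y\<bar>"
    unfolding tent_def by (simp add: max_def abs_if split: if_splits)
  also have "\<dots> \<le> 2 * norm (x - y)" using norm_triangle_ineq3[of x y] by linarith
  finally show ?thesis .
qed

lemma dilate_tent_support:
  assumes "0 < R" "dilate R tent x \<noteq> 0"
  shows "R < norm x" "norm x < 2 * R"
  using tent_support[of "(1 / R) *\<^sub>R x"] assms by (auto simp: dilate_def field_simps)

lemma dilate_tent_Lipschitz:
  assumes R: "0 < R"
  shows "\<bar>dilate R tent x - dilate R tent y\<bar> \<le> 2 / R * norm (x - y)"
proof -
  have "\<bar>dilate R tent x - dilate R tent y\<bar> \<le> 2 * norm ((1 / R) *\<^sub>R x - (1 / R) *\<^sub>R y)"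
    unfolding dilate_def by (rule tent_Lipschitz)
  also have "(1 / R) *\<^sub>R x - (1 / R) *\<^sub>R y = (1 / R) *\<^sub>R (x - y)" by (simp add: scaleR_diff_right)
  finally show ?thesis using R by simp
qed

lemma tent_sq_pos:
  assumes "tent \<in> L2 (lborel :: 'a::euclidean_space measure)"
  shows "0 < L2_inner lborel tent (tent :: 'a \<Rightarrow> real)"
proof (rule ccontr)
  assume "\<not> ?thesis"
  then have "(LINT x|lborel. (tent (x :: 'a))\<^sup>2) = 0"
    using L2.ip_nonneg[OF assms] unfolding L2_inner_self by linarith
  then have "AE x in lborel. (tent (x :: 'a))\<^sup>2 = 0"
    using integral_nonneg_eq_0_iff_AE[OF L2_integrable_sq[OF assms]] by simp
  then have ae: "AE x in lborel. tent (x :: 'a) = 0" by simp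
  have "continuous_on UNIV (tent :: 'a \<Rightarrow> real)" unfolding tent_def by (intro continuous_intros)
  then have op: "open {x :: 'a. tent x \<noteq> 0}" by (intro open_Collect_neq) auto
  obtain b :: 'a where b: "b \<in> Basis" using nonempty_Basis by blast
  have "tent ((3/2) *\<^sub>R b) \<noteq> 0" using b by (simp add: tent_def)
  then have ne: "{x :: 'a. tent x \<noteq> 0} \<noteq> {}" by blast
  have "{x :: 'a. tent x \<noteq> 0} \<in> null_sets lborel"
    using ae op by (subst (asm) AE_iff_null) (auto simp: borel_open)
  then have "negligible {x :: 'a. tent x \<noteq> 0}"
    by (simp add: negligible_iff_null_sets null_sets_completionI)
  then show False using open_not_negligible[OF op ne] by simp
qed

section \<open>The stable Dirichlet form\<close>

context
  fixes \<alpha> :: real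
  assumes \<alpha>_pos: "0 < \<alpha>" and \<alpha>_less: "\<alpha> < 2"
begin

lemma stable_integrand_eq: "stable_integrand \<alpha> f g = (\<lambda>z. jump \<alpha> f z * jump \<alpha> g z)"
proof -
  have *: "a * sqrt c * (b * sqrt c) = a * b * c" if "0 \<le> c" for a b c :: real
  proof -
    have "a * sqrt c * (b * sqrt c) = a * b * (sqrt c * sqrt c)" by algebra
    then show ?thesis using that by simp
  qed
  show ?thesis
  proof (rule ext, clarify)
    fix x y :: 'a
    show "stable_integrand \<alpha> f g (x, y) = jump \<alpha> f (x, y) * jump \<alpha> g (x, y)"
      unfolding stable_integrand_def jump_def prod.case
      using stable_const_pos[OF \<alpha>_pos \<alpha>_less, of "DIM('a)"] by (subst *) auto
  qed
qed

lemma stable_form_eq: "stable_form \<alpha> f g = 1 / 2 * L2_inner (lborel \<Otimes>\<^sub>M lborel) (jump \<alpha> f) (jump \<alpha> g)"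
  by (simp add: stable_form_def stable_integrand_eq L2_inner_def)

lemma stable_dom_eq: "stable_dom \<alpha> = L2 lborel \<inter> finite_energy \<alpha>"
proof -
  have "f \<in> stable_dom \<alpha> \<longleftrightarrow> f \<in> L2 lborel \<inter> finite_energy \<alpha>" for f :: "'a \<Rightarrow> real"
    using measurable_jump[of f \<alpha>]
    by (auto simp: stable_dom_def finite_energy_def L2_def[of "lborel :: 'a measure"]
        L2_def[of "lborel \<Otimes>\<^sub>M lborel :: ('a \<times> 'a) measure"] stable_integrand_eq power2_eq_square)
  then show ?thesis by blast
qed

lemma semi_inner_stable_form: "semi_inner (finite_energy \<alpha>) (stable_form \<alpha>)"
  by standard (auto simp: subspace_finite_energy stable_form_eq jump_add jump_scale finite_energyD
      L2.ip_simps L2.ip_nonneg L2.ip_commute algebra_simps)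

interpretation D: semi_inner "finite_energy \<alpha>" "stable_form \<alpha>"
  by (rule semi_inner_stable_form)

lemma nrm_jump: "L2.nrm (lborel \<Otimes>\<^sub>M lborel) (jump \<alpha> f) = sqrt 2 * D.nrm f"
  by (simp add: L2.nrm_def D.nrm_def stable_form_eq flip: real_sqrt_mult)

lemma conv_jump: "L2.conv (lborel \<Otimes>\<^sub>M lborel) (\<lambda>n. jump \<alpha> (u n)) (jump \<alpha> f) \<longleftrightarrow> D.conv u f"
proof -
  have "(\<lambda>n. sqrt 2 * D.nrm (u n - f)) \<longlonglongrightarrow> 0 \<longleftrightarrow> (\<lambda>n. D.nrm (u n - f)) \<longlonglongrightarrow> 0"
    using tendsto_mult_left_iff[of "sqrt 2" "\<lambda>n. D.nrm (u n - f)" 0] by simp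
  then show ?thesis unfolding L2.conv_def D.conv_def by (simp add: nrm_jump flip: jump_diff)
qed

lemma Cau_jump: "D.Cau u \<Longrightarrow> L2.Cau (lborel \<Otimes>\<^sub>M lborel) (\<lambda>n. jump \<alpha> (u n))"
  unfolding D.Cau_def by (rule L2.CauI_dominated[of "sqrt 2"]) (simp_all add: nrm_jump flip: jump_diff)

text \<open>Finite energy is stable under almost everywhere limits of energy-Cauchy sequences, since the
  increments converge in \<open>L\<^sup>2\<close> as well.\<close>

lemma energy_AE_limit:
  fixes u :: "nat \<Rightarrow> 'a::euclidean_space \<Rightarrow> real"
  assumes u: "\<And>n. u n \<in> finite_energy \<alpha>" and C: "D.Cau u"
    and f: "f \<in> borel_measurable lborel" and ae: "AE x in lborel. (\<lambda>n. u n x) \<longlonglongrightarrow> f x"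
  shows "f \<in> finite_energy \<alpha>" "D.conv u f"
proof -
  let ?L = "lborel \<Otimes>\<^sub>M lborel :: ('a \<times> 'a) measure"
  have "AE z in ?L. (\<lambda>n. u n (fst z)) \<longlonglongrightarrow> f (fst z) \<and> (\<lambda>n. u n (snd z)) \<longlonglongrightarrow> f (snd z)"
    by (rule AE_lborel_pairI[OF ae])
  then have "AE z in ?L. (\<lambda>n. jump \<alpha> (u n) z) \<longlonglongrightarrow> jump \<alpha> f z"
    by eventually_elim (auto simp: jump_def split_beta intro!: tendsto_mult tendsto_diff)
  note lim = L2_AE_limit[OF finite_energyD(2)[OF u] Cau_jump[OF C] measurable_jump[OF f] this]
  show "f \<in> finite_energy \<alpha>" using f lim(1) by (simp add: finite_energy_def)
  show "D.conv u f" using lim(2) by (simp add: conv_jump)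
qed

section \<open>The extended Dirichlet space\<close>

lemma stable_domD: "f \<in> stable_dom \<alpha> \<Longrightarrow> f \<in> finite_energy \<alpha>" "f \<in> stable_dom \<alpha> \<Longrightarrow> f \<in> L2 lborel"
  by (auto simp: stable_dom_eq)

lemma subspace_stable_dom: "subspace (stable_dom \<alpha>)"
  unfolding stable_dom_eq by (intro subspace_inter subspace_L2 subspace_finite_energy)

lemma approximating_sequence_iff:
  "approximating_sequence \<alpha> u f \<longleftrightarrow>
    (\<forall>n. u n \<in> stable_dom \<alpha>) \<and> D.Cau u \<and> (AE x in lborel. (\<lambda>n. u n x) \<longlonglongrightarrow> f x)"
proof -
  let ?d = "\<lambda>m n. stable_form \<alpha> (u m - u n) (u m - u n)"
  have "(\<forall>e>0. \<exists>N. \<forall>m\<ge>N. \<forall>n\<ge>N. ?d m n < e) \<longleftrightarrow> (\<forall>e>0. \<exists>N. \<forall>m\<ge>N. \<forall>n\<ge>N. sqrt (?d m n) < e)"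
  proof (intro iffI allI impI)
    fix e :: real assume a: "\<forall>e>0. \<exists>N. \<forall>m\<ge>N. \<forall>n\<ge>N. ?d m n < e" and e: "e > 0"
    then have "\<exists>N. \<forall>m\<ge>N. \<forall>n\<ge>N. ?d m n < e\<^sup>2" by simp
    then obtain N where N: "\<forall>m\<ge>N. \<forall>n\<ge>N. ?d m n < e\<^sup>2" ..
    have "sqrt (?d m n) < e" if "m \<ge> N" "n \<ge> N" for m n
    proof -
      have "sqrt (?d m n) < sqrt (e\<^sup>2)" using N that by (intro real_sqrt_less_mono) simp
      then show ?thesis using e by simp
    qed
    then show "\<exists>N. \<forall>m\<ge>N. \<forall>n\<ge>N. sqrt (?d m n) < e" by blast
  next
    fix e :: real assume a: "\<forall>e>0. \<exists>N. \<forall>m\<ge>N. \<forall>n\<ge>N. sqrt (?d m n) < e" and e: "e > 0"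
    have "\<exists>N. \<forall>m\<ge>N. \<forall>n\<ge>N. sqrt (?d m n) < sqrt e" by (rule a[rule_format]) (use e in simp)
    then show "\<exists>N. \<forall>m\<ge>N. \<forall>n\<ge>N. ?d m n < e" by (simp only: real_sqrt_less_iff)
  qed
  then show ?thesis
    unfolding approximating_sequence_def D.Cau_def D.nrm_def fun_diff_def by (simp only:)
qed

lemma approximating_sequence_conv:
  assumes "approximating_sequence \<alpha> u f" "f \<in> borel_measurable lborel"
  shows "f \<in> finite_energy \<alpha>" "D.conv u f"
  using energy_AE_limit[of u f] assms by (auto simp: approximating_sequence_iff stable_domD)

lemma extended_domE:
  assumes "f \<in> extended_dom \<alpha>"
  obtains u where "approximating_sequence \<alpha> u f" "f \<in> finite_energy \<alpha>" "D.conv u f"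
  using assms approximating_sequence_conv unfolding extended_dom_def by blast

text \<open>Every approximating sequence converges in energy to \<open>f\<close> itself, so the
  limit in the definite description is always the double integral of the limits. From here on the
  abstract extension can be replaced by the explicit form.\<close>

lemma extended_form_eq:
  assumes f: "f \<in> extended_dom \<alpha>" and g: "g \<in> extended_dom \<alpha>"
  shows "extended_form \<alpha> f g = stable_form \<alpha> f g"
  unfolding extended_form_def
proof (rule the_equality)
  have lim: "(\<lambda>n. stable_form \<alpha> (u n) (v n)) \<longlonglongrightarrow> stable_form \<alpha> f g"
    if uv: "approximating_sequence \<alpha> u f" "approximating_sequence \<alpha> v g" for u v
  proof (rule D.conv_ip)
    show "f \<in> finite_energy \<alpha>" "D.conv u f" "g \<in> finite_energy \<alpha>" "D.conv v g"
      using approximating_sequence_conv[OF uv(1)] approximating_sequence_conv[OF uv(2)] f g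
      by (auto simp: extended_dom_def)
    show "u n \<in> finite_energy \<alpha>" "v n \<in> finite_energy \<alpha>" for n
      using uv by (auto simp: approximating_sequence_def stable_domD)
  qed
  then show "\<forall>u v. approximating_sequence \<alpha> u f \<longrightarrow> approximating_sequence \<alpha> v g \<longrightarrow>
      (\<lambda>n. stable_form \<alpha> (u n) (v n)) \<longlonglongrightarrow> stable_form \<alpha> f g" by blast
  fix c assume c: "\<forall>u v. approximating_sequence \<alpha> u f \<longrightarrow> approximating_sequence \<alpha> v g \<longrightarrow>
      (\<lambda>n. stable_form \<alpha> (u n) (v n)) \<longlonglongrightarrow> c"
  obtain u v where "approximating_sequence \<alpha> u f" "approximating_sequence \<alpha> v g"
    using f g by (auto simp: extended_dom_def)
  then show "c = stable_form \<alpha> f g" using c lim LIMSEQ_unique by blast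
qed

lemma stable_dom_extended:
  assumes f: "f \<in> stable_dom \<alpha>"
  shows "f \<in> extended_dom \<alpha>"
proof -
  have "approximating_sequence \<alpha> (\<lambda>n. f) f"
    unfolding approximating_sequence_iff D.Cau_def using f by auto
  then show ?thesis using L2_measurable[OF stable_domD(2)[OF f]] by (auto simp: extended_dom_def)
qed

lemma subspace_extended_dom: "subspace (extended_dom \<alpha>)"
  unfolding subspace_def
proof (intro conjI ballI allI)
  show "0 \<in> extended_dom \<alpha>" by (rule stable_dom_extended[OF subspace_0[OF subspace_stable_dom]])
next
  fix f g :: "'a \<Rightarrow> real" assume "f \<in> extended_dom \<alpha>" "g \<in> extended_dom \<alpha>"
  then obtain u v where u: "approximating_sequence \<alpha> u f" and v: "approximating_sequence \<alpha> v g"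
    and fe: "f \<in> finite_energy \<alpha>" "g \<in> finite_energy \<alpha>" by (elim extended_domE)
  have "approximating_sequence \<alpha> (\<lambda>n. u n + v n) (f + g)"
    unfolding approximating_sequence_iff
  proof (intro conjI allI)
    have uv: "u n \<in> stable_dom \<alpha>" "v n \<in> stable_dom \<alpha>" for n
      using u v by (auto simp: approximating_sequence_def)
    then show "u n + v n \<in> stable_dom \<alpha>" for n by (intro subspace_add[OF subspace_stable_dom])
    show "D.Cau (\<lambda>n. u n + v n)" using u v uv by (intro D.Cau_add) (auto simp: approximating_sequence_iff stable_domD)
    have "AE x in lborel. (\<lambda>n. u n x) \<longlonglongrightarrow> f x" "AE x in lborel. (\<lambda>n. v n x) \<longlonglongrightarrow> g x"
      using u v by (simp_all add: approximating_sequence_def)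
    then show "AE x in lborel. (\<lambda>n. (u n + v n) x) \<longlonglongrightarrow> (f + g) x"
      by eventually_elim (auto intro: tendsto_add)
  qed
  then show "f + g \<in> extended_dom \<alpha>"
    using finite_energyD(1)[OF D.mem_add[OF fe]] by (auto simp: extended_dom_def)
next
  fix c and f :: "'a \<Rightarrow> real" assume "f \<in> extended_dom \<alpha>"
  then obtain u where u: "approximating_sequence \<alpha> u f" and fe: "f \<in> finite_energy \<alpha>" by (elim extended_domE)
  have "approximating_sequence \<alpha> (\<lambda>n. c *\<^sub>R u n) (c *\<^sub>R f)"
    unfolding approximating_sequence_iff
  proof (intro conjI allI)
    have uu: "u n \<in> stable_dom \<alpha>" for n using u by (auto simp: approximating_sequence_def)
    then show "c *\<^sub>R u n \<in> stable_dom \<alpha>" for n by (intro subspace_scale[OF subspace_stable_dom])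
    show "D.Cau (\<lambda>n. c *\<^sub>R u n)" using u uu by (intro D.Cau_scale) (auto simp: approximating_sequence_iff stable_domD)
    have "AE x in lborel. (\<lambda>n. u n x) \<longlonglongrightarrow> f x"
      using u by (simp add: approximating_sequence_def)
    then show "AE x in lborel. (\<lambda>n. (c *\<^sub>R u n) x) \<longlonglongrightarrow> (c *\<^sub>R f) x"
      by eventually_elim (auto intro: tendsto_mult)
  qed
  then show "c *\<^sub>R f \<in> extended_dom \<alpha>"
    using finite_energyD(1)[OF D.mem_scale[OF fe]] by (auto simp: extended_dom_def)
qed

section \<open>The Hardy inequality\<close>

text \<open>For points at distance at most \<rho> the jump density is bounded below, so plain
  squared increments are paid for by energy. Used for neighbouring shells and for pairs within one
  cube.\<close>

lemma increment_energy_on: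
  fixes f :: "'a::euclidean_space \<Rightarrow> real"
  assumes f: "f \<in> borel_measurable lborel"
    and [measurable]: "P \<in> sets borel" "Q \<in> sets borel"
    and \<rho>: "\<And>x y. x \<in> P \<Longrightarrow> y \<in> Q \<Longrightarrow> norm (x - y) \<le> \<rho>"
  shows "(\<integral>\<^sup>+z\<in>P \<times> Q. ennreal ((f (fst z) - f (snd z))\<^sup>2) \<partial>(lborel \<Otimes>\<^sub>M lborel)) \<le>
    ennreal (\<rho> powr (real DIM('a) + \<alpha>) / stable_const DIM('a) \<alpha>) *
      (\<integral>\<^sup>+z\<in>P \<times> Q. ennreal ((jump \<alpha> f z)\<^sup>2) \<partial>(lborel \<Otimes>\<^sub>M lborel))"
proof -
  let ?s = "real DIM('a) + \<alpha>" and ?c = "stable_const DIM('a) \<alpha>"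
  have c: "?c > 0" using \<alpha>_pos \<alpha>_less by (rule stable_const_pos)
  note [measurable] = f measurable_jump[OF f, of \<alpha>]
  have pt: "(f x - f y)\<^sup>2 \<le> \<rho> powr ?s / ?c * (jump \<alpha> f (x, y))\<^sup>2" if xy: "x \<in> P" "y \<in> Q" for x y
  proof (cases "x = y")
    case False
    let ?n = "norm (x - y) powr ?s"
    have n: "?n > 0" using False by simp
    have "?n \<le> \<rho> powr ?s" using \<rho>[OF xy] \<alpha>_pos by (intro powr_mono2) auto
    then have "1 \<le> \<rho> powr ?s / ?n" using n by simp
    then have "(f x - f y)\<^sup>2 * 1 \<le> (f x - f y)\<^sup>2 * (\<rho> powr ?s / ?n)" by (intro mult_left_mono) auto
    also have "\<dots> = \<rho> powr ?s / ?c * (jump \<alpha> f (x, y))\<^sup>2"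
      using c n by (simp add: jump_def power_mult_distrib)
    finally show ?thesis by simp
  qed (use c in simp)
  have "(\<integral>\<^sup>+z\<in>P \<times> Q. ennreal ((f (fst z) - f (snd z))\<^sup>2) \<partial>(lborel \<Otimes>\<^sub>M lborel)) \<le>
      (\<integral>\<^sup>+z. ennreal (\<rho> powr ?s / ?c) * (ennreal ((jump \<alpha> f z)\<^sup>2) * indicator (P \<times> Q) z) \<partial>(lborel \<Otimes>\<^sub>M lborel))"
    by (intro nn_integral_mono)
      (use pt c in \<open>auto simp: indicator_def ennreal_mult[symmetric] intro!: ennreal_leI\<close>)
  also have "\<dots> = ennreal (\<rho> powr ?s / ?c) *
      (\<integral>\<^sup>+z\<in>P \<times> Q. ennreal ((jump \<alpha> f z)\<^sup>2) \<partial>(lborel \<Otimes>\<^sub>M lborel))"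
    by (intro nn_integral_cmult) measurable
  finally show ?thesis .
qed

lemma sq_on_nn:
  fixes f :: "'a::euclidean_space \<Rightarrow> real"
  assumes "f \<in> L2 lborel" "P \<in> sets borel"
  shows "(\<integral>\<^sup>+x\<in>P. ennreal ((f x)\<^sup>2) \<partial>lborel) = ennreal (sq_on f P)"
proof -
  have "integrable lborel (\<lambda>x. indicator P x * (f x)\<^sup>2)"
    using integrable_mult_indicator[of P lborel "\<lambda>x. (f x)\<^sup>2"] assms L2_integrable_sq[of f lborel] by simp
  then have "(\<integral>\<^sup>+x. ennreal (indicator P x * (f x)\<^sup>2) \<partial>lborel) = ennreal (sq_on f P)"
    unfolding sq_on_def by (intro nn_integral_eq_integral) auto
  moreover have "ennreal (indicator P x * (f x)\<^sup>2) = ennreal ((f x)\<^sup>2) * indicator P x" for x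
    by (simp add: indicator_def)
  ultimately show ?thesis by simp
qed

lemma energy_on_integrable:
  fixes f :: "'a::euclidean_space \<Rightarrow> real"
  assumes "f \<in> finite_energy \<alpha>" "B \<in> sets (lborel \<Otimes>\<^sub>M lborel)"
  shows "integrable (lborel \<Otimes>\<^sub>M lborel) (\<lambda>z. indicator B z * (jump \<alpha> f z)\<^sup>2)"
  using integrable_mult_indicator[OF assms(2) L2_integrable_sq[OF finite_energyD(2)[OF assms(1)]]]
  by simp

lemma energy_on_nn:
  fixes f :: "'a::euclidean_space \<Rightarrow> real"
  assumes "f \<in> finite_energy \<alpha>" "B \<in> sets (lborel \<Otimes>\<^sub>M lborel)"
  shows "(\<integral>\<^sup>+z\<in>B. ennreal ((jump \<alpha> f z)\<^sup>2) \<partial>(lborel \<Otimes>\<^sub>M lborel)) = ennreal (energy_on \<alpha> f B)"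
proof -
  have "(\<integral>\<^sup>+z. ennreal (indicator B z * (jump \<alpha> f z)\<^sup>2) \<partial>(lborel \<Otimes>\<^sub>M lborel)) = ennreal (energy_on \<alpha> f B)"
    unfolding energy_on_def using energy_on_integrable[OF assms] by (intro nn_integral_eq_integral) auto
  moreover have "ennreal (indicator B z * (jump \<alpha> f z)\<^sup>2) = ennreal ((jump \<alpha> f z)\<^sup>2) * indicator B z" for z
    by (simp add: indicator_def)
  ultimately show ?thesis by simp
qed

lemma sum_energy_on_le:
  fixes f :: "'a::euclidean_space \<Rightarrow> real"
  assumes f: "f \<in> finite_energy \<alpha>" and I: "finite I"
    and B: "\<And>i. i \<in> I \<Longrightarrow> B i \<in> sets (lborel \<Otimes>\<^sub>M lborel)" and dis: "disjoint_family_on B I"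
  shows "(\<Sum>i\<in>I. energy_on \<alpha> f (B i)) \<le> 2 * stable_form \<alpha> f f"
proof -
  have "(\<Sum>i\<in>I. energy_on \<alpha> f (B i)) = (LINT z|(lborel \<Otimes>\<^sub>M lborel). (\<Sum>i\<in>I. indicator (B i) z * (jump \<alpha> f z)\<^sup>2))"
    unfolding energy_on_def using energy_on_integrable[OF f] B by (intro Bochner_Integration.integral_sum[symmetric]) auto
  also have "\<dots> \<le> (LINT z|(lborel \<Otimes>\<^sub>M lborel). (jump \<alpha> f z)\<^sup>2)"
  proof (rule integral_mono)
    fix z
    have "(\<Sum>i\<in>I. indicator (B i) z * (jump \<alpha> f z)\<^sup>2) = indicator (\<Union>i\<in>I. B i) z * (jump \<alpha> f z)\<^sup>2"
      unfolding indicator_UN_disjoint[OF I dis] by (simp add: sum_distrib_right)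
    also have "\<dots> \<le> (jump \<alpha> f z)\<^sup>2" by (simp add: indicator_def)
    finally show "(\<Sum>i\<in>I. indicator (B i) z * (jump \<alpha> f z)\<^sup>2) \<le> (jump \<alpha> f z)\<^sup>2" .
  qed (use f B energy_on_integrable[OF f] in \<open>auto intro!: Bochner_Integration.integrable_sum L2_integrable_sq finite_energyD\<close>)
  also have "\<dots> = 2 * stable_form \<alpha> f f"
    by (simp add: stable_form_eq L2_inner_self)
  finally show ?thesis .
qed

lemma ennreal_bilinear_sum:
  assumes "0 \<le> a" "0 \<le> b" "0 \<le> c" "0 \<le> d" "0 \<le> e" "0 \<le> g"
  shows "ennreal a * (ennreal b * ennreal c) + ennreal d * (ennreal e * ennreal g) =
    ennreal (a * (b * c) + d * (e * g))"
  using assms by (simp add: ennreal_mult ennreal_plus)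

text \<open>Integrate \<open>weighted_square_ineq\<close> with \<open>a = f x\<close> and
  \<open>b = f y\<close> over \<open>P \<times> Q\<close>. Each single-variable term picks up the
  volume of the other set, which is where the volume ratio of consecutive shells enters.\<close>

lemma sq_on_compare:
  fixes f :: "'a::euclidean_space \<Rightarrow> real"
  assumes f: "f \<in> stable_dom \<alpha>" and [measurable]: "P \<in> sets borel" "Q \<in> sets borel"
    and fin: "emeasure lborel P < \<infinity>" "emeasure lborel Q < \<infinity>"
    and \<rho>: "\<And>x y. x \<in> P \<Longrightarrow> y \<in> Q \<Longrightarrow> norm (x - y) \<le> \<rho>" and \<epsilon>: "0 < \<epsilon>"
  shows "sq_on f P * measure lborel Q \<le> (1 + \<epsilon>) * (measure lborel P * sq_on f Q) +
    (1 + 1 / \<epsilon>) * (\<rho> powr (real DIM('a) + \<alpha>) / stable_const DIM('a) \<alpha> * energy_on \<alpha> f (P \<times> Q))"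
proof -
  let ?k = "\<rho> powr (real DIM('a) + \<alpha>) / stable_const DIM('a) \<alpha>"
  let ?L = "lborel \<Otimes>\<^sub>M lborel :: ('a \<times> 'a) measure"
  have k: "0 \<le> ?k" using stable_const_pos[OF \<alpha>_pos \<alpha>_less, of "DIM('a)"] by simp
  have fe: "f \<in> finite_energy \<alpha>" and fL: "f \<in> L2 lborel"
    using f by (auto simp: stable_domD)
  have [measurable]: "f \<in> borel_measurable lborel" using fL by (rule L2_measurable)
  have PQ: "P \<times> Q \<in> sets ?L" by measurable
  have mP: "emeasure lborel P = ennreal (measure lborel P)" "emeasure lborel Q = ennreal (measure lborel Q)"
    using fin by (simp_all add: emeasure_eq_ennreal_measure less_top)
  have "ennreal (sq_on f P * measure lborel Q) = (\<integral>\<^sup>+z\<in>P \<times> Q. ennreal ((f (fst z))\<^sup>2) \<partial>?L)"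
    by (subst nn_integral_fst_Times) (auto simp: sq_on_nn[OF fL] mP ennreal_mult sq_on_nonneg)
  also have "\<dots> \<le> (\<integral>\<^sup>+z. ennreal (1 + \<epsilon>) * (ennreal ((f (snd z))\<^sup>2) * indicator (P \<times> Q) z) +
      ennreal (1 + 1 / \<epsilon>) * (ennreal ((f (fst z) - f (snd z))\<^sup>2) * indicator (P \<times> Q) z) \<partial>?L)"
    using \<epsilon> weighted_square_ineq[OF \<epsilon>]
    by (intro nn_integral_mono) (auto simp: indicator_def ennreal_mult[symmetric] ennreal_plus[symmetric]
        simp del: ennreal_plus intro!: ennreal_leI)
  also have "\<dots> = ennreal (1 + \<epsilon>) * (\<integral>\<^sup>+z\<in>P \<times> Q. ennreal ((f (snd z))\<^sup>2) \<partial>?L) +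
      ennreal (1 + 1 / \<epsilon>) * (\<integral>\<^sup>+z\<in>P \<times> Q. ennreal ((f (fst z) - f (snd z))\<^sup>2) \<partial>?L)"
    by (subst nn_integral_add) (auto simp: nn_integral_cmult)
  also have "\<dots> \<le> ennreal (1 + \<epsilon>) * (emeasure lborel P * ennreal (sq_on f Q)) +
      ennreal (1 + 1 / \<epsilon>) * (ennreal ?k * ennreal (energy_on \<alpha> f (P \<times> Q)))"
    using increment_energy_on[OF _ _ _ \<rho>, of f P Q]
    by (intro add_mono mult_left_mono)
      (auto simp: nn_integral_fst_Times(2)[of "\<lambda>x. ennreal ((f x)\<^sup>2)"] sq_on_nn[OF fL] energy_on_nn[OF fe PQ])
  also have "\<dots> = ennreal ((1 + \<epsilon>) * (measure lborel P * sq_on f Q) + (1 + 1 / \<epsilon>) * (?k * energy_on \<alpha> f (P \<times> Q)))"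
    unfolding mP(1) using \<epsilon> k by (intro ennreal_bilinear_sum) (auto simp: sq_on_nonneg energy_on_nonneg)
  finally have le: "ennreal (sq_on f P * measure lborel Q) \<le> \<dots>" .
  have "0 \<le> (1 + \<epsilon>) * (measure lborel P * sq_on f Q) + (1 + 1 / \<epsilon>) * (?k * energy_on \<alpha> f (P \<times> Q))"
    by (intro add_nonneg_nonneg mult_nonneg_nonneg sq_on_nonneg energy_on_nonneg k measure_nonneg)
      (use \<epsilon> in auto)
  from le[unfolded ennreal_le_iff[OF this]] show ?thesis .
qed

text \<open>With \<open>u = 2 powr \<alpha>\<close> and \<open>w = 2 ^ DIM('a)\<close>, the weighted mean squares
  \<open>b k = u\<^bsup>-k\<^esup> (\<integral>f\<^sup>2 on shell k)\<close> satisfy \<open>b k \<le> q b (k + 1) + (energy between the shells k and k + 1)\<close>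
  with \<open>q < 1\<close>, because \<open>\<alpha> < DIM('a)\<close> makes \<open>u < w\<close>.\<close>

lemma Hardy_shells:
  assumes dim: "\<alpha> < real DIM('a::euclidean_space)"
  obtains C where "0 \<le> C"
    "\<And>(f :: 'a \<Rightarrow> real) K. f \<in> stable_dom \<alpha> \<Longrightarrow>
      (\<Sum>k<K. (2 powr - \<alpha>) ^ k * sq_on f (shell k)) \<le> C * stable_form \<alpha> f f"
proof -
  define u where "u = 2 powr \<alpha>"
  define r where "r = 2 powr - \<alpha>"
  define w where "w = (2::real) ^ DIM('a)"
  define V where "V = unit_ball_vol (real DIM('a))"
  define c where "c = stable_const DIM('a) \<alpha>"
  have c: "0 < c" unfolding c_def by (rule stable_const_pos[OF \<alpha>_pos \<alpha>_less])
  have V: "0 < V" by (simp add: V_def)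
  have u1: "1 < u" using \<alpha>_pos by (simp add: u_def)
  have ri: "r = inverse u" by (simp add: u_def r_def powr_minus)
  have r: "0 < r" "r < 1" and ru: "r * u = 1"
    using u1 by (simp_all add: ri inverse_less_1_iff)
  have "u < 2 powr real DIM('a)" unfolding u_def using dim by (intro powr_less_mono) auto
  then have uw: "u < w" by (simp add: w_def powr_realpow)
  then have w1: "1 < w" using u1 by simp
  have powr_s: "(2 ^ n) powr (real DIM('a) + \<alpha>) = (w * u) ^ n" for n :: nat
  proof -
    have "(2 ^ n) powr (real DIM('a) + \<alpha>) = (2 powr (real DIM('a) + \<alpha>)) ^ n"
      by (simp add: powr_powr mult.commute flip: powr_realpow)
    also have "2 powr (real DIM('a) + \<alpha>) = w * u" by (simp add: powr_add u_def w_def powr_realpow)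
    finally show ?thesis .
  qed
  have mS: "measure lborel (shell (Suc j) :: 'a set) = V * (w - 1) * w ^ j" for j
    by (simp add: measure_shell_Suc V_def w_def)
  have m0: "measure lborel (shell 0 :: 'a set) = V" by (simp add: measure_shell_0 V_def)
  \<comment> \<open>Makes \<open>1 + \<epsilon>\<close> the mean of 1 and \<open>w / u\<close>, so
    that \<open>q\<close> is the mean of \<open>u / w\<close> and 1.\<close>
  define \<epsilon> where "\<epsilon> = (w / u - 1) / 2"
  have \<epsilon>: "0 < \<epsilon>" using uw u1 by (simp add: \<epsilon>_def)
  define q where "q = (1 + \<epsilon>) * u / w"
  have q: "0 \<le> q" "q < 1"
  proof -
    have "q = (u / w + 1) / 2" using u1 w1 by (simp add: q_def \<epsilon>_def field_simps)
    moreover have "0 < u / w" "u / w < 1" using uw u1 w1 by auto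
    ultimately show "0 \<le> q" "q < 1" by simp_all
  qed
  \<comment> \<open>Points of the shells \<open>k + 1\<close> and \<open>k + 2\<close> have distance
    at most \<open>2 ^ (k + 3)\<close>, which gives \<open>(w * u) ^ (k + 3)\<close>. Division by
    the volume \<open>V * (w - 1) * w ^ Suc k\<close> leaves
    \<open>w\<^sup>2 * u\<^sup>2 * u ^ Suc k\<close>, and the weight \<open>r ^ Suc k\<close>
    cancels the last power.\<close>
  define B where "B = (1 + 1 / \<epsilon>) * (w\<^sup>2 * u\<^sup>2 / (c * V * (w - 1)))"
  have B: "0 \<le> B" using \<epsilon> c V w1 by (simp add: B_def)
  define B0 where "B0 = 2 * (w * u)\<^sup>2 / (c * V * (w - 1))"
  have B0: "0 \<le> B0" using c V w1 u1 by (simp add: B0_def)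
  define A0 where "A0 = 2 / (w - 1) * u"
  have A0: "0 \<le> A0" using w1 u1 by (simp add: A0_def)
  define C where "C = 2 * ((A0 + 1) * (B / (1 - q)) + B0)"
  have main: "(\<Sum>k<K. r ^ k * sq_on f (shell k)) \<le> C * stable_form \<alpha> f f"
    if f: "f \<in> stable_dom \<alpha>" for f :: "'a \<Rightarrow> real" and K
  proof -
    let ?S = "shell :: nat \<Rightarrow> 'a set"
    have fe: "f \<in> finite_energy \<alpha>" and fL: "f \<in> L2 lborel"
      using f by (auto simp: stable_domD)
    define a where "a k = sq_on f (?S k)" for k
    define e where "e k = energy_on \<alpha> f (?S k \<times> ?S (Suc k))" for k
    define T where "T = 2 * stable_form \<alpha> f f"
    have a0: "0 \<le> a k" and e0: "0 \<le> e k" for k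
      by (simp_all add: a_def e_def sq_on_nonneg energy_on_nonneg)
    have dist: "norm (x - y) \<le> 2 ^ (k + 2)" if "x \<in> ?S k" "y \<in> ?S (Suc k)" for x y k
    proof -
      have "norm (x - y) \<le> 2 ^ k + 2 * 2 ^ k"
        using norm_triangle_ineq4[of x y] norm_shell[OF that(1)] norm_shell[OF that(2)] by simp
      also have "\<dots> \<le> 2 ^ (k + 2)" by simp
      finally show ?thesis .
    qed
    have sumI: "(\<Sum>k\<in>I. e k) \<le> T" if "finite I" for I
      unfolding e_def T_def
    proof (rule sum_energy_on_le[OF fe that])
      show "disjoint_family_on (\<lambda>k. ?S k \<times> ?S (Suc k)) I"
        unfolding disjoint_family_on_def
      proof (intro ballI impI)
        fix m n :: nat assume "m \<noteq> n"
        then have "?S m \<inter> ?S n = {}" by (rule shell_disjoint)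
        then show "?S m \<times> ?S (Suc m) \<inter> ?S n \<times> ?S (Suc n) = {}" by blast
      qed
    qed measurable
    have cmp: "a k * measure lborel (?S (Suc k)) \<le> (1 + \<delta>) * (measure lborel (?S k) * a (Suc k)) +
        (1 + 1 / \<delta>) * ((w * u) ^ (k + 2) / c * e k)" if "0 < \<delta>" for \<delta> k
      using sq_on_compare[OF f shell_borel shell_borel shell_finite shell_finite dist that]
      unfolding a_def e_def c_def powr_s .
    \<comment> \<open>Starts at shell 1, because the volume formula for shells fails for the central
      ball; that ball is compared with shell 1 separately.\<close>
    define b where "b k = r ^ Suc k * a (Suc k)" for k
    have "b k \<le> q * b (Suc k) + B * e (Suc k)" for k
    proof -
      let ?m = "V * (w - 1) * w ^ Suc k"
      have m: "0 < ?m" using V w1 by simp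
      have rk: "r ^ Suc k * u ^ Suc k = 1" using ru by (simp only: flip: power_mult_distrib) simp
      have "a (Suc k) * ?m \<le> (1 + \<epsilon>) * (V * (w - 1) * w ^ k * a (Suc (Suc k))) +
          (1 + 1 / \<epsilon>) * ((w * u) ^ (Suc k + 2) / c * e (Suc k))"
        using cmp[OF \<epsilon>, of "Suc k"] unfolding mS .
      then have "a (Suc k) \<le> ((1 + \<epsilon>) * (V * (w - 1) * w ^ k * a (Suc (Suc k))) +
          (1 + 1 / \<epsilon>) * ((w * u) ^ (Suc k + 2) / c * e (Suc k))) / ?m"
        using m by (simp only: pos_le_divide_eq)
      also have "\<dots> = (1 + \<epsilon>) / w * a (Suc (Suc k)) +
          (1 + 1 / \<epsilon>) * (w\<^sup>2 * u\<^sup>2 / (c * V * (w - 1))) * u ^ Suc k * e (Suc k)"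
      proof -
        have alg: "(x * (V * z * p * A) + y * (t * (w * p) / c * d)) / (V * z * (w * p)) =
            x / w * A + y * (t / (c * V * z)) * d"
          if "z \<noteq> 0" "p \<noteq> 0" for x z p A y t d :: real
          using that V w1 c by (simp add: field_simps)
        have pw: "(w * u) ^ (Suc k + 2) = (w\<^sup>2 * u\<^sup>2 * u ^ Suc k) * (w * w ^ k)"
          by (simp add: power_mult_distrib power2_eq_square)
        show ?thesis
          unfolding pw
          using alg[of "w - 1" "w ^ k" "1 + \<epsilon>" "a (Suc (Suc k))" "1 + 1 / \<epsilon>" "w\<^sup>2 * u\<^sup>2 * u ^ Suc k" "e (Suc k)"] w1
          by (simp add: mult.assoc)
      qed
      finally have "b k \<le> r ^ Suc k * ((1 + \<epsilon>) / w * a (Suc (Suc k)) + B * u ^ Suc k * e (Suc k))"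
        unfolding b_def B_def using r by (intro mult_left_mono) auto
      also have "\<dots> = (1 + \<epsilon>) / w * (r ^ Suc k * a (Suc (Suc k))) + B * (r ^ Suc k * u ^ Suc k) * e (Suc k)"
        by (simp add: algebra_simps)
      also have "r ^ Suc k * a (Suc (Suc k)) = u * b (Suc k)"
        using ru by (simp add: b_def algebra_simps)
      finally show ?thesis unfolding rk by (simp add: q_def algebra_simps)
    qed
    moreover have "0 \<le> b k" for k using a0 r by (simp add: b_def)
    moreover have "(\<Sum>k<K. e (Suc k)) \<le> T" for K
      using sumI[of "Suc ` {..<K}"] by (simp add: sum.reindex)
    \<comment> \<open>Here square integrability of \<open>f\<close> with respect to Lebesgue measure
      is used: the integrals over shells are bounded and \<open>r < 1\<close>. It enters only
      qualitatively, so the final constant does not depend on it.\<close>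
    moreover have "b \<longlonglongrightarrow> 0"
    proof (rule Lim_null_comparison)
      have "a k \<le> (LINT x|lborel. (f x)\<^sup>2)" for k
        unfolding a_def sq_on_def
        using integrable_mult_indicator[of "?S k" lborel "\<lambda>x. (f x)\<^sup>2"] L2_integrable_sq[OF fL]
        by (intro integral_mono) (auto simp: indicator_def)
      then show "\<forall>\<^sub>F k in sequentially. norm (b k) \<le> r ^ Suc k * (LINT x|lborel. (f x)\<^sup>2)"
        using a0 r unfolding b_def by (intro always_eventually allI) (simp add: mult_left_mono)
      have "(\<lambda>k. r ^ Suc k) \<longlonglongrightarrow> 0" using r by (intro LIMSEQ_Suc LIMSEQ_power_zero) auto
      then show "(\<lambda>k. r ^ Suc k * (LINT x|lborel. (f x)\<^sup>2)) \<longlonglongrightarrow> 0" by (rule tendsto_mult_left_zero)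
    qed
    ultimately have sumb: "(\<Sum>k<K. b k) \<le> B * T / (1 - q)" for K
      using q B by (intro geometric_recursion_bound[where e = "\<lambda>k. e (Suc k)"]) auto
    have T0: "0 \<le> T" using sumI[of "{}"] by simp
    have "a 0 \<le> A0 * b 0 + B0 * e 0"
    proof -
      have m: "0 < V * (w - 1)" using V w1 by simp
      have "a 0 * (V * (w - 1)) \<le> (1 + 1) * (V * a (Suc 0)) + (1 + 1 / 1) * ((w * u) ^ (0 + 2) / c * e 0)"
        using cmp[of 1 0] unfolding mS m0 by simp
      then have "a 0 \<le> ((1 + 1) * (V * a (Suc 0)) + (1 + 1 / 1) * ((w * u) ^ (0 + 2) / c * e 0)) / (V * (w - 1))"
        using m by (simp only: pos_le_divide_eq)
      also have "\<dots> = 2 / (w - 1) * a (Suc 0) + B0 * e 0"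
      proof -
        have "((1 + 1) * (V * x) + (1 + 1 / 1) * (y / c * d)) / (V * z) = 2 / z * x + 2 * y / (c * V * z) * d"
          if "z \<noteq> 0" for x y z d :: real
          using that V c by (simp add: field_simps)
        from this[of "w - 1"] show ?thesis using w1 by (simp add: B0_def power2_eq_square)
      qed
      also have "a (Suc 0) = u * b 0"
      proof -
        have "u * b 0 = (r * u) * a (Suc 0)" by (simp add: b_def)
        then show ?thesis by (simp add: ru)
      qed
      finally show ?thesis by (simp add: A0_def)
    qed
    moreover have "A0 * b 0 \<le> A0 * (B * T / (1 - q))"
      using sumb[of 1] A0 by (intro mult_left_mono) auto
    moreover have "B0 * e 0 \<le> B0 * T" using sumI[of "{0}"] B0 by (intro mult_left_mono) auto
    ultimately have a0': "a 0 \<le> A0 * (B * T / (1 - q)) + B0 * T" by linarith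
    have "(\<Sum>k<K. r ^ k * a k) \<le> (\<Sum>k<Suc K. r ^ k * a k)" using a0 r by simp
    also have "\<dots> = a 0 + (\<Sum>k<K. b k)" by (simp add: sum.lessThan_Suc_shift b_def del: sum.lessThan_Suc)
    also have "\<dots> \<le> C * stable_form \<alpha> f f"
    proof -
      define Z where "Z = B / (1 - q)"
      have Z: "B * T / (1 - q) = Z * T" by (simp add: Z_def)
      have CT: "C * stable_form \<alpha> f f = ((A0 + 1) * Z + B0) * T" by (simp add: C_def Z_def T_def)
      show ?thesis using a0' sumb[of K] unfolding Z CT by (simp add: algebra_simps)
    qed
    finally show ?thesis by (simp add: a_def)
  qed
  have "0 \<le> C" unfolding C_def using A0 B0 B q by auto
  then show thesis using main that[of C] unfolding r_def by blast
qed

text \<open>The shell sums dominate the weighted integral: for \<open>k > 0\<close> the inner radius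
  of shell \<open>k\<close> is \<open>2 ^ (k - 1)\<close>, so the weight there is at most
  \<open>u * r ^ k\<close>.\<close>

lemma Hardy:
  assumes dim: "\<alpha> < real DIM('a::euclidean_space)"
  obtains C where "0 \<le> C"
    "\<And>f :: 'a \<Rightarrow> real. f \<in> stable_dom \<alpha> \<Longrightarrow> f \<in> L2 (weighted_measure \<alpha>)"
    "\<And>f :: 'a \<Rightarrow> real. f \<in> stable_dom \<alpha> \<Longrightarrow> L2_inner (weighted_measure \<alpha>) f f \<le> C * stable_form \<alpha> f f"
proof -
  obtain C where C: "0 \<le> C" and sh: "\<And>(f :: 'a \<Rightarrow> real) K. f \<in> stable_dom \<alpha> \<Longrightarrow>
      (\<Sum>k<K. (2 powr - \<alpha>) ^ k * sq_on f (shell k)) \<le> C * stable_form \<alpha> f f"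
    using Hardy_shells[OF dim] by metis
  define u where "u = 2 powr \<alpha>"
  define r where "r = 2 powr - \<alpha>"
  have u1: "1 \<le> u" unfolding u_def using \<alpha>_pos by (intro ge_one_powr_ge_zero) auto
  have r: "0 \<le> r" by (simp add: r_def)
  have ru: "u * r = 1" by (simp add: u_def r_def powr_minus)
  have weight: "(1 + norm x) powr - \<alpha> \<le> u * r ^ k" if x: "x \<in> shell k" for x :: 'a and k
  proof (cases k)
    case 0
    have "(1 + norm x) powr - \<alpha> \<le> 1 powr - \<alpha>" using \<alpha>_pos by (intro powr_mono2') auto
    then show ?thesis using 0 u1 by simp
  next
    case (Suc j)
    have "(1 + norm x) powr - \<alpha> \<le> (2 ^ j) powr - \<alpha>"
      using norm_shell_Suc[of x j] x Suc \<alpha>_pos by (intro powr_mono2') auto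
    also have "\<dots> = r ^ j" by (simp add: r_def powr_powr mult.commute flip: powr_realpow)
    also have "\<dots> = u * r ^ k" using ru Suc by (simp flip: mult.assoc)
    finally show ?thesis .
  qed
  have main: "(\<integral>\<^sup>+x. ennreal ((f x)\<^sup>2) \<partial>weighted_measure \<alpha>) \<le> ennreal (u * C * stable_form \<alpha> f f)"
    if f: "f \<in> stable_dom \<alpha>" for f :: "'a \<Rightarrow> real"
  proof -
    have fL: "f \<in> L2 lborel" using f by (rule stable_domD)
    have [measurable]: "f \<in> borel_measurable borel" using L2_measurable[OF fL] by simp
    have "(\<integral>\<^sup>+x. ennreal ((f x)\<^sup>2) \<partial>weighted_measure \<alpha>) =
        (\<integral>\<^sup>+x. ennreal ((1 + norm x) powr - \<alpha>) * ennreal ((f x)\<^sup>2) \<partial>lborel)"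
      by (rule nn_integral_weighted_measure) measurable
    also have "\<dots> \<le> (\<integral>\<^sup>+x. (\<Sum>k. ennreal (u * r ^ k) * (ennreal ((f x)\<^sup>2) * indicator (shell k) x)) \<partial>lborel)"
    proof (rule nn_integral_mono)
      fix x :: 'a
      obtain k where k: "x \<in> shell k" using shell_cover by blast
      let ?g = "\<lambda>k. ennreal (u * r ^ k) * (ennreal ((f x)\<^sup>2) * indicator (shell k) x)"
      have "ennreal ((1 + norm x) powr - \<alpha>) * ennreal ((f x)\<^sup>2) \<le> ?g k"
        using weight[OF k] k by (auto intro!: mult_right_mono ennreal_leI)
      also have "\<dots> \<le> suminf ?g" using sum_le_suminf[of ?g "{k}"] by (simp add: summableI)
      finally show "ennreal ((1 + norm x) powr - \<alpha>) * ennreal ((f x)\<^sup>2) \<le> suminf ?g" .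
    qed
    also have "\<dots> = (\<Sum>k. ennreal (u * r ^ k) * (\<integral>\<^sup>+x\<in>shell k. ennreal ((f x)\<^sup>2) \<partial>lborel))"
      by (simp add: nn_integral_suminf nn_integral_cmult)
    also have "\<dots> = (\<Sum>k. ennreal (u * (r ^ k * sq_on f (shell k))))"
      using u1 r by (intro suminf_cong)
        (simp add: sq_on_nn[OF fL] ennreal_mult sq_on_nonneg mult.assoc)
    also have "\<dots> \<le> ennreal (u * C * stable_form \<alpha> f f)"
    proof (rule suminf_le_const[OF summableI])
      fix K
      have "(\<Sum>k<K. ennreal (u * (r ^ k * sq_on f (shell k)))) = ennreal (\<Sum>k<K. u * (r ^ k * sq_on f (shell k)))"
        using u1 r by (intro sum_ennreal) (simp add: sq_on_nonneg)
      also have "(\<Sum>k<K. u * (r ^ k * sq_on f (shell k))) = u * (\<Sum>k<K. r ^ k * sq_on f (shell k))"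
        by (simp add: sum_distrib_left)
      also have "ennreal \<dots> \<le> ennreal (u * C * stable_form \<alpha> f f)"
        using sh[OF f, of K] u1 by (intro ennreal_leI) (simp add: r_def mult.assoc mult_left_mono)
      finally show "(\<Sum>k<K. ennreal (u * (r ^ k * sq_on f (shell k)))) \<le> ennreal (u * C * stable_form \<alpha> f f)" .
    qed
    finally show ?thesis .
  qed
  have nn: "0 \<le> u * C * stable_form \<alpha> f f" if "f \<in> stable_dom \<alpha>" for f :: "'a \<Rightarrow> real"
    using u1 C D.ip_nonneg[OF stable_domD(1)[OF that]] by simp
  have meas: "f \<in> borel_measurable (weighted_measure \<alpha>)" if "f \<in> stable_dom \<alpha>" for f :: "'a \<Rightarrow> real"
    using L2_measurable[OF stable_domD(2)[OF that]] by (simp cong: measurable_cong_sets)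
  show thesis
    by (rule that[of "u * C"])
      (use u1 C L2_if_nn_integral_finite[OF meas main nn] in auto)
qed

text \<open>By the inequality itself, approximating sequences are Cauchy in the weighted space;
  their pointwise limit is then the weighted limit, and both sides pass to the limit.\<close>

lemma Hardy_extended:
  assumes dim: "\<alpha> < real DIM('a::euclidean_space)"
  obtains C where "0 \<le> C"
    "\<And>f :: 'a \<Rightarrow> real. f \<in> extended_dom \<alpha> \<Longrightarrow> f \<in> L2 (weighted_measure \<alpha>)"
    "\<And>f :: 'a \<Rightarrow> real. f \<in> extended_dom \<alpha> \<Longrightarrow> L2_inner (weighted_measure \<alpha>) f f \<le> C * stable_form \<alpha> f f"
proof -
  let ?M = "weighted_measure \<alpha> :: 'a measure"
  obtain C where C: "0 \<le> C"
    and CL: "\<And>f :: 'a \<Rightarrow> real. f \<in> stable_dom \<alpha> \<Longrightarrow> f \<in> L2 ?M"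
    and CH: "\<And>f :: 'a \<Rightarrow> real. f \<in> stable_dom \<alpha> \<Longrightarrow> L2_inner ?M f f \<le> C * stable_form \<alpha> f f"
    using Hardy[OF dim] by metis
  have "f \<in> L2 ?M \<and> L2_inner ?M f f \<le> C * stable_form \<alpha> f f" if f: "f \<in> extended_dom \<alpha>" for f :: "'a \<Rightarrow> real"
  proof -
    obtain u where u: "approximating_sequence \<alpha> u f" and fe: "f \<in> finite_energy \<alpha>" and c: "D.conv u f"
      using extended_domE[OF f] by metis
    have us: "\<And>n. u n \<in> stable_dom \<alpha>" and ae: "AE x in lborel. (\<lambda>n. u n x) \<longlonglongrightarrow> f x" and DC: "D.Cau u"
      using u by (auto simp: approximating_sequence_iff)
    have uL: "u n \<in> L2 ?M" for n using us by (rule CL)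
    have "L2.Cau ?M u"
    proof (rule L2.CauI_dominated[OF _ _ DC[unfolded D.Cau_def]])
      fix m n
      have "u m - u n \<in> stable_dom \<alpha>" by (intro subspace_diff[OF subspace_stable_dom] us)
      then show "L2.nrm ?M (u m - u n) \<le> sqrt C * D.nrm (u m - u n)"
        unfolding L2.nrm_def D.nrm_def by (simp add: CH flip: real_sqrt_mult)
    qed (use C in simp)
    moreover have "f \<in> borel_measurable ?M"
      using finite_energyD(1)[OF fe] by (simp cong: measurable_cong_sets)
    moreover have "AE x in ?M. (\<lambda>n. u n x) \<longlonglongrightarrow> f x" using ae by (simp add: AE_weighted_measure)
    ultimately have fL: "f \<in> L2 ?M" and cL: "L2.conv ?M u f" using L2_AE_limit[OF uL] by auto
    have "(\<lambda>n. L2_inner ?M (u n) (u n)) \<longlonglongrightarrow> L2_inner ?M f f" using uL fL cL by (intro L2.conv_ip)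
    moreover have "(\<lambda>n. C * stable_form \<alpha> (u n) (u n)) \<longlonglongrightarrow> C * stable_form \<alpha> f f"
      using fe c us by (intro tendsto_intros D.conv_ip) (auto intro: stable_domD)
    ultimately have "L2_inner ?M f f \<le> C * stable_form \<alpha> f f"
      by (rule LIMSEQ_le) (use CH us in auto)
    then show ?thesis using fL by simp
  qed
  then show thesis using that[OF C] by blast
qed

lemma extended_dom_finite_energy: "f \<in> extended_dom \<alpha> \<Longrightarrow> f \<in> finite_energy \<alpha>"
  by (elim extended_domE)

lemma extended_dom_approx:
  assumes f: "f \<in> extended_dom \<alpha>" and e: "0 < e"
  obtains w where "w \<in> stable_dom \<alpha>" "D.nrm (w - f) < e"
proof -
  obtain u where u: "approximating_sequence \<alpha> u f" and c: "D.conv u f"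
    using extended_domE[OF f] by metis
  have "\<forall>\<^sub>F n in sequentially. D.nrm (u n - f) < e"
    using c e unfolding D.conv_def by (intro order_tendstoD) auto
  then obtain n where "D.nrm (u n - f) < e" by (auto simp: eventually_sequentially)
  then show thesis using u that[of "u n"] by (auto simp: approximating_sequence_def)
qed

section \<open>Closedness of the time-changed form\<close>

lemma subspace_time_changed_dom: "subspace (time_changed_dom \<alpha> \<beta>)"
  unfolding time_changed_dom_def
  by (intro subspace_inter subspace_extended_dom subspace_L2)

lemma semi_inner_extended_form: "semi_inner (time_changed_dom \<alpha> \<beta> :: ('a::euclidean_space \<Rightarrow> real) set) (extended_form \<alpha>)"
proof -
  have fe: "f \<in> finite_energy \<alpha>" and eq: "g \<in> time_changed_dom \<alpha> \<beta> \<Longrightarrow> extended_form \<alpha> f g = stable_form \<alpha> f g"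
    if "f \<in> time_changed_dom \<alpha> \<beta>" for f g :: "'a \<Rightarrow> real"
    using that extended_form_eq extended_dom_finite_energy
    by (auto simp: time_changed_dom_def)
  note sub = subspace_time_changed_dom[of \<beta>, where 'a = 'a]
  show ?thesis
  proof
    fix f g h :: "'a \<Rightarrow> real" and c :: real
    assume fgh: "f \<in> time_changed_dom \<alpha> \<beta>" "g \<in> time_changed_dom \<alpha> \<beta>" "h \<in> time_changed_dom \<alpha> \<beta>"
    show "extended_form \<alpha> (f + g) h = extended_form \<alpha> f h + extended_form \<alpha> g h"
      using fgh fe subspace_add[OF sub] by (simp add: eq D.ip_simps)
    show "extended_form \<alpha> (c *\<^sub>R f) h = c * extended_form \<alpha> f h"
      using fgh fe subspace_scale[OF sub] by (simp add: eq D.ip_simps)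
    show "extended_form \<alpha> f g = extended_form \<alpha> g f" using fgh fe by (simp add: eq D.ip_commute)
    show "0 \<le> extended_form \<alpha> f f" using fgh fe by (simp add: eq D.ip_nonneg)
  qed (rule sub)
qed

lemma nrm_extended_form:
  assumes "f \<in> time_changed_dom \<alpha> \<beta>"
  shows "semi_inner.nrm (extended_form \<alpha>) f = D.nrm f"
  using assms extended_form_eq[of f f]
  by (simp add: semi_inner.nrm_def[OF semi_inner_extended_form] D.nrm_def time_changed_dom_def)

text \<open>By the Hardy inequality, energy convergence implies convergence almost everywhere along a
  subsequence, so that a diagonal sequence in \<open>stable_dom\<close> approximates the limit.\<close>

lemma closed_extended_form:
  assumes dim: "\<alpha> < real DIM('a::euclidean_space)"
    and u: "\<And>n. u n \<in> time_changed_dom \<alpha> \<beta>" and x: "x \<in> L2 (weighted_measure \<beta>)"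
    and cu: "L2.conv (weighted_measure \<beta>) u x" and C: "D.Cau u"
  shows "(x :: 'a \<Rightarrow> real) \<in> time_changed_dom \<alpha> \<beta>" "D.conv u x"
proof -
  let ?M = "weighted_measure \<alpha> :: 'a measure" and ?N = "weighted_measure \<beta> :: 'a measure"
  obtain K where K: "0 \<le> K"
    and KL: "\<And>f :: 'a \<Rightarrow> real. f \<in> extended_dom \<alpha> \<Longrightarrow> f \<in> L2 ?M"
    and KH: "\<And>f :: 'a \<Rightarrow> real. f \<in> extended_dom \<alpha> \<Longrightarrow> L2_inner ?M f f \<le> K * stable_form \<alpha> f f"
    using Hardy_extended[OF dim] by metis
  have Kn: "L2.nrm ?M f \<le> sqrt K * D.nrm f" if "f \<in> extended_dom \<alpha>" for f :: "'a \<Rightarrow> real"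
    unfolding L2.nrm_def D.nrm_def by (simp add: KH that flip: real_sqrt_mult)
  have ue: "u n \<in> extended_dom \<alpha>" and uN: "u n \<in> L2 ?N" for n using u[of n] by (auto simp: time_changed_dom_def)
  have uf: "u n \<in> finite_energy \<alpha>" for n by (rule extended_dom_finite_energy[OF ue])
  have sub: "subspace (extended_dom \<alpha> :: ('a \<Rightarrow> real) set)" by (rule subspace_extended_dom)
  \<comment> \<open>Membership in the extended space requires approximants from
    \<open>stable_dom\<close>; each \<open>u n\<close> is therefore replaced by one at energy
    distance below \<open>1 / (n + 1)\<close>.\<close>
  have "\<exists>w. w \<in> stable_dom \<alpha> \<and> D.nrm (w - u n) < inverse (real (Suc n))" for n
    using extended_dom_approx[OF ue[of n], of "inverse (real (Suc n))"] by (metis inverse_positive_iff_positive of_nat_0_less_iff zero_less_Suc)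
  then obtain w where ws: "\<And>n. w n \<in> stable_dom \<alpha>" and wu: "\<And>n. D.nrm (w n - u n) < inverse (real (Suc n))"
    by metis
  have we: "w n \<in> extended_dom \<alpha>" and wf: "w n \<in> finite_energy \<alpha>" for n
    using ws[of n] by (auto intro: stable_dom_extended stable_domD)
  define z where "z n = w n - u n" for n
  have ze: "z n \<in> extended_dom \<alpha>" for n unfolding z_def by (intro subspace_diff[OF sub] we ue)
  have zf: "z n \<in> finite_energy \<alpha>" for n by (rule extended_dom_finite_energy[OF ze])
  have z0: "(\<lambda>n. D.nrm (z n)) \<longlonglongrightarrow> 0"
  proof (rule Lim_null_comparison[OF _ LIMSEQ_inverse_real_of_nat])
    show "\<forall>\<^sub>F n in sequentially. norm (D.nrm (z n)) \<le> inverse (real (Suc n))"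
      using wu D.nrm_nonneg[OF zf] unfolding z_def
      by (intro always_eventually allI) (simp add: less_imp_le del: of_nat_Suc)
  qed
  have wuz: "w = (\<lambda>n. u n + z n)" by (simp add: z_def)
  have "D.Cau z"
    by (rule D.conv_imp_Cau[of z 0]) (use zf z0 in \<open>auto simp: D.conv_def\<close>)
  then have Cw: "D.Cau w" unfolding wuz by (intro D.Cau_add uf zf C)
  have uM: "u n \<in> L2 ?M" and zM: "z n \<in> L2 ?M" for n using ue ze by (auto intro: KL)
  have "L2.Cau ?M u"
    by (rule L2.CauI_dominated[OF _ Kn C[unfolded D.Cau_def]]) (use K subspace_diff[OF sub ue ue] in auto)
  from L2.complete[OF uM this] obtain h where h: "h \<in> L2 ?M" and ch: "L2.conv ?M u h" by blast
  \<comment> \<open>Two limits are present: \<open>h\<close> for the weight exponent \<alpha>, from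
    the Hardy inequality, and \<open>x\<close> for \<beta>. A common subsequence converging almost
    everywhere to both identifies them.\<close>
  obtain r where r: "strict_mono r" and rh: "AE t in ?M. (\<lambda>n. u (r n) t) \<longlonglongrightarrow> h t"
    by (rule L2_AE_subseq[OF uM h ch])
  obtain s where s: "strict_mono s" and sx: "AE t in ?N. (\<lambda>n. u (r (s n)) t) \<longlonglongrightarrow> x t"
    by (rule L2_AE_subseq[where f = "\<lambda>n. u (r n)", OF uN x L2.conv_subseq[OF cu r]])
  have "AE t in lborel. x t = h t"
    using rh[unfolded AE_weighted_measure] sx[unfolded AE_weighted_measure]
  proof eventually_elim
    case (elim t)
    then show ?case using LIMSEQ_subseq_LIMSEQ[OF elim(1) s] LIMSEQ_unique by (auto simp: o_def)
  qed
  moreover have xm: "x \<in> borel_measurable lborel" using L2_measurable[OF x] by (simp cong: measurable_cong_sets)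
  ultimately have xM: "x \<in> L2 ?M" and xh: "L2.nrm ?M (h - x) = 0"
    using L2_AE_cong[OF h, of x] by (simp_all add: AE_weighted_measure cong: measurable_cong_sets)
  have "L2.conv ?M u x" by (rule L2_conv_cong[OF uM h xM xh ch])
  have "L2.conv ?M w x"
    unfolding L2.conv_def
  proof (rule Lim_null_comparison)
    show "\<forall>\<^sub>F n in sequentially. norm (L2.nrm ?M (w n - x)) \<le> L2.nrm ?M (u n - x) + sqrt K * D.nrm (z n)"
    proof (intro always_eventually allI)
      fix n
      have eq: "w n - x = (u n - x) + z n" by (simp add: z_def)
      have "L2.nrm ?M (w n - x) \<le> L2.nrm ?M (u n - x) + L2.nrm ?M (z n)"
        unfolding eq by (rule L2.nrm_triangle[OF L2.mem_diff[OF uM xM] zM])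
      then show "norm (L2.nrm ?M (w n - x)) \<le> L2.nrm ?M (u n - x) + sqrt K * D.nrm (z n)"
        using Kn[OF ze[of n]] L2.nrm_nonneg[OF L2.mem_diff[OF KL[OF we] xM], of n] by simp
    qed
    have "(\<lambda>n. L2.nrm ?M (u n - x) + sqrt K * D.nrm (z n)) \<longlonglongrightarrow> 0 + sqrt K * 0"
      using \<open>L2.conv ?M u x\<close> z0 unfolding L2.conv_def by (intro tendsto_intros)
    then show "(\<lambda>n. L2.nrm ?M (u n - x) + sqrt K * D.nrm (z n)) \<longlonglongrightarrow> 0" by simp
  qed
  from L2_AE_subseq[where f = w, OF KL[OF we] xM this]
  obtain p where p: "strict_mono p" and px: "AE t in ?M. (\<lambda>n. w (p n) t) \<longlonglongrightarrow> x t" .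
  have "D.Cau (\<lambda>n. w (p n))"
    unfolding D.Cau_def
  proof (intro allI impI)
    fix e :: real assume "e > 0"
    then obtain N where "\<forall>m\<ge>N. \<forall>n\<ge>N. D.nrm (w m - w n) < e" using Cw unfolding D.Cau_def by blast
    then show "\<exists>N. \<forall>m\<ge>N. \<forall>n\<ge>N. D.nrm (w (p m) - w (p n)) < e"
      using seq_suble[OF p] by (meson order_trans)
  qed
  then have "approximating_sequence \<alpha> (\<lambda>n. w (p n)) x"
    using ws px unfolding approximating_sequence_iff AE_weighted_measure by blast
  then have xe: "x \<in> extended_dom \<alpha>" using xm by (auto simp: extended_dom_def)
  then show "x \<in> time_changed_dom \<alpha> \<beta>" using x by (simp add: time_changed_dom_def)
  have xf: "x \<in> finite_energy \<alpha>" by (rule extended_dom_finite_energy[OF xe])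
  have "D.conv (\<lambda>n. w (p n)) x"
    using \<open>approximating_sequence \<alpha> (\<lambda>n. w (p n)) x\<close> xm by (rule approximating_sequence_conv)
  then have cw: "D.conv w x" by (rule D.Cau_conv_subseq[OF wf xf Cw p])
  show "D.conv u x"
    unfolding D.conv_def
  proof (rule Lim_null_comparison)
    show "\<forall>\<^sub>F n in sequentially. norm (D.nrm (u n - x)) \<le> D.nrm (w n - x) + D.nrm (z n)"
    proof (intro always_eventually allI)
      fix n
      have eq: "u n - x = (w n - x) - z n" by (simp add: z_def)
      have "D.nrm (u n - x) \<le> D.nrm (w n - x) + D.nrm (z n)"
        unfolding eq by (rule D.nrm_triangle_diff[OF D.mem_diff[OF wf xf] zf])
      then show "norm (D.nrm (u n - x)) \<le> D.nrm (w n - x) + D.nrm (z n)"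
        using D.nrm_nonneg[OF D.mem_diff[OF uf xf], of n] by simp
    qed
    have "(\<lambda>n. D.nrm (w n - x) + D.nrm (z n)) \<longlonglongrightarrow> 0 + 0"
      using cw z0 unfolding D.conv_def by (intro tendsto_intros)
    then show "(\<lambda>n. D.nrm (w n - x) + D.nrm (z n)) \<longlonglongrightarrow> 0" by simp
  qed
qed

lemma closed_form_extended_form:
  assumes dim: "\<alpha> < real DIM('a::euclidean_space)"
  shows "closed_form (L2 (weighted_measure \<beta>)) (L2_inner (weighted_measure \<beta>))
    (time_changed_dom \<alpha> \<beta> :: ('a \<Rightarrow> real) set) (extended_form \<alpha>)"
proof -
  interpret E: semi_inner "time_changed_dom \<alpha> \<beta> :: ('a \<Rightarrow> real) set" "extended_form \<alpha>"
    by (rule semi_inner_extended_form)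
  show ?thesis
  proof
    show "time_changed_dom \<alpha> \<beta> \<subseteq> L2 (weighted_measure \<beta>)" by (auto simp: time_changed_dom_def)
    fix u :: "nat \<Rightarrow> 'a \<Rightarrow> real" and x
    assume u: "\<And>n. u n \<in> time_changed_dom \<alpha> \<beta>" and x: "x \<in> L2 (weighted_measure \<beta>)"
      and c: "L2.conv (weighted_measure \<beta>) u x" and C: "E.Cau u"
    have "D.Cau u" using C u unfolding D.Cau_def E.Cau_def by (simp add: nrm_extended_form[of _ \<beta>])
    note closed = closed_extended_form[OF dim u x c this]
    then show "x \<in> time_changed_dom \<alpha> \<beta> \<and> E.conv u x"
      using u unfolding D.conv_def E.conv_def by (simp add: nrm_extended_form[of _ \<beta>])
  qed
qed

section \<open>Compact embedding of the form domain\<close>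

text \<open>The variance identity with the energy bound for points at distance at most
  \<open>DIM('a) * h\<close>. Dividing \<open>h powr (d + \<alpha>)\<close> by the volume
  \<open>h ^ d\<close> leaves \<open>h powr \<alpha>\<close>, which is small for fine cubes.\<close>

lemma cell_Poincare:
  fixes f :: "'a::euclidean_space \<Rightarrow> real"
  assumes fe: "f \<in> finite_energy \<alpha>" and h: "0 < h"
    and int: "integrable lborel (\<lambda>x. indicator (cell h p) x * (f x)\<^sup>2)"
  shows "sq_on f (cell h p) \<le> (int_on f (cell h p))\<^sup>2 / h ^ DIM('a) +
    (real DIM('a) powr (real DIM('a) + \<alpha>) * h powr \<alpha> / (2 * stable_const DIM('a) \<alpha>)) *
      energy_on \<alpha> f (cell h p \<times> cell h p)"
proof -
  let ?Q = "cell h p :: 'a set" and ?d = "real DIM('a)" and ?c = "stable_const DIM('a) \<alpha>"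
  have c: "0 < ?c" by (rule stable_const_pos[OF \<alpha>_pos \<alpha>_less])
  have fm: "f \<in> borel_measurable lborel" using fe by (rule finite_energyD)
  have fin: "emeasure lborel ?Q < \<infinity>" using emeasure_cell[OF h, of p] by simp
  have v: "measure lborel ?Q = h ^ DIM('a)" using emeasure_cell[OF h, of p] h by (simp add: measure_def)
  have QQ: "?Q \<times> ?Q \<in> sets (lborel \<Otimes>\<^sub>M lborel)" by measurable
  have "ennreal (2 * (h ^ DIM('a) * sq_on f ?Q - (int_on f ?Q)\<^sup>2)) \<le>
      ennreal ((?d * h) powr (?d + \<alpha>) / ?c) * ennreal (energy_on \<alpha> f (?Q \<times> ?Q))"
    using increment_energy_on[where f = f and P = ?Q and Q = ?Q and \<rho> = "?d * h",
        OF fm cell_borel cell_borel cell_diameter[OF h]]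
    unfolding increments_within(1)[OF fm cell_borel fin int] v energy_on_nn[OF fe QQ] .
  also have "\<dots> = ennreal ((?d * h) powr (?d + \<alpha>) / ?c * energy_on \<alpha> f (?Q \<times> ?Q))"
    using c by (intro ennreal_mult[symmetric] energy_on_nonneg) simp
  finally have "2 * (h ^ DIM('a) * sq_on f ?Q - (int_on f ?Q)\<^sup>2) \<le>
      (?d * h) powr (?d + \<alpha>) / ?c * energy_on \<alpha> f (?Q \<times> ?Q)"
    using c energy_on_nonneg[of \<alpha> f "?Q \<times> ?Q"] by (subst (asm) ennreal_le_iff) auto
  moreover have "(?d * h) powr (?d + \<alpha>) = ?d powr (?d + \<alpha>) * (h ^ DIM('a) * h powr \<alpha>)"
    using h by (simp add: powr_mult powr_add powr_realpow)
  ultimately have "2 * (h ^ DIM('a) * sq_on f ?Q - (int_on f ?Q)\<^sup>2) \<le>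
      ?d powr (?d + \<alpha>) * (h ^ DIM('a) * h powr \<alpha>) / ?c * energy_on \<alpha> f (?Q \<times> ?Q)" by simp
  moreover have "s \<le> I / H + (A * t / (2 * c)) * e" if "2 * (H * s - I) \<le> A * (H * t) / c * e" "0 < H" "0 < c"
    for s I H A t c e :: real
    using that by (simp add: field_simps)
  ultimately show ?thesis using h c by simp
qed

text \<open>Outside the ball the weight with exponent \<beta> is
  \<open>(1 + norm x) powr (\<alpha> - \<beta>)\<close> times the Hardy weight, and
  \<open>\<alpha> < \<beta>\<close> makes this factor decreasing in the radius. Inside, the weight
  is at most 1.\<close>

lemma weighted_tail:
  fixes f :: "'a::euclidean_space \<Rightarrow> real"
  assumes \<beta>: "\<alpha> < \<beta>" and f: "f \<in> L2 (weighted_measure \<beta>)" "f \<in> L2 (weighted_measure \<alpha>)" and R: "0 \<le> R"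
  shows "L2_inner (weighted_measure \<beta>) f f \<le> sq_on f (ball 0 R) +
    (1 + R) powr (\<alpha> - \<beta>) * L2_inner (weighted_measure \<alpha>) f f"
proof -
  have [measurable]: "f \<in> borel_measurable borel" using L2_measurable[OF f(1)] by (simp cong: measurable_cong_sets)
  have b0: "0 \<le> \<beta>" using \<alpha>_pos \<beta> by simp
  have pt: "(1 + norm x) powr - \<beta> * (f x)\<^sup>2 \<le> indicator (ball 0 R) x * (f x)\<^sup>2 +
      (1 + R) powr (\<alpha> - \<beta>) * ((1 + norm x) powr - \<alpha> * (f x)\<^sup>2)" for x
  proof (cases "x \<in> ball 0 R")
    case True
    have "(1 + norm x) powr - \<beta> * (f x)\<^sup>2 \<le> 1 * (f x)\<^sup>2"
      by (intro mult_right_mono weight_le_1 b0) simp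
    then show ?thesis using True by (simp add: add_increasing2)
  next
    case False
    then have x: "R \<le> norm x" by simp
    have "(1 + norm x) powr - \<beta> = (1 + norm x) powr (\<alpha> - \<beta>) * (1 + norm x) powr - \<alpha>"
      by (simp flip: powr_add)
    also have "\<dots> \<le> (1 + R) powr (\<alpha> - \<beta>) * (1 + norm x) powr - \<alpha>"
      using x R \<beta> by (intro mult_right_mono powr_mono2') auto
    finally have "(1 + norm x) powr - \<beta> * (f x)\<^sup>2 \<le> ((1 + R) powr (\<alpha> - \<beta>) * (1 + norm x) powr - \<alpha>) * (f x)\<^sup>2"
      by (rule mult_right_mono) simp
    then show ?thesis using False by (simp add: mult.assoc)
  qed
  have nn: "0 \<le> sq_on f (ball 0 R)" "0 \<le> L2_inner (weighted_measure \<alpha>) f f"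
    using sq_on_nonneg L2.ip_nonneg[OF f(2)] by auto
  have "ennreal (L2_inner (weighted_measure \<beta>) f f) =
      (\<integral>\<^sup>+x. ennreal ((1 + norm x) powr - \<beta> * (f x)\<^sup>2) \<partial>lborel)"
    unfolding L2_inner_self_nn[OF f(1)] by (subst nn_integral_weighted_measure) (auto simp: ennreal_mult)
  also have "\<dots> \<le> (\<integral>\<^sup>+x. ennreal ((f x)\<^sup>2) * indicator (ball 0 R) x +
      ennreal ((1 + R) powr (\<alpha> - \<beta>)) * (ennreal ((1 + norm x) powr - \<alpha>) * ennreal ((f x)\<^sup>2)) \<partial>lborel)"
  proof (rule nn_integral_mono)
    fix x :: 'a
    have "ennreal ((1 + norm x) powr - \<beta> * (f x)\<^sup>2) \<le> ennreal (indicator (ball 0 R) x * (f x)\<^sup>2 +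
        (1 + R) powr (\<alpha> - \<beta>) * ((1 + norm x) powr - \<alpha> * (f x)\<^sup>2))" using pt by (rule ennreal_leI)
    also have "\<dots> = ennreal ((f x)\<^sup>2) * indicator (ball 0 R) x +
      ennreal ((1 + R) powr (\<alpha> - \<beta>)) * (ennreal ((1 + norm x) powr - \<alpha>) * ennreal ((f x)\<^sup>2))"
      by (simp add: ennreal_plus ennreal_mult indicator_def)
    finally show "ennreal ((1 + norm x) powr - \<beta> * (f x)\<^sup>2) \<le> \<dots>" .
  qed
  also have "\<dots> = (\<integral>\<^sup>+x\<in>ball 0 R. ennreal ((f x)\<^sup>2) \<partial>lborel) +
      ennreal ((1 + R) powr (\<alpha> - \<beta>)) * (\<integral>\<^sup>+x. ennreal ((f x)\<^sup>2) \<partial>weighted_measure \<alpha>)"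
  proof -
    have [measurable]: "ball (0::'a) R \<in> sets borel" by simp
    show ?thesis
      by (subst nn_integral_weighted_measure, measurable, subst nn_integral_add, measurable,
          subst nn_integral_cmult, measurable)
  qed
  also have "\<dots> = ennreal (sq_on f (ball 0 R)) +
      ennreal ((1 + R) powr (\<alpha> - \<beta>)) * ennreal (L2_inner (weighted_measure \<alpha>) f f)"
    using weighted_L2_local(3)[OF f(1) b0, of "ball 0 R" R] by (simp add: L2_inner_self_nn[OF f(2)])
  also have "\<dots> = ennreal (sq_on f (ball 0 R) + (1 + R) powr (\<alpha> - \<beta>) * L2_inner (weighted_measure \<alpha>) f f)"
    using nn by (simp add: ennreal_plus ennreal_mult)
  finally show ?thesis using nn by (subst (asm) ennreal_le_iff) auto
qed

text \<open>Finitely many cube averages control the weighted norm up to a multiple of the energy,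
  and the multiple becomes small for fine cubes and a large ball. This quantifies total
  boundedness.\<close>

lemma compactness_estimate:
  fixes f :: "'a::euclidean_space \<Rightarrow> real"
  assumes f: "f \<in> time_changed_dom \<alpha> \<beta>" and \<beta>: "\<alpha> < \<beta>" and h: "0 < h" and R: "0 \<le> R"
    and fH: "f \<in> L2 (weighted_measure \<alpha>)" "L2_inner (weighted_measure \<alpha>) f f \<le> C * stable_form \<alpha> f f"
  shows "L2_inner (weighted_measure \<beta>) f f \<le> (\<Sum>p\<in>grid h R. (int_on f (cell h p))\<^sup>2 / h ^ DIM('a)) +
    (real DIM('a) powr (real DIM('a) + \<alpha>) / stable_const DIM('a) \<alpha> * h powr \<alpha> + C * (1 + R) powr (\<alpha> - \<beta>)) *
      stable_form \<alpha> f f"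
proof -
  let ?d = "real DIM('a)" and ?c = "stable_const DIM('a) \<alpha>"
  let ?G = "grid h R :: ('a \<Rightarrow> int) set"
  have c: "0 < ?c" by (rule stable_const_pos[OF \<alpha>_pos \<alpha>_less])
  have b0: "0 \<le> \<beta>" using \<alpha>_pos \<beta> by simp
  have fL: "f \<in> L2 (weighted_measure \<beta>)" and fe: "f \<in> finite_energy \<alpha>"
    using f extended_dom_finite_energy by (auto simp: time_changed_dom_def)
  have icell: "integrable lborel (\<lambda>x. indicator (cell h p) x * (f x)\<^sup>2)" for p
  proof -
    obtain r where "cell h p \<subseteq> ball (0::'a) r" using bounded_subset_ballD[OF cell_bounded[OF h, of p], of 0] by blast
    then show ?thesis using weighted_L2_local(1)[OF fL b0 cell_borel] by blast
  qed
  let ?A = "?d powr (?d + \<alpha>) * h powr \<alpha> / (2 * ?c)"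
  have "sq_on f (ball 0 R) \<le> (\<Sum>p\<in>?G. sq_on f (cell h p))"
  proof -
    have "sq_on f (ball 0 R) \<le> (LINT x|lborel. (\<Sum>p\<in>?G. indicator (cell h p) x * (f x)\<^sup>2))"
      unfolding sq_on_def
    proof (rule integral_mono)
      show "integrable lborel (\<lambda>x. indicator (ball 0 R) x * (f x)\<^sup>2)"
        by (rule weighted_L2_local(1)[OF fL b0]) auto
      show "integrable lborel (\<lambda>x. \<Sum>p\<in>?G. indicator (cell h p) x * (f x)\<^sup>2)"
        by (intro Bochner_Integration.integrable_sum icell)
      fix x :: 'a
      show "indicator (ball 0 R) x * (f x)\<^sup>2 \<le> (\<Sum>p\<in>?G. indicator (cell h p) x * (f x)\<^sup>2)"
      proof (cases "x \<in> ball 0 R")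
        case True
        then obtain p where p: "p \<in> ?G" "x \<in> cell h p" using grid_cover[OF h] by blast
        have "indicator (cell h p) x * (f x)\<^sup>2 \<le> (\<Sum>p\<in>?G. indicator (cell h p) x * (f x)\<^sup>2)"
          using p(1) finite_grid[OF h] by (intro member_le_sum) auto
        then show ?thesis using p(2) True by simp
      qed (auto intro!: sum_nonneg)
    qed
    also have "\<dots> = (\<Sum>p\<in>?G. sq_on f (cell h p))"
      unfolding sq_on_def using icell by (intro Bochner_Integration.integral_sum) auto
    finally show ?thesis .
  qed
  also have "\<dots> \<le> (\<Sum>p\<in>?G. (int_on f (cell h p))\<^sup>2 / h ^ DIM('a) + ?A * energy_on \<alpha> f (cell h p \<times> cell h p))"
    by (intro sum_mono cell_Poincare fe h icell)
  also have "\<dots> = (\<Sum>p\<in>?G. (int_on f (cell h p))\<^sup>2 / h ^ DIM('a)) +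
      ?A * (\<Sum>p\<in>?G. energy_on \<alpha> f (cell h p \<times> cell h p))"
    by (simp add: sum.distrib sum_distrib_left)
  also have "\<dots> \<le> (\<Sum>p\<in>?G. (int_on f (cell h p))\<^sup>2 / h ^ DIM('a)) + ?A * (2 * stable_form \<alpha> f f)"
  proof (intro add_left_mono mult_left_mono sum_energy_on_le[OF fe finite_grid[OF h]])
    show "disjoint_family_on (\<lambda>p. cell h p \<times> cell h p) ?G"
      unfolding disjoint_family_on_def using cell_disjoint[OF h] by blast
  qed (use c h in auto)
  finally have "sq_on f (ball 0 R) \<le> \<dots>" .
  moreover have "(1 + R) powr (\<alpha> - \<beta>) * L2_inner (weighted_measure \<alpha>) f f \<le>
      (1 + R) powr (\<alpha> - \<beta>) * (C * stable_form \<alpha> f f)"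
    using fH by (intro mult_left_mono) auto
  ultimately have "L2_inner (weighted_measure \<beta>) f f \<le> ((\<Sum>p\<in>?G. (int_on f (cell h p))\<^sup>2 / h ^ DIM('a)) +
      ?A * (2 * stable_form \<alpha> f f)) + (1 + R) powr (\<alpha> - \<beta>) * (C * stable_form \<alpha> f f)"
    using weighted_tail[OF \<beta> fL fH(1) R] by linarith
  also have "?A * (2 * stable_form \<alpha> f f) = ?d powr (?d + \<alpha>) / ?c * h powr \<alpha> * stable_form \<alpha> f f" by simp
  finally show ?thesis by (simp add: algebra_simps)
qed

lemma time_changed_domD:
  assumes "f \<in> time_changed_dom \<alpha> \<beta>"
  shows "f \<in> L2 (weighted_measure \<beta>)" "f \<in> extended_dom \<alpha>" "f \<in> finite_energy \<alpha>"
    "f \<in> borel_measurable lborel"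
  using assms extended_dom_finite_energy[of f] finite_energyD[of f \<alpha>]
  by (auto simp: time_changed_dom_def)

lemma int_on_cell:
  fixes f :: "'a::euclidean_space \<Rightarrow> real"
  assumes f: "f \<in> time_changed_dom \<alpha> \<beta>" and \<beta>: "0 \<le> \<beta>" and h: "0 < h" and r: "cell h p \<subseteq> ball 0 r"
  shows "integrable lborel (\<lambda>x. indicator (cell h p) x * f x)"
    "(int_on f (cell h p))\<^sup>2 \<le> h ^ DIM('a) * ((1 + r) powr \<beta> * L2_inner (weighted_measure \<beta>) f f)"
proof -
  have fin: "emeasure lborel (cell h p :: 'a set) < \<infinity>" using emeasure_cell[OF h, of p] by simp
  have v: "measure lborel (cell h p :: 'a set) = h ^ DIM('a)"
    using emeasure_cell[OF h, of p] h by (simp add: measure_def)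
  note loc = weighted_L2_local[OF time_changed_domD(1)[OF f] \<beta> cell_borel r]
  note ctx = time_changed_domD(4)[OF f] cell_borel fin loc(1)
  show "integrable lborel (\<lambda>x. indicator (cell h p) x * f x)" by (rule integrable_int_on[OF ctx])
  have "(int_on f (cell h p))\<^sup>2 \<le> h ^ DIM('a) * sq_on f (cell h p)"
    using increments_within(2)[OF ctx] unfolding v .
  also have "\<dots> \<le> h ^ DIM('a) * ((1 + r) powr \<beta> * L2_inner (weighted_measure \<beta>) f f)"
    using loc(2) h by (intro mult_left_mono) auto
  finally show "(int_on f (cell h p))\<^sup>2 \<le> h ^ DIM('a) * ((1 + r) powr \<beta> * L2_inner (weighted_measure \<beta>) f f)" .
qed

text \<open>Along a diagonal subsequence all cube averages at all scales converge. Applied to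
  differences, the estimate at one sufficiently fine scale then shows that the subsequence is
  Cauchy.\<close>

lemma compact_embedding_time_changed:
  fixes u :: "nat \<Rightarrow> 'a::euclidean_space \<Rightarrow> real"
  assumes dim: "\<alpha> < real DIM('a)" and \<beta>: "\<alpha> < \<beta>"
    and u: "\<And>n. u n \<in> time_changed_dom \<alpha> \<beta>"
    and E: "\<And>n. stable_form \<alpha> (u n) (u n) \<le> C"
    and N: "\<And>n. L2_inner (weighted_measure \<beta>) (u n) (u n) \<le> C"
  shows "\<exists>r g. strict_mono r \<and> g \<in> L2 (weighted_measure \<beta>) \<and> L2.conv (weighted_measure \<beta>) (\<lambda>n. u (r n)) g"
proof -
  let ?M = "weighted_measure \<beta> :: 'a measure"
  have b0: "0 \<le> \<beta>" using \<alpha>_pos \<beta> by simp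
  note uD = time_changed_domD[OF u]
  have C0: "0 \<le> C" using E[of 0] D.ip_nonneg[OF uD(3)[of 0]] by linarith
  obtain K where K: "0 \<le> K"
    and KL: "\<And>f :: 'a \<Rightarrow> real. f \<in> extended_dom \<alpha> \<Longrightarrow> f \<in> L2 (weighted_measure \<alpha>)"
    and KH: "\<And>f :: 'a \<Rightarrow> real. f \<in> extended_dom \<alpha> \<Longrightarrow> L2_inner (weighted_measure \<alpha>) f f \<le> K * stable_form \<alpha> f f"
    using Hardy_extended[OF dim] by metis
  define A where "A = real DIM('a) powr (real DIM('a) + \<alpha>) / stable_const DIM('a) \<alpha>"
  \<comment> \<open>One parameter \<open>j\<close> refines the cubes and, with radius
    \<open>j\<close>, enlarges the ball, so that both error terms in \<eta> tend to zero
    together.\<close>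
  define h where "h j = 1 / (1 + real j)" for j
  have h: "0 < h j" for j by (simp add: h_def)
  let ?G = "\<lambda>j. grid (h j) (real j) :: ('a \<Rightarrow> int) set"
  define \<eta> where "\<eta> j = A * h j powr \<alpha> + K * (1 + real j) powr (\<alpha> - \<beta>)" for j
  have "\<eta> \<longlonglongrightarrow> 0"
  proof -
    have top: "filterlim (\<lambda>j. 1 + real j) at_top sequentially"
      by (rule filterlim_tendsto_add_at_top[OF tendsto_const filterlim_real_sequentially])
    have "(\<lambda>j. A * (1 + real j) powr - \<alpha> + K * (1 + real j) powr (\<alpha> - \<beta>)) \<longlonglongrightarrow> A * 0 + K * 0"
      using \<alpha>_pos \<beta> by (intro tendsto_intros tendsto_neg_powr top) auto
    moreover have "h j powr \<alpha> = (1 + real j) powr - \<alpha>" for j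
      by (simp add: h_def powr_minus inverse_eq_divide powr_divide)
    ultimately show ?thesis by (simp add: \<eta>_def[abs_def])
  qed
  define a where "a j p n = int_on (u n) (cell (h j) p)" for j p n
  have bdd: "\<exists>B. \<forall>n. \<bar>a j p n\<bar> \<le> B" for j p
  proof -
    obtain r where r: "cell (h j) p \<subseteq> ball (0::'a) r"
      using bounded_subset_ballD[OF cell_bounded[OF h, of j p], of 0] by blast
    let ?B = "h j ^ DIM('a) * ((1 + r) powr \<beta> * C)"
    have "\<bar>a j p n\<bar> \<le> sqrt ?B" for n
    proof -
      have "(a j p n)\<^sup>2 \<le> h j ^ DIM('a) * ((1 + r) powr \<beta> * L2_inner ?M (u n) (u n))"
        unfolding a_def by (rule int_on_cell(2)[OF u b0 h r])
      also have "\<dots> \<le> ?B" using N h[of j] by (intro mult_left_mono) auto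
      finally have "sqrt ((a j p n)\<^sup>2) \<le> sqrt ?B" by (rule real_sqrt_le_mono)
      then show ?thesis by simp
    qed
    then show ?thesis by blast
  qed
  obtain r where r: "strict_mono r" and conv: "\<And>j p. p \<in> ?G j \<Longrightarrow> convergent (\<lambda>n. a j p (r n))"
    using diagonal_subseq[of ?G a] finite_grid[OF h] bdd by metis
  define v where "v n = u (r n)" for n
  have vF: "v n \<in> time_changed_dom \<alpha> \<beta>" for n using u by (simp add: v_def)
  note vD = time_changed_domD[OF vF]
  have "L2.Cau ?M v"
    unfolding L2.Cau_def
  proof (intro allI impI)
    fix e :: real assume e: "0 < e"
    have "(\<lambda>j. \<eta> j * (4 * C)) \<longlonglongrightarrow> 0" using \<open>\<eta> \<longlonglongrightarrow> 0\<close> by (rule tendsto_mult_left_zero)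
    then have "\<forall>\<^sub>F j in sequentially. \<eta> j * (4 * C) < e\<^sup>2 / 2" using e by (intro order_tendstoD) auto
    then obtain j where j: "\<eta> j * (4 * C) < e\<^sup>2 / 2" by (auto simp: eventually_sequentially)
    have hj: "0 < h j ^ DIM('a)" using h by simp
    obtain l where l: "\<And>p. p \<in> ?G j \<Longrightarrow> (\<lambda>n. a j p (r n)) \<longlonglongrightarrow> l p"
      using conv[of _ j] unfolding convergent_def by metis
    \<comment> \<open>Comparing each average with its limit splits the contribution of a pair
      \<open>m\<close>, \<open>n\<close> into \<open>s m + s n\<close>.\<close>
    define s where "s n = (\<Sum>p\<in>?G j. 2 * (a j p (r n) - l p)\<^sup>2 / h j ^ DIM('a))" for n
    have "s \<longlonglongrightarrow> (\<Sum>p\<in>?G j. 2 * (l p - l p)\<^sup>2 / h j ^ DIM('a))"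
      unfolding s_def using h[of j] by (intro tendsto_sum tendsto_divide tendsto_mult tendsto_power tendsto_diff l tendsto_const) auto
    then have "s \<longlonglongrightarrow> 0" by simp
    then have "\<forall>\<^sub>F n in sequentially. s n < e\<^sup>2 / 4" using e by (intro order_tendstoD) auto
    then obtain M where M: "\<And>n. n \<ge> M \<Longrightarrow> s n < e\<^sup>2 / 4" by (auto simp: eventually_sequentially)
    have "L2.nrm ?M (v m - v n) < e" if mn: "m \<ge> M" "n \<ge> M" for m n
    proof (rule power2_less_imp_less)
      have dF: "v m - v n \<in> time_changed_dom \<alpha> \<beta>"
        by (intro subspace_diff[OF subspace_time_changed_dom] vF)
      note dD = time_changed_domD[OF dF]
      \<comment> \<open>The energy of a difference is at most twice the sum of the two
        energies.\<close>
      have sf: "stable_form \<alpha> (v m - v n) (v m - v n) \<le> 4 * C"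
        using D.ip_diff_le[OF vD(3) vD(3), of m n] E[of "r m"] E[of "r n"] unfolding v_def by linarith
      have \<eta>0: "0 \<le> \<eta> j"
        using K stable_const_pos[OF \<alpha>_pos \<alpha>_less, of "DIM('a)"] unfolding \<eta>_def A_def
        by (intro add_nonneg_nonneg mult_nonneg_nonneg divide_nonneg_nonneg) auto
      have "L2_inner ?M (v m - v n) (v m - v n) \<le>
          (\<Sum>p\<in>?G j. (int_on (v m - v n) (cell (h j) p))\<^sup>2 / h j ^ DIM('a)) +
          \<eta> j * stable_form \<alpha> (v m - v n) (v m - v n)"
        unfolding \<eta>_def A_def
        by (rule compactness_estimate[OF dF \<beta> h _ KL[OF dD(2)] KH[OF dD(2)]]) simp
      also have "\<dots> \<le> (s m + s n) + \<eta> j * (4 * C)"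
      proof (intro add_mono mult_left_mono sf \<eta>0)
        have "(int_on (v m - v n) (cell (h j) p))\<^sup>2 / h j ^ DIM('a) \<le>
            2 * (a j p (r m) - l p)\<^sup>2 / h j ^ DIM('a) + 2 * (a j p (r n) - l p)\<^sup>2 / h j ^ DIM('a)" for p
        proof -
          obtain \<rho> where \<rho>: "cell (h j) p \<subseteq> ball (0::'a) \<rho>"
            using bounded_subset_ballD[OF cell_bounded[OF h, of j p], of 0] by blast
          have eq: "int_on (v m - v n) (cell (h j) p) = (a j p (r m) - l p) - (a j p (r n) - l p)"
            unfolding int_on_diff[OF int_on_cell(1)[OF vF b0 h \<rho>] int_on_cell(1)[OF vF b0 h \<rho>]]
            by (simp add: a_def v_def)
          have sq: "(x - y)\<^sup>2 \<le> 2 * x\<^sup>2 + 2 * y\<^sup>2" for x y :: real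
            using zero_le_power2[of "x + y"] by (simp add: power2_eq_square algebra_simps)
          have "(int_on (v m - v n) (cell (h j) p))\<^sup>2 \<le> 2 * (a j p (r m) - l p)\<^sup>2 + 2 * (a j p (r n) - l p)\<^sup>2"
            unfolding eq by (rule sq)
          then have "(int_on (v m - v n) (cell (h j) p))\<^sup>2 / h j ^ DIM('a) \<le>
              (2 * (a j p (r m) - l p)\<^sup>2 + 2 * (a j p (r n) - l p)\<^sup>2) / h j ^ DIM('a)"
            using hj by (intro divide_right_mono) auto
          then show ?thesis by (simp add: add_divide_distrib)
        qed
        then show "(\<Sum>p\<in>?G j. (int_on (v m - v n) (cell (h j) p))\<^sup>2 / h j ^ DIM('a)) \<le> s m + s n"
          unfolding s_def sum.distrib[symmetric] by (rule sum_mono)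
      qed
      also have "\<dots> < e\<^sup>2" using M[OF mn(1)] M[OF mn(2)] j by linarith
      finally show "(L2.nrm ?M (v m - v n))\<^sup>2 < e\<^sup>2" by (simp add: L2.nrm_sq[OF dD(1)])
    qed (use e in simp)
    then show "\<exists>N. \<forall>m\<ge>N. \<forall>n\<ge>N. L2.nrm ?M (v m - v n) < e" by blast
  qed
  from L2.complete[OF vD(1) this] obtain g where g: "g \<in> L2 ?M" "L2.conv ?M v g" by blast
  show ?thesis
  proof (intro exI conjI)
    show "L2.conv ?M (\<lambda>n. u (r n)) g" using g(2) by (simp add: v_def[abs_def])
  qed (use r g in auto)
qed

section \<open>Lipschitz functions of bounded support have finite energy\<close>

text \<open>Dyadic decomposition around the unit sphere. Outwards the terms decay with ratio
  \<open>2 powr - \<alpha>\<close>, because \<open>\<alpha> > 0\<close>; inwards with ratio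
  \<open>2 powr (\<alpha> - 2)\<close>, because \<open>\<alpha> < 2\<close>.\<close>

lemma jump_kernel_integrable: "(\<integral>\<^sup>+z. ennreal (jump_kernel \<alpha> (z :: 'a::euclidean_space)) \<partial>lborel) < \<infinity>"
proof -
  define s where "s = real DIM('a) + \<alpha>"
  define V where "V = unit_ball_vol (real DIM('a))"
  have V: "0 \<le> V" by (simp add: V_def)
  let ?B = "\<lambda>r. ball (0::'a) r"
  have [measurable]: "?B r \<in> sets borel" for r by simp
  define p where "p = 2 powr - \<alpha>"
  define q where "q = 2 powr (\<alpha> - 2)"
  have p: "0 \<le> p" "p < 1" and q: "0 \<le> q" "q < 1"
    using \<alpha>_pos \<alpha>_less powr_less_mono[of "- \<alpha>" 0 2] powr_less_mono[of "\<alpha> - 2" 0 2] by (simp_all add: p_def q_def)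
  \<comment> \<open>Bounds for the kernel where \<open>2 ^ k \<le> norm z < 2 ^ Suc k\<close> and
    where \<open>1 / 2 ^ Suc k \<le> norm z \<le> (1/2) ^ k\<close>. The inner balls below have
    doubled radius because the last inequality need not be strict.\<close>
  define o' where "o' k = (2 ^ k) powr - s" for k :: nat
  define i' where "i' k = (1/4) ^ k * (2 ^ Suc k) powr s" for k :: nat
  have mB: "emeasure lborel (?B r) = ennreal (V * r ^ DIM('a))" if "0 \<le> r" for r
    using content_ball[OF that, of "0::'a"] emeasure_lborel_ball_finite[of "0::'a" r]
    by (simp add: V_def emeasure_eq_ennreal_measure less_top)
  have pt: "ennreal (jump_kernel \<alpha> z) \<le> (\<Sum>k. ennreal (o' k) * indicator (?B (2 ^ Suc k)) z) +
      (\<Sum>k. ennreal (i' k) * indicator (?B (2 * (1/2) ^ k)) z)" for z :: 'a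
  proof -
    consider "z = 0" | "1 \<le> norm z" | "0 < norm z" "norm z < 1" by fastforce
    then show ?thesis
    proof cases
      case 1
      then show ?thesis by (simp add: jump_kernel_def)
    next
      case 2
      then obtain k :: nat where k: "2 ^ k \<le> norm z" "norm z < 2 ^ Suc k" by (rule dyadic_bracket)
      have "jump_kernel \<alpha> z \<le> norm z powr - s"
        unfolding jump_kernel_def s_def powr_minus_divide by (intro divide_right_mono) auto
      also have "\<dots> \<le> o' k" unfolding o'_def s_def using k \<alpha>_pos by (intro powr_mono2') auto
      finally have "ennreal (jump_kernel \<alpha> z) \<le> ennreal (o' k) * indicator (?B (2 ^ Suc k)) z"
        using k by (simp add: ennreal_leI)
      also have "\<dots> \<le> (\<Sum>k. ennreal (o' k) * indicator (?B (2 ^ Suc k)) z)"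
        by (rule ennreal_le_suminf[where f = "\<lambda>k. ennreal (o' k) * indicator (?B (2 ^ Suc k)) z"])
      finally show ?thesis by (simp add: add_increasing2)
    next
      case 3
      then have "1 \<le> 1 / norm z" by simp
      then obtain k :: nat where k: "2 ^ k \<le> 1 / norm z" "1 / norm z < 2 ^ Suc k" by (rule dyadic_bracket)
      have n1: "norm z \<le> (1/2) ^ k" using k(1) 3 by (simp add: field_simps)
      have n2: "1 / 2 ^ Suc k \<le> norm z" using k(2) 3 by (simp add: field_simps)
      have "jump_kernel \<alpha> z \<le> (norm z)\<^sup>2 * norm z powr - s"
        unfolding jump_kernel_def s_def powr_minus_divide by (simp add: divide_right_mono)
      also have "\<dots> \<le> ((1/2) ^ k)\<^sup>2 * (1 / 2 ^ Suc k) powr - s"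
        using n1 n2 \<alpha>_pos by (intro mult_mono power_mono powr_mono2') (auto simp: s_def)
      also have "\<dots> = i' k"
        by (simp add: i'_def powr_minus_divide powr_divide power2_eq_square flip: power_mult_distrib)
      finally have "ennreal (jump_kernel \<alpha> z) \<le> ennreal (i' k) * indicator (?B (2 * (1/2) ^ k)) z"
      proof -
        assume le: "jump_kernel \<alpha> z \<le> i' k"
        have "(1/2::real) ^ k > 0" by simp
        then have "norm z < 2 * (1/2) ^ k" using n1 by linarith
        then show ?thesis using le by (simp add: ennreal_leI)
      qed
      also have "\<dots> \<le> (\<Sum>k. ennreal (i' k) * indicator (?B (2 * (1/2) ^ k)) z)"
        by (rule ennreal_le_suminf[where f = "\<lambda>k. ennreal (i' k) * indicator (?B (2 * (1/2) ^ k)) z"])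
      finally show ?thesis by (simp add: add_increasing)
    qed
  qed
  have two: "2 powr real DIM('a) = 2 ^ DIM('a)" by (simp add: powr_realpow)
  have o_eq: "o' k * (V * (2 ^ Suc k) ^ DIM('a)) = V * 2 ^ DIM('a) * p ^ k" for k
  proof -
    have "o' k = (2 powr - s) ^ k" by (simp add: o'_def powr_powr mult.commute flip: powr_realpow)
    moreover have "((2::real) ^ Suc k) ^ DIM('a) = (2 ^ DIM('a)) ^ Suc k"
      by (simp only: power_mult[symmetric] mult.commute)
    moreover have "p = 2 ^ DIM('a) * 2 powr - s"
      by (simp add: p_def s_def flip: two powr_add)
    ultimately show ?thesis by (simp only: power_mult_distrib power_Suc mult_ac)
  qed
  have i_eq: "i' k * (V * (2 * (1/2) ^ k) ^ DIM('a)) = V * 2 ^ DIM('a) * 2 powr s * q ^ k" for k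
  proof -
    have "(2 ^ Suc k) powr s = 2 powr s * (2 powr s) ^ k"
      by (simp add: powr_mult powr_powr mult.commute flip: powr_realpow)
    moreover have "q = (1/4) * 2 powr s * (1/2) ^ DIM('a)"
    proof -
      have "q = 2 powr (s - real DIM('a) - 2)" by (simp add: q_def s_def)
      also have "\<dots> = 2 powr s / 2 powr real DIM('a) / 2 powr 2" by (simp only: powr_diff)
      also have "\<dots> = (1/4) * 2 powr s * (1/2) ^ DIM('a)" by (simp add: two power_one_over)
      finally show ?thesis .
    qed
    moreover have "(2 * (1/2::real) ^ k) ^ DIM('a) = 2 ^ DIM('a) * ((1/2) ^ DIM('a)) ^ k"
      by (simp only: power_mult_distrib power_mult[symmetric] mult.commute)
    ultimately show ?thesis unfolding i'_def by (simp only: power_mult_distrib mult_ac)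
  qed
  have "(\<integral>\<^sup>+z. ennreal (jump_kernel \<alpha> (z :: 'a)) \<partial>lborel) \<le>
      (\<integral>\<^sup>+z. (\<Sum>k. ennreal (o' k) * indicator (?B (2 ^ Suc k)) z) +
      (\<Sum>k. ennreal (i' k) * indicator (?B (2 * (1/2) ^ k)) z) \<partial>lborel)"
    by (intro nn_integral_mono pt)
  also have "\<dots> = (\<Sum>k. ennreal (o' k) * emeasure lborel (?B (2 ^ Suc k))) +
      (\<Sum>k. ennreal (i' k) * emeasure lborel (?B (2 * (1/2) ^ k)))"
    by (subst nn_integral_add) (simp_all add: nn_integral_suminf nn_integral_cmult)
  also have "\<dots> = (\<Sum>k. ennreal (V * 2 ^ DIM('a) * p ^ k)) + (\<Sum>k. ennreal (V * 2 ^ DIM('a) * 2 powr s * q ^ k))"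
    unfolding o_eq[symmetric] i_eq[symmetric]
    by (intro arg_cong2[where f = plus] suminf_cong; subst mB) (auto simp: ennreal_mult o'_def i'_def V)
  also have "\<dots> < \<infinity>"
  proof -
    have "(\<Sum>k. ennreal (c * x ^ k)) < \<infinity>" if "0 \<le> c" "0 \<le> x" "x < 1" for c x :: real
    proof -
      have "(\<Sum>k. ennreal (c * x ^ k)) = ennreal (\<Sum>k. c * x ^ k)"
        using that by (intro suminf_ennreal2 summable_mult summable_geometric) auto
      then show ?thesis by simp
    qed
    then show ?thesis using V p q by simp
  qed
  finally show ?thesis .
qed

lemma nn_integral_translate:
  fixes g :: "'a::euclidean_space \<Rightarrow> ennreal"
  assumes [measurable]: "g \<in> borel_measurable borel"
  shows "(\<integral>\<^sup>+y. g (a + y) \<partial>lborel) = (\<integral>\<^sup>+y. g y \<partial>lborel)"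
proof -
  have "(\<integral>\<^sup>+y. g y \<partial>lborel) = (\<integral>\<^sup>+y. g y \<partial>distr lborel borel ((+) a))" by (simp add: lborel_distr_plus)
  also have "\<dots> = (\<integral>\<^sup>+y. g (a + y) \<partial>lborel)" by (subst nn_integral_distr) auto
  finally show ?thesis by simp
qed

text \<open>Squared increments are at most a constant times \<open>min (norm (x - y) ^ 2) 1\<close>
  and vanish unless one of the points lies in the ball. By translation invariance the energy is
  bounded by twice the volume of the ball times the integral of the kernel.\<close>

lemma Lipschitz_stable_dom:
  fixes \<phi> :: "'a::euclidean_space \<Rightarrow> real"
  assumes L: "\<And>x y. \<bar>\<phi> x - \<phi> y\<bar> \<le> L * norm (x - y)"
    and B: "\<And>x. \<bar>\<phi> x\<bar> \<le> B" and supp: "\<And>x. x \<notin> ball 0 R \<Longrightarrow> \<phi> x = 0"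
  shows "\<phi> \<in> stable_dom \<alpha>"
proof -
  let ?c = "stable_const DIM('a) \<alpha>" and ?L = "lborel \<Otimes>\<^sub>M lborel :: ('a \<times> 'a) measure"
  let ?B = "ball (0::'a) R"
  have c: "0 < ?c" by (rule stable_const_pos[OF \<alpha>_pos \<alpha>_less])
  have "continuous_on UNIV \<phi>"
  proof (rule continuous_onI)
    fix x :: 'a and e :: real assume e: "0 < e"
    have "dist (\<phi> x') (\<phi> x) \<le> e" if "dist x' x < e / (\<bar>L\<bar> + 1)" for x'
    proof -
      have "dist (\<phi> x') (\<phi> x) \<le> (\<bar>L\<bar> + 1) * norm (x' - x)"
        using L[of x' x] unfolding dist_real_def by (meson abs_ge_self add_increasing2 mult_right_mono norm_ge_zero order_trans zero_le_one)
      also have "\<dots> \<le> e" using that unfolding dist_norm by (simp add: field_simps)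
      finally show ?thesis .
    qed
    then show "\<exists>d>0. \<forall>x'\<in>UNIV. dist x' x < d \<longrightarrow> dist (\<phi> x') (\<phi> x) \<le> e"
      using e by (intro exI[of _ "e / (\<bar>L\<bar> + 1)"]) (auto intro!: divide_pos_pos)
  qed
  then have m [measurable]: "\<phi> \<in> borel_measurable borel" by (rule borel_measurable_continuous_onI)
  have [measurable]: "?B \<in> sets borel" by simp
  have fin: "emeasure lborel ?B < \<infinity>" by (rule emeasure_lborel_ball_finite)
  have B0: "0 \<le> B" using B[of 0] by linarith
  have sq: "(\<phi> x)\<^sup>2 \<le> B\<^sup>2" for x using B[of x] by (simp add: abs_le_square_iff[symmetric] B0)
  have "(\<integral>\<^sup>+x. ennreal ((\<phi> x)\<^sup>2) \<partial>lborel) \<le> (\<integral>\<^sup>+x. ennreal (B\<^sup>2) * indicator ?B x \<partial>lborel)"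
  proof (rule nn_integral_mono)
    fix x :: 'a
    show "ennreal ((\<phi> x)\<^sup>2) \<le> ennreal (B\<^sup>2) * indicator ?B x"
      using sq[of x] supp[of x] by (auto simp: indicator_def intro: ennreal_leI)
  qed
  also have "\<dots> = ennreal (B\<^sup>2 * measure lborel ?B)"
    using fin by (simp add: nn_integral_cmult emeasure_eq_ennreal_measure less_top ennreal_mult)
  finally have "\<phi> \<in> L2 lborel" using m by (intro L2_if_nn_integral_finite(1)) auto
  moreover have "jump \<alpha> \<phi> \<in> L2 ?L"
  proof -
    let ?g = "\<lambda>z :: 'a. ennreal (jump_kernel \<alpha> z)"
    have gm [measurable]: "?g \<in> borel_measurable borel" unfolding jump_kernel_def by measurable
    define J where "J = (\<integral>\<^sup>+z. ?g z \<partial>lborel)"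
    have J: "J < \<infinity>" unfolding J_def by (rule jump_kernel_integrable)
    define K where "K = (L\<^sup>2 + 4 * B\<^sup>2) * ?c"
    have K: "0 \<le> K" using c by (simp add: K_def)
    have even: "jump_kernel \<alpha> (x - y) = jump_kernel \<alpha> (y - x)" for x y :: 'a
      by (simp add: jump_kernel_def norm_minus_commute)
    have incr: "(\<phi> x - \<phi> y)\<^sup>2 \<le> (L\<^sup>2 + 4 * B\<^sup>2) * min ((norm (x - y))\<^sup>2) 1" for x y
    proof -
      have "(\<phi> x - \<phi> y)\<^sup>2 \<le> (L * norm (x - y))\<^sup>2"
        using L[of x y] by (metis abs_ge_zero power2_abs power_mono)
      then have 1: "(\<phi> x - \<phi> y)\<^sup>2 \<le> L\<^sup>2 * (norm (x - y))\<^sup>2" by (simp add: power_mult_distrib)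
      have "\<bar>\<phi> x - \<phi> y\<bar> \<le> 2 * B" using B[of x] B[of y] by linarith
      then have "(\<phi> x - \<phi> y)\<^sup>2 \<le> (2 * B)\<^sup>2" by (metis abs_ge_zero power2_abs power_mono)
      then have 2: "(\<phi> x - \<phi> y)\<^sup>2 \<le> 4 * B\<^sup>2" by (simp add: power_mult_distrib)
      show ?thesis
      proof (cases "(norm (x - y))\<^sup>2 \<le> 1")
        case True
        have "L\<^sup>2 * (norm (x - y))\<^sup>2 \<le> (L\<^sup>2 + 4 * B\<^sup>2) * (norm (x - y))\<^sup>2" by (intro mult_right_mono) auto
        then show ?thesis using 1 True by (simp add: min_def)
      next
        case False
        have "4 * B\<^sup>2 \<le> L\<^sup>2 + 4 * B\<^sup>2" by simp
        with 2 have "(\<phi> x - \<phi> y)\<^sup>2 \<le> L\<^sup>2 + 4 * B\<^sup>2" by (rule order_trans)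
        then show ?thesis using False by (simp add: min_def)
      qed
    qed
    have pt: "ennreal ((jump \<alpha> \<phi> z)\<^sup>2) \<le> ennreal K * (?g (fst z - snd z) * indicator ?B (fst z)) +
        ennreal K * (?g (fst z - snd z) * indicator ?B (snd z))" for z :: "'a \<times> 'a"
    proof -
      obtain x y where z: "z = (x, y)" by force
      have "(jump \<alpha> \<phi> z)\<^sup>2 = (\<phi> x - \<phi> y)\<^sup>2 * (?c / norm (x - y) powr (real DIM('a) + \<alpha>))"
        using c by (simp add: jump_def z power_mult_distrib)
      also have "\<dots> \<le> ((L\<^sup>2 + 4 * B\<^sup>2) * min ((norm (x - y))\<^sup>2) 1) * (?c / norm (x - y) powr (real DIM('a) + \<alpha>))"
        using c by (intro mult_right_mono incr) auto
      also have "\<dots> = K * jump_kernel \<alpha> (x - y)" by (simp add: K_def jump_kernel_def)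
      finally have le: "ennreal ((jump \<alpha> \<phi> z)\<^sup>2) \<le> ennreal K * ?g (x - y)"
        using K by (simp add: ennreal_leI jump_kernel_def flip: ennreal_mult)
      show ?thesis
      proof (cases "x \<in> ?B \<or> y \<in> ?B")
        case True
        then show ?thesis using le by (auto simp: z indicator_def intro: add_increasing add_increasing2)
      next
        case False
        then have "\<phi> x = 0" "\<phi> y = 0" using supp by auto
        then show ?thesis by (simp add: jump_def z)
      qed
    qed
    have g1: "(\<integral>\<^sup>+z. ?g (fst z - snd z) * indicator ?B (fst z) \<partial>?L) = J * emeasure lborel ?B"
    proof -
      have "(\<integral>\<^sup>+z. ?g (fst z - snd z) * indicator ?B (fst z) \<partial>?L) =
          (\<integral>\<^sup>+x. \<integral>\<^sup>+y. ?g (x - y) * indicator ?B x \<partial>lborel \<partial>lborel)"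
        by (subst lborel.nn_integral_fst[symmetric]) auto
      also have "\<dots> = (\<integral>\<^sup>+x. J * indicator ?B x \<partial>lborel)"
      proof (intro nn_integral_cong)
        fix x :: 'a
        have "(\<integral>\<^sup>+y. ?g (x - y) \<partial>lborel) = (\<integral>\<^sup>+y. ?g (- x + y) \<partial>lborel)" by (simp add: even[of x])
        also have "\<dots> = J" unfolding J_def by (rule nn_integral_translate[OF gm])
        finally show "(\<integral>\<^sup>+y. ?g (x - y) * indicator ?B x \<partial>lborel) = J * indicator ?B x"
          by (simp add: nn_integral_multc)
      qed
      also have "\<dots> = J * emeasure lborel ?B" by (simp add: nn_integral_cmult)
      finally show ?thesis .
    qed
    have g2: "(\<integral>\<^sup>+z. ?g (fst z - snd z) * indicator ?B (snd z) \<partial>?L) = J * emeasure lborel ?B"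
    proof -
      have "(\<integral>\<^sup>+z. ?g (fst z - snd z) * indicator ?B (snd z) \<partial>?L) =
          (\<integral>\<^sup>+y. \<integral>\<^sup>+x. ?g (x - y) * indicator ?B y \<partial>lborel \<partial>lborel)"
        by (subst lborel_pair.nn_integral_snd[symmetric]) auto
      also have "\<dots> = (\<integral>\<^sup>+y. J * indicator ?B y \<partial>lborel)"
      proof (intro nn_integral_cong)
        fix y :: 'a
        have "(\<integral>\<^sup>+x. ?g (x - y) \<partial>lborel) = (\<integral>\<^sup>+x. ?g (- y + x) \<partial>lborel)" by simp
        also have "\<dots> = J" unfolding J_def by (rule nn_integral_translate[OF gm])
        finally show "(\<integral>\<^sup>+x. ?g (x - y) * indicator ?B y \<partial>lborel) = J * indicator ?B y"
          by (simp add: nn_integral_multc)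
      qed
      also have "\<dots> = J * emeasure lborel ?B" by (simp add: nn_integral_cmult)
      finally show ?thesis .
    qed
    have "(\<integral>\<^sup>+z. ennreal ((jump \<alpha> \<phi> z)\<^sup>2) \<partial>?L) \<le>
        (\<integral>\<^sup>+z. ennreal K * (?g (fst z - snd z) * indicator ?B (fst z)) +
          ennreal K * (?g (fst z - snd z) * indicator ?B (snd z)) \<partial>?L)" by (intro nn_integral_mono pt)
    also have "\<dots> = ennreal K * (J * emeasure lborel ?B) + ennreal K * (J * emeasure lborel ?B)"
      by (subst nn_integral_add) (simp_all add: nn_integral_cmult g1 g2)
    also have "\<dots> < \<infinity>" using J fin by (simp add: ennreal_mult_less_top)
    finally have "(\<integral>\<^sup>+z. ennreal ((jump \<alpha> \<phi> z)\<^sup>2) \<partial>?L) < \<infinity>" .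
    moreover have "jump \<alpha> \<phi> \<in> borel_measurable ?L" by (rule measurable_jump) simp
    ultimately show ?thesis by (intro L2I integrableI_nonneg) auto
  qed
  ultimately show ?thesis unfolding stable_dom_eq by (simp add: finite_energy_def)
qed

section \<open>Scaling and the separated sequence\<close>

lemma stable_form_nn:
  assumes "f \<in> finite_energy \<alpha>"
  shows "(\<integral>\<^sup>+z. ennreal ((jump \<alpha> f z)\<^sup>2) \<partial>(lborel \<Otimes>\<^sub>M lborel)) = ennreal (2 * stable_form \<alpha> f f)"
  using L2_inner_self_nn[OF finite_energyD(2)[OF assms]] by (simp add: stable_form_eq)

text \<open>Each of the two integrations contributes \<open>R ^ d\<close>, and the kernel
  contributes \<open>R powr - (d + \<alpha>)\<close>.\<close>

lemma stable_form_dilate: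
  fixes f :: "'a::euclidean_space \<Rightarrow> real"
  assumes f: "f \<in> finite_energy \<alpha>" and fR: "dilate R f \<in> finite_energy \<alpha>" and R: "0 < R"
  shows "stable_form \<alpha> (dilate R f) (dilate R f) = R powr (real DIM('a) - \<alpha>) * stable_form \<alpha> f f"
proof -
  let ?d = "real DIM('a)" and ?L = "lborel \<Otimes>\<^sub>M lborel :: ('a \<times> 'a) measure"
  have [measurable]: "jump \<alpha> f \<in> borel_measurable ?L" "jump \<alpha> (dilate R f) \<in> borel_measurable ?L"
    using f fR finite_energyD measurable_jump by blast+
  have jump: "(jump \<alpha> (dilate R f) (x, y))\<^sup>2 =
      R powr - (?d + \<alpha>) * (jump \<alpha> f ((1 / R) *\<^sub>R x, (1 / R) *\<^sub>R y))\<^sup>2" for x y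
  proof -
    have "norm (x - y) = R * norm ((1 / R) *\<^sub>R x - (1 / R) *\<^sub>R y)"
      using R by (simp flip: scaleR_diff_right)
    then have n: "norm (x - y) powr (?d + \<alpha>) =
        R powr (?d + \<alpha>) * norm ((1 / R) *\<^sub>R x - (1 / R) *\<^sub>R y) powr (?d + \<alpha>)"
      using R by (simp add: powr_mult)
    have alg: "(a * sqrt (c / (r * m)))\<^sup>2 = inverse r * (a * sqrt (c / m))\<^sup>2"
      if "0 \<le> c" "0 \<le> r" "0 \<le> m" for a c r m :: real
      using that by (simp add: power_mult_distrib divide_inverse)
    have c: "0 \<le> stable_const DIM('a) \<alpha>" using stable_const_pos[OF \<alpha>_pos \<alpha>_less, of "DIM('a)"] by simp
    show ?thesis
      unfolding jump_def prod.case dilate_def n powr_minus using c R by (intro alg) auto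
  qed
  have "(\<integral>\<^sup>+z. ennreal ((jump \<alpha> (dilate R f) z)\<^sup>2) \<partial>?L) =
      (\<integral>\<^sup>+x. \<integral>\<^sup>+y. ennreal (R powr - (?d + \<alpha>)) * ennreal ((jump \<alpha> f ((1 / R) *\<^sub>R x, (1 / R) *\<^sub>R y))\<^sup>2) \<partial>lborel \<partial>lborel)"
    by (subst lborel.nn_integral_fst[symmetric]) (auto simp: jump ennreal_mult)
  also have "\<dots> = (\<integral>\<^sup>+x. ennreal (R powr - (?d + \<alpha>)) * (ennreal (R ^ DIM('a)) *
      (\<integral>\<^sup>+y. ennreal ((jump \<alpha> f ((1 / R) *\<^sub>R x, y))\<^sup>2) \<partial>lborel)) \<partial>lborel)"
  proof (intro nn_integral_cong)
    fix x :: 'a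
    have m: "(\<lambda>y. ennreal ((jump \<alpha> f ((1 / R) *\<^sub>R x, y))\<^sup>2)) \<in> borel_measurable borel" by measurable
    have m': "(\<lambda>y. ennreal ((jump \<alpha> f ((1 / R) *\<^sub>R x, (1 / R) *\<^sub>R y))\<^sup>2)) \<in> borel_measurable lborel" by measurable
    show "(\<integral>\<^sup>+y. ennreal (R powr - (?d + \<alpha>)) * ennreal ((jump \<alpha> f ((1 / R) *\<^sub>R x, (1 / R) *\<^sub>R y))\<^sup>2) \<partial>lborel) =
        ennreal (R powr - (?d + \<alpha>)) * (ennreal (R ^ DIM('a)) *
          (\<integral>\<^sup>+y. ennreal ((jump \<alpha> f ((1 / R) *\<^sub>R x, y))\<^sup>2) \<partial>lborel))"
      unfolding nn_integral_cmult[OF m'] nn_integral_dilate[OF m R] ..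
  qed
  also have "\<dots> = ennreal (R powr - (?d + \<alpha>)) * (ennreal (R ^ DIM('a)) *
      (\<integral>\<^sup>+x. \<integral>\<^sup>+y. ennreal ((jump \<alpha> f ((1 / R) *\<^sub>R x, y))\<^sup>2) \<partial>lborel \<partial>lborel))"
    by (subst nn_integral_cmult, measurable, subst nn_integral_cmult, measurable)
  also have "(\<integral>\<^sup>+x. \<integral>\<^sup>+y. ennreal ((jump \<alpha> f ((1 / R) *\<^sub>R x, y))\<^sup>2) \<partial>lborel \<partial>lborel) =
      ennreal (R ^ DIM('a)) * (\<integral>\<^sup>+x. \<integral>\<^sup>+y. ennreal ((jump \<alpha> f (x, y))\<^sup>2) \<partial>lborel \<partial>lborel)"
  proof (rule nn_integral_dilate[OF _ R])
    have "(\<lambda>x. \<integral>\<^sup>+y. ennreal ((jump \<alpha> f (x, y))\<^sup>2) \<partial>lborel) \<in> borel_measurable lborel" by measurable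
    then show "(\<lambda>x. \<integral>\<^sup>+y. ennreal ((jump \<alpha> f (x, y))\<^sup>2) \<partial>lborel) \<in> borel_measurable borel" by simp
  qed
  also have "(\<integral>\<^sup>+x. \<integral>\<^sup>+y. ennreal ((jump \<alpha> f (x, y))\<^sup>2) \<partial>lborel \<partial>lborel) = (\<integral>\<^sup>+z. ennreal ((jump \<alpha> f z)\<^sup>2) \<partial>?L)"
    by (rule lborel.nn_integral_fst) measurable
  finally have "ennreal (2 * stable_form \<alpha> (dilate R f) (dilate R f)) =
      ennreal (R powr - (?d + \<alpha>)) * (ennreal (R ^ DIM('a)) * (ennreal (R ^ DIM('a)) * ennreal (2 * stable_form \<alpha> f f)))"
    by (simp only: stable_form_nn[OF f] stable_form_nn[OF fR])
  also have "\<dots> = ennreal (R powr - (?d + \<alpha>) * (R ^ DIM('a) * (R ^ DIM('a) * (2 * stable_form \<alpha> f f))))"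
    using R D.ip_nonneg[OF f] by (simp add: ennreal_mult)
  finally have "2 * stable_form \<alpha> (dilate R f) (dilate R f) =
      R powr - (?d + \<alpha>) * (R ^ DIM('a) * (R ^ DIM('a) * (2 * stable_form \<alpha> f f)))"
    using R D.ip_nonneg[OF f] D.ip_nonneg[OF fR] by (subst (asm) ennreal_inj) auto
  moreover have "R powr - (?d + \<alpha>) * (R ^ DIM('a) * R ^ DIM('a)) = R powr (?d - \<alpha>)"
  proof -
    have "R ^ DIM('a) = R powr ?d" using R by (simp add: powr_realpow)
    then show ?thesis using R by (simp flip: powr_add)
  qed
  ultimately show ?thesis by (simp add: mult.assoc[symmetric])
qed

lemma dilate_tent_stable_dom:
  assumes R: "0 < R"
  shows "dilate R (tent :: 'a::euclidean_space \<Rightarrow> real) \<in> stable_dom \<alpha>"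
proof (rule Lipschitz_stable_dom)
  show "\<bar>dilate R tent x - dilate R tent y\<bar> \<le> 2 / R * norm (x - y)" for x y :: 'a
    by (rule dilate_tent_Lipschitz[OF R])
  show "\<bar>dilate R tent x\<bar> \<le> 1" for x :: 'a
    using tent_bounds[of "(1 / R) *\<^sub>R x"] by (simp add: dilate_def)
  show "dilate R tent x = 0" if "x \<notin> ball 0 (2 * R)" for x :: 'a
    using dilate_tent_support(2)[OF R, of x] that by auto
qed

lemma stable_dom_time_changed:
  fixes f :: "'a::euclidean_space \<Rightarrow> real"
  assumes f: "f \<in> stable_dom \<alpha>" and \<beta>: "0 \<le> \<beta>"
  shows "f \<in> time_changed_dom \<alpha> \<beta>"
proof -
  have fL: "f \<in> L2 lborel" by (rule stable_domD(2)[OF f])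
  have m: "f \<in> borel_measurable borel" using L2_measurable[OF fL] by simp
  have "(\<integral>\<^sup>+x. ennreal ((f x)\<^sup>2) \<partial>weighted_measure \<beta>) =
      (\<integral>\<^sup>+x. ennreal ((1 + norm x) powr - \<beta>) * ennreal ((f x)\<^sup>2) \<partial>lborel)"
    using m by (intro nn_integral_weighted_measure) simp
  also have "\<dots> \<le> (\<integral>\<^sup>+x. 1 * ennreal ((f x)\<^sup>2) \<partial>lborel)"
    using weight_le_1[OF \<beta>] by (intro nn_integral_mono mult_right_mono) (auto simp: ennreal_le_1)
  also have "\<dots> = ennreal (L2_inner lborel f f)" by (simp add: L2_inner_self_nn[OF fL])
  finally have "f \<in> L2 (weighted_measure \<beta>)"
    using m L2.ip_nonneg[OF fL] by (intro L2_if_nn_integral_finite(1)) (auto cong: measurable_cong_sets)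
  then show ?thesis
    using stable_dom_extended[OF f] by (simp add: time_changed_dom_def)
qed

text \<open>On the support \<open>1 + norm x \<le> 3 * R\<close>, since \<open>R \<ge> 1\<close>, so
  the weight is at least \<open>(3 * R) powr - \<beta>\<close>. Only this lower bound on the mass is
  needed, as the mass will be a denominator.\<close>

lemma dilate_tent_weighted:
  assumes \<beta>: "0 \<le> \<beta>" and R: "1 \<le> R"
  shows "R powr (real DIM('a) - \<beta>) * (3 powr - \<beta> * L2_inner lborel tent (tent :: 'a::euclidean_space \<Rightarrow> real)) \<le>
    L2_inner (weighted_measure \<beta>) (dilate R tent) (dilate R (tent :: 'a \<Rightarrow> real))"
proof -
  let ?f = "dilate R (tent :: 'a \<Rightarrow> real)"
  have R0: "0 < R" using R by simp
  have tL: "(tent :: 'a \<Rightarrow> real) \<in> L2 lborel"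
    using stable_domD(2)[OF dilate_tent_stable_dom[of 1]] by (simp add: dilate_one)
  have tm: "(\<lambda>x :: 'a. ennreal ((tent x)\<^sup>2)) \<in> borel_measurable borel" using L2_measurable[OF tL] by simp
  have fF: "?f \<in> time_changed_dom \<alpha> \<beta>" by (intro stable_dom_time_changed dilate_tent_stable_dom R0 \<beta>)
  have fL: "?f \<in> L2 (weighted_measure \<beta>)" using fF by (simp add: time_changed_dom_def)
  have fm [measurable]: "?f \<in> borel_measurable borel" using L2_measurable[OF fL] by (simp cong: measurable_cong_sets)
  have pt: "(3 * R) powr - \<beta> * (?f x)\<^sup>2 \<le> (1 + norm x) powr - \<beta> * (?f x)\<^sup>2" for x
  proof (cases "?f x = 0")
    case False
    then have "norm x < 2 * R" by (rule dilate_tent_support(2)[OF R0])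
    then have "1 + norm x \<le> 3 * R" using R by simp
    then have "(3 * R) powr - \<beta> \<le> (1 + norm x) powr - \<beta>"
      using \<beta> norm_ge_zero[of x] by (intro powr_mono2') (auto intro: add_pos_nonneg)
    then show ?thesis by (rule mult_right_mono) simp
  qed simp
  have "ennreal ((3 * R) powr - \<beta>) * (ennreal (R ^ DIM('a)) * ennreal (L2_inner lborel tent (tent :: 'a \<Rightarrow> real))) =
      ennreal ((3 * R) powr - \<beta>) * (\<integral>\<^sup>+x. ennreal ((?f x)\<^sup>2) \<partial>lborel)"
    using nn_integral_dilate[OF tm R0] by (simp add: dilate_def L2_inner_self_nn[OF tL])
  also have "\<dots> = (\<integral>\<^sup>+x. ennreal ((3 * R) powr - \<beta> * (?f x)\<^sup>2) \<partial>lborel)"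
    by (subst nn_integral_cmult[symmetric]) (auto simp: ennreal_mult)
  also have "\<dots> \<le> (\<integral>\<^sup>+x. ennreal ((1 + norm x) powr - \<beta> * (?f x)\<^sup>2) \<partial>lborel)"
    by (intro nn_integral_mono ennreal_leI pt)
  also have "\<dots> = ennreal (L2_inner (weighted_measure \<beta>) ?f ?f)"
    unfolding L2_inner_self_nn[OF fL] by (subst nn_integral_weighted_measure) (auto simp: ennreal_mult)
  finally have "(3 * R) powr - \<beta> * (R ^ DIM('a) * L2_inner lborel tent (tent :: 'a \<Rightarrow> real)) \<le>
      L2_inner (weighted_measure \<beta>) ?f ?f"
    using R0 L2.ip_nonneg[OF tL] L2.ip_nonneg[OF fL]
    by (simp add: ennreal_le_iff flip: ennreal_mult)
  moreover have "(3 * R) powr - \<beta> * R ^ DIM('a) = R powr (real DIM('a) - \<beta>) * 3 powr - \<beta>"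
  proof -
    have "R ^ DIM('a) = R powr real DIM('a)" using R0 by (simp add: powr_realpow)
    then show ?thesis using R0 by (simp add: powr_mult powr_diff powr_minus field_simps)
  qed
  ultimately show ?thesis by (simp flip: mult.assoc)
qed

lemma separated_sequence:
  assumes \<beta>: "0 \<le> \<beta>" "\<beta> \<le> \<alpha>"
  obtains f :: "nat \<Rightarrow> 'a::euclidean_space \<Rightarrow> real" and C where
    "\<And>n. f n \<in> time_changed_dom \<alpha> \<beta>" "\<And>n. stable_form \<alpha> (f n) (f n) \<le> C"
    "\<And>n. L2.nrm (weighted_measure \<beta>) (f n) = 1"
    "\<And>m n. m \<noteq> n \<Longrightarrow> 1 \<le> L2.nrm (weighted_measure \<beta>) (f m - f n)"
proof -
  let ?M = "weighted_measure \<beta> :: 'a measure" and ?t = "tent :: 'a \<Rightarrow> real"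
  have td: "?t \<in> stable_dom \<alpha>" using dilate_tent_stable_dom[of 1] by (simp add: dilate_one)
  have tL: "?t \<in> L2 lborel" and te: "?t \<in> finite_energy \<alpha>" using td by (auto intro: stable_domD)
  define I where "I = 3 powr - \<beta> * L2_inner lborel ?t ?t"
  have I: "0 < I" using tent_sq_pos[OF tL] by (simp add: I_def)
  define R where "R n = (2::real) ^ n" for n :: nat
  have R: "1 \<le> R n" "0 < R n" for n by (simp_all add: R_def)
  define \<phi> where "\<phi> n = dilate (R n) ?t" for n
  have \<phi>d: "\<phi> n \<in> stable_dom \<alpha>" for n unfolding \<phi>_def by (intro dilate_tent_stable_dom R)
  have \<phi>F: "\<phi> n \<in> time_changed_dom \<alpha> \<beta>" for n by (intro stable_dom_time_changed \<phi>d \<beta>)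
  have \<phi>L: "\<phi> n \<in> L2 ?M" and \<phi>e: "\<phi> n \<in> finite_energy \<alpha>" for n
    using \<phi>F[of n] stable_domD[OF \<phi>d, of n] by (auto simp: time_changed_dom_def)
  define N where "N n = L2_inner ?M (\<phi> n) (\<phi> n)" for n
  have N: "R n powr (real DIM('a) - \<beta>) * I \<le> N n" for n
    unfolding N_def I_def \<phi>_def by (rule dilate_tent_weighted[OF \<beta>(1) R(1)])
  have Np: "0 < N n" for n
  proof -
    have "0 < R n powr (real DIM('a) - \<beta>) * I" using I R(2)[of n] by simp
    then show ?thesis using N[of n] by linarith
  qed
  define f where "f n = (1 / sqrt (N n)) *\<^sub>R \<phi> n" for n
  have fF: "f n \<in> time_changed_dom \<alpha> \<beta>" for n
    unfolding f_def by (intro subspace_scale[OF subspace_time_changed_dom] \<phi>F)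
  have fL: "f n \<in> L2 ?M" for n using fF[of n] by (simp add: time_changed_dom_def)
  have one: "L2_inner ?M (f n) (f n) = 1" for n
    unfolding f_def using Np[of n] \<phi>L[of n] by (simp add: L2.ip_simps flip: N_def)
  have orth: "L2_inner ?M (f m) (f n) = 0" if "m < n" for m n
  proof -
    have "\<phi> m x * \<phi> n x = 0" for x
    proof (rule ccontr)
      assume "\<not> ?thesis"
      then have "norm x < 2 * R m" "R n < norm x"
        using dilate_tent_support[OF R(2), of m x] dilate_tent_support[OF R(2), of n x] by (auto simp: \<phi>_def)
      \<comment> \<open>Consecutive dyadic shells just touch, so the open supports are
        disjoint.\<close>
      moreover have "2 * R m \<le> R n"
        unfolding R_def power_Suc[symmetric] using that by (intro power_increasing) auto
      ultimately show False by linarith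
    qed
    then have eq: "(\<lambda>x. f m x * f n x) = (\<lambda>x. 0)" unfolding f_def by (intro ext) simp
    show ?thesis unfolding L2_inner_def eq by simp
  qed
  show thesis
  proof (rule that[of f "stable_form \<alpha> ?t ?t / I"])
    show "f n \<in> time_changed_dom \<alpha> \<beta>" for n by (rule fF)
    show "L2.nrm ?M (f n) = 1" for n by (simp add: L2.nrm_def one)
    show "1 \<le> L2.nrm ?M (f m - f n)" if "m \<noteq> n" for m n
    proof -
      have "L2_inner ?M (f m) (f n) = 0" "L2_inner ?M (f n) (f m) = 0"
        using orth[of m n] orth[of n m] that L2.ip_commute[OF fL fL, of m n] by (cases "m < n"; simp)+
      then have "L2_inner ?M (f m - f n) (f m - f n) = 2" by (simp add: L2.ip_simps fL one)
      then show ?thesis by (simp add: L2.nrm_def)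
    qed
    fix n
    have "stable_form \<alpha> (f n) (f n) = stable_form \<alpha> (\<phi> n) (\<phi> n) / N n"
      unfolding f_def using \<phi>e[of n] Np[of n] by (simp add: D.ip_simps)
    also have "stable_form \<alpha> (\<phi> n) (\<phi> n) = R n powr (real DIM('a) - \<alpha>) * stable_form \<alpha> ?t ?t"
      unfolding \<phi>_def by (rule stable_form_dilate[OF te \<phi>e[unfolded \<phi>_def] R(2)])
    \<comment> \<open>Here \<open>\<beta> \<le> \<alpha>\<close> and \<open>R n \<ge> 1\<close> give
      the energy the exponent of the lower bound for the mass; the powers of \<open>R n\<close> then
      cancel in the quotient.\<close>
    also have "\<dots> \<le> R n powr (real DIM('a) - \<beta>) * stable_form \<alpha> ?t ?t"
      using R(1)[of n] \<beta>(2) by (intro mult_right_mono powr_mono D.ip_nonneg[OF te]) auto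
    finally have "stable_form \<alpha> (f n) (f n) \<le> R n powr (real DIM('a) - \<beta>) * stable_form \<alpha> ?t ?t / N n"
      using Np[of n] by (simp add: divide_right_mono)
    also have "\<dots> \<le> R n powr (real DIM('a) - \<beta>) * stable_form \<alpha> ?t ?t / (R n powr (real DIM('a) - \<beta>) * I)"
      using N[of n] Np[of n] I R(2)[of n] D.ip_nonneg[OF te] by (intro divide_left_mono) auto
    also have "\<dots> = stable_form \<alpha> ?t ?t / I" using R(2)[of n] by simp
    finally show "stable_form \<alpha> (f n) (f n) \<le> stable_form \<alpha> ?t ?t / I" .
  qed
qed

section \<open>The criterion for compactness\<close>

lemma extended_form_self: "f \<in> time_changed_dom \<alpha> \<beta> \<Longrightarrow> extended_form \<alpha> f f = stable_form \<alpha> f f"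
  by (rule extended_form_eq) (auto simp: time_changed_dom_def)

text \<open>Density holds because the Lipschitz functions of bounded support lie in the form domain
  and already separate weighted functions.\<close>

lemma compact_closed_form_extended_form:
  assumes dim: "\<alpha> < real DIM('a::euclidean_space)" and \<beta>: "\<alpha> < \<beta>"
  shows "compact_closed_form (L2 (weighted_measure \<beta>)) (L2_inner (weighted_measure \<beta>))
    (time_changed_dom \<alpha> \<beta> :: ('a \<Rightarrow> real) set) (extended_form \<alpha>)"
proof -
  let ?M = "weighted_measure \<beta> :: 'a measure" and ?F = "time_changed_dom \<alpha> \<beta> :: ('a \<Rightarrow> real) set"
  interpret closed_form "L2 ?M" "L2_inner ?M" ?F "extended_form \<alpha>"
    by (rule closed_form_extended_form[OF dim])
  have b0: "0 \<le> \<beta>" using \<alpha>_pos \<beta> by simp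
  show ?thesis
  proof
    fix u :: "nat \<Rightarrow> 'a \<Rightarrow> real" and C
    assume u: "\<And>n. u n \<in> ?F" and E: "\<And>n. extended_form \<alpha> (u n) (u n) \<le> C"
      and N: "\<And>n. L2_inner ?M (u n) (u n) \<le> C"
    show "\<exists>r g. strict_mono r \<and> g \<in> L2 ?M \<and> L2.conv ?M (\<lambda>n. u (r n)) g"
    proof (rule compact_embedding_time_changed[OF dim \<beta> u _ N])
      show "stable_form \<alpha> (u n) (u n) \<le> C" for n using E[of n] extended_form_self[OF u] by simp
    qed
  next
    fix f assume f: "f \<in> L2 ?M" and orth: "\<And>v. v \<in> ?F \<Longrightarrow> L2_inner ?M f v = 0"
    have "AE x in lborel. f x = 0"
    proof (rule weighted_null_if_orthogonal[OF f b0])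
      fix \<phi> :: "'a \<Rightarrow> real" and L R
      assume "\<And>x y. \<bar>\<phi> x - \<phi> y\<bar> \<le> L * norm (x - y)" "\<And>x. \<bar>\<phi> x\<bar> \<le> 1" "\<And>x. x \<notin> ball 0 R \<Longrightarrow> \<phi> x = 0"
      then have "\<phi> \<in> stable_dom \<alpha>" by (rule Lipschitz_stable_dom)
      then show "L2_inner ?M f \<phi> = 0" by (intro orth stable_dom_time_changed b0)
    qed
    then have "AE x in ?M. f x = 0 x" by (simp add: AE_weighted_measure)
    then have "L2_norm ?M (f - 0) = 0" using f by (subst L2_norm_diff_eq_0_iff) auto
    then show "L2.nrm ?M f = 0" by (simp add: nrm_L2)
  qed
qed

end

theorem corollary2p3:
  fixes \<alpha> \<beta> :: real
  assumes "0 < \<alpha>" and "\<alpha> < 2" and "\<alpha> < real DIM('a::euclidean_space)" and "0 \<le> \<beta>"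
  shows "generates_compact_semigroup (weighted_measure \<beta> :: 'a measure) (L0_operator \<alpha> \<beta>)
           \<longleftrightarrow> \<beta> > \<alpha>"
proof -
  let ?M = "weighted_measure \<beta> :: 'a measure" and ?F = "time_changed_dom \<alpha> \<beta> :: ('a \<Rightarrow> real) set"
  have cf: "closed_form (L2 ?M) (L2_inner ?M) ?F (extended_form \<alpha>)"
    by (rule closed_form_extended_form[OF assms(1-3)])
  interpret closed_form "L2 ?M" "L2_inner ?M" ?F "extended_form \<alpha>" by (rule cf)
  have L0: "L0_operator \<alpha> \<beta> = form_operator"
    unfolding L0_operator_def by (rule form_generator_eq[OF cf])
  show ?thesis
  proof
    assume "generates_compact_semigroup ?M (L0_operator \<alpha> \<beta>)"
    then obtain P where P: "L2_C0_semigroup ?M P" and gen: "semigroup_generator ?M P = form_operator"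
      and compact: "\<And>t. 0 < t \<Longrightarrow> L2_compact_operator ?M (P t)"
      unfolding generates_compact_semigroup_def L0 by blast
    show "\<beta> > \<alpha>"
    proof (rule ccontr)
      assume "\<not> \<beta> > \<alpha>"
      then have "\<beta> \<le> \<alpha>" by simp
      from separated_sequence[OF assms(1,2,4) this]
      obtain f :: "nat \<Rightarrow> 'a \<Rightarrow> real" and C where f: "\<And>n. f n \<in> ?F"
        and C: "\<And>n. stable_form \<alpha> (f n) (f n) \<le> C" and n1: "\<And>n. L2.nrm ?M (f n) = 1"
        and sep: "\<And>m n. m \<noteq> n \<Longrightarrow> 1 \<le> L2.nrm ?M (f m - f n)" by metis
      show False
      proof (rule not_compact_semigroup[of P f C 1])
        show "c0_semigroup (L2 ?M) (L2_inner ?M) P" using P by (simp add: L2_C0_semigroup_iff)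
        show "form_operator \<subseteq> c0_semigroup.generator (L2 ?M) (L2_inner ?M) P"
          using gen semigroup_generator_eq[OF P] by simp
        show "\<exists>r g. strict_mono r \<and> g \<in> L2 ?M \<and> L2.conv ?M (\<lambda>n. P t (x (r n))) g"
          if "0 < t" "\<And>n. x n \<in> L2 ?M" "bounded (range (\<lambda>n. L2.nrm ?M (x n)))" for t and x :: "nat \<Rightarrow> 'a \<Rightarrow> real"
          using compact[OF that(1)] compact_operator_iff[OF P, of t] that by simp
        show "extended_form \<alpha> (f n) (f n) \<le> C" for n using C extended_form_self[OF assms(1,2) f] by simp
      qed (use f n1 sep in auto)
    qed
  next
    assume "\<beta> > \<alpha>"
    then interpret compact_closed_form "L2 ?M" "L2_inner ?M" ?F "extended_form \<alpha>"
      by (rule compact_closed_form_extended_form[OF assms(1-3)])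
    obtain P where P: "c0_semigroup (L2 ?M) (L2_inner ?M) P"
      "c0_semigroup.generator (L2 ?M) (L2_inner ?M) P = form_operator"
      and compact: "\<And>t (f :: nat \<Rightarrow> 'a \<Rightarrow> real). 0 < t \<Longrightarrow> (\<And>n. f n \<in> L2 ?M) \<Longrightarrow>
        bounded (range (\<lambda>n. L2.nrm ?M (f n))) \<Longrightarrow>
        \<exists>r g. strict_mono r \<and> g \<in> L2 ?M \<and> L2.conv ?M (\<lambda>n. P t (f (r n))) g"
      using compact_semigroup by metis
    have P': "L2_C0_semigroup ?M P" using P(1) by (simp add: L2_C0_semigroup_iff)
    show "generates_compact_semigroup ?M (L0_operator \<alpha> \<beta>)"
      unfolding generates_compact_semigroup_def
    proof (intro exI conjI allI impI)
      show "L2_C0_semigroup ?M P" by (rule P')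
      show "semigroup_generator ?M P = L0_operator \<alpha> \<beta>"
        using P(2) by (simp add: semigroup_generator_eq[OF P'] L0)
      show "L2_compact_operator ?M (P t)" if "0 < t" for t
        using compact_operator_iff[OF P', of t] compact[OF that] that by simp
    qed
  qed
qed

end
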